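(* Let $E$ be a Banach space, $P\in\mathcal{P}(E)$, and let $\varphi_P\colon\pi_1(\mathcal{P}(\mathcal{C}(E)),p(P))\to\mathbb{Z}$ be the homomorphism defined in the context. (h1) For an integer $m$, one has $m\in\operatorname{Im}(\varphi_P)$ if and only if there exists a projector $Q$ in the same connected component of $\mathcal{P}(E)$ as $P$ such that $Q-P$ is compact and $\dim(\operatorname{Range}Q,\operatorname{Range}P)=m$. (h2) If the connected component of $P$ in $\mathcal{P}(E)$ is simply connected, then $\varphi_P$ is injective.
   Context: $\mathcal{L}(E)$ is the algebra of bounded operators on $E$, $\mathcal{L}_c(E)$ the ideal of compact operators, $\mathcal{C}(E)=\mathcal{L}(E)/\mathcal{L}_c(E)$ the Calkin algebra, $p$ the quotient map. For a unital Banach algebra $\mathcal{B}$, $\mathcal{P}(\mathcal{B})=\{x\in\mathcal{B}:x^2=x\}$ with the norm topology, and $\mathcal{P}(E)=\mathcal{P}(\mathcal{L}(E))$. Relative dimension: two closed complemented subspaces $X,Y\subset E$ are compact perturbation of each other if, for projectors $P_X,P_Y$ with ranges $X,Y$, the operators $(I-P_X)P_Y$ and $(I-P_Y)P_X$ are compact (this does not depend on the choice of projectors). Then the restriction $P_Y|_X\colon X\to Y$ is Fredholm and $\dim(X,Y):=\operatorname{ind}(P_Y|_X\colon X\to Y)$, which does not depend on the choice of projectors. If $Q-P$ is compact, then $\operatorname{Range}Q$ and $\operatorname{Range}P$ are compact perturbation of each other. Definition of $\varphi_P$: the map $p\colon\mathcal{P}(E)\to\mathcal{P}(\mathcal{C}(E))$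 is a locally trivial bundle. Given a loop $a$ in $\mathcal{P}(\mathcal{C}(E))$ based at $p(P)$, choose a continuous path $\beta\colon[0,1]\to\mathcal{P}(E)$ with $\beta(0)=P$ and $p\circ\beta=a$; then $\beta(1)-\beta(0)$ is compact and $\varphi_P([a])=\dim(\operatorname{Range}\beta(1),\operatorname{Range}\beta(0))$. This is well defined on homotopy classes and is a group homomorphism. *)

theory Defs
  imports "HOL-Analysis.Analysis" "HOL-Algebra.QuotRing"
begin

section \<open>Banach spaces and bounded operators\<close>

text \<open>
  A Banach space over the reals or over the complex numbers. The scalar field is a type \<open>'k\<close>:
  a finite-dimensional \<open>real_normed_field\<close> is, up to isometric isomorphism, either \<open>real\<close> or
  \<open>complex\<close>, and both are instances. The class \<open>banach\<close> only provides the underlying real Banach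
  space, so the scalar multiplication of \<open>E\<close> is the explicit parameter \<open>scl\<close>; for a real Banach
  space it is \<open>scaleR\<close>.
\<close>
locale banach_space_over = vector_space scl
  for scl :: "'k::{real_normed_field, euclidean_space} \<Rightarrow> 'a::banach \<Rightarrow> 'a" +
  assumes scale_of_real: "scl (of_real r) x = r *\<^sub>R x"
    and norm_scale: "norm (scl c x) = norm c * norm x"

lemma banach_space_over_scaleR: "banach_space_over (scaleR :: real \<Rightarrow> 'a::banach \<Rightarrow> 'a)"
  by unfold_locales (auto simp: algebra_simps)

definition bounded_ops :: "('k::{real_normed_field, euclidean_space} \<Rightarrow> 'a::banach \<Rightarrow> 'a)
    \<Rightarrow> ('a \<Rightarrow>\<^sub>L 'a) ring" where
  "bounded_ops scl =
    \<lparr>carrier = {T. \<forall>c x. blinfun_apply T (scl c x) = scl c (blinfun_apply T x)},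
     mult = (o\<^sub>L), one = id_blinfun, zero = 0, add = (+)\<rparr>"

definition compact_op :: "('a::banach \<Rightarrow>\<^sub>L 'a) \<Rightarrow> bool" where
  "compact_op T \<longleftrightarrow> compact (closure (blinfun_apply T ` cball 0 1))"

definition compact_ops :: "('k::{real_normed_field, euclidean_space} \<Rightarrow> 'a::banach \<Rightarrow> 'a)
    \<Rightarrow> ('a \<Rightarrow>\<^sub>L 'a) set" where
  "compact_ops scl = {T \<in> carrier (bounded_ops scl). compact_op T}"

definition idempotents :: "('b, 'm) ring_scheme \<Rightarrow> 'b set" where
  "idempotents R = {x \<in> carrier R. x \<otimes>\<^bsub>R\<^esub> x = x}"

abbreviation projectors :: "('k::{real_normed_field, euclidean_space} \<Rightarrow> 'a::banach \<Rightarrow> 'a)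
    \<Rightarrow> ('a \<Rightarrow>\<^sub>L 'a) set" where
  "projectors scl \<equiv> idempotents (bounded_ops scl)"


section \<open>The Calkin algebra\<close>

definition calkin :: "('k::{real_normed_field, euclidean_space} \<Rightarrow> 'a::banach \<Rightarrow> 'a)
    \<Rightarrow> ('a \<Rightarrow>\<^sub>L 'a) set ring" where
  "calkin scl = bounded_ops scl Quot compact_ops scl"

definition calkin_proj :: "('k::{real_normed_field, euclidean_space} \<Rightarrow> 'a::banach \<Rightarrow> 'a)
    \<Rightarrow> ('a \<Rightarrow>\<^sub>L 'a) \<Rightarrow> ('a \<Rightarrow>\<^sub>L 'a) set" where
  "calkin_proj scl T = compact_ops scl +>\<^bsub>bounded_ops scl\<^esub> T"

text \<open>
  The elements of the Calkin algebra are cosets of the compact operators. The distance of two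
  cosets as sets of operators is the quotient norm of their difference; see
  \<open>setdist_calkin_proj\<close> below.
\<close>
definition calkin_topology :: "('k::{real_normed_field, euclidean_space} \<Rightarrow> 'a::banach \<Rightarrow> 'a)
    \<Rightarrow> ('a \<Rightarrow>\<^sub>L 'a) set topology" where
  "calkin_topology scl = Metric_space.mtopology (carrier (calkin scl)) setdist"

definition calkin_idempotents :: "('k::{real_normed_field, euclidean_space} \<Rightarrow> 'a::banach \<Rightarrow> 'a)
    \<Rightarrow> ('a \<Rightarrow>\<^sub>L 'a) set topology" where
  "calkin_idempotents scl = subtopology (calkin_topology scl) (idempotents (calkin scl))"


section \<open>Relative dimension\<close>

text \<open>The dimension of \<open>V / W\<close>, computed as the dimension of an algebraic complement of \<open>W\<close> in \<open>V\<close>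
  (all complements are isomorphic to \<open>V / W\<close>).\<close>
definition codim_in :: "('k::field \<Rightarrow> 'a::ab_group_add \<Rightarrow> 'a) \<Rightarrow> 'a set \<Rightarrow> 'a set \<Rightarrow> nat" where
  "codim_in scl W V = (THE n. \<exists>C. module.subspace scl C \<and> W \<inter> C = {0} \<and>
     V = {w + c | w c. w \<in> W \<and> c \<in> C} \<and> vector_space.dim scl C = n)"

text \<open>The index of the restriction \<open>T : X \<rightarrow> Y\<close>, when this is Fredholm.\<close>
definition fredholm_index :: "('k::field \<Rightarrow> 'a::ab_group_add \<Rightarrow> 'a)
    \<Rightarrow> 'a set \<Rightarrow> 'a set \<Rightarrow> ('a \<Rightarrow> 'a) \<Rightarrow> int" where
  "fredholm_index scl X Y T =
     int (vector_space.dim scl {x \<in> X. T x = 0}) - int (codim_in scl (T ` X) Y)"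

text \<open>\<open>dim (X, Y)\<close> for closed complemented subspaces \<open>X\<close>, \<open>Y\<close> that are compact perturbation of
  each other; the value then does not depend on the projector \<open>P\<close> onto \<open>Y\<close>.\<close>
definition relative_dim :: "('k::{real_normed_field, euclidean_space} \<Rightarrow> 'a::banach \<Rightarrow> 'a)
    \<Rightarrow> 'a set \<Rightarrow> 'a set \<Rightarrow> int" where
  "relative_dim scl X Y = (THE m. \<exists>P \<in> projectors scl.
     range (blinfun_apply P) = Y \<and> m = fredholm_index scl X Y (blinfun_apply P))"


section \<open>Fundamental group and the index homomorphism\<close>

definition loops :: "'b topology \<Rightarrow> 'b \<Rightarrow> (real \<Rightarrow> 'b) set" where
  "loops X x0 = {a. pathin X a \<and> a 0 = x0 \<and> a 1 = x0}"

definition loop_homotopy :: "'b topology \<Rightarrow> 'b \<Rightarrow> ((real \<Rightarrow> 'b) \<times> (real \<Rightarrow> 'b)) set" where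
  "loop_homotopy X x0 = {(a, b). a \<in> loops X x0 \<and> b \<in> loops X x0 \<and>
     homotopic_with (\<lambda>r. r 0 = x0 \<and> r 1 = x0) (top_of_set {0..1}) X a b}"

text \<open>The underlying set of the fundamental group.\<close>
definition pi1 :: "'b topology \<Rightarrow> 'b \<Rightarrow> (real \<Rightarrow> 'b) set set" where
  "pi1 X x0 = loops X x0 // loop_homotopy X x0"

text \<open>The value on a homotopy class \<open>c\<close> depends neither on the representative loop \<open>a\<close> nor on its
  lift \<open>b\<close>, which is what the definite description encodes.\<close>
definition phi :: "('k::{real_normed_field, euclidean_space} \<Rightarrow> 'a::banach \<Rightarrow> 'a)
    \<Rightarrow> ('a \<Rightarrow>\<^sub>L 'a) \<Rightarrow> (real \<Rightarrow> ('a \<Rightarrow>\<^sub>L 'a) set) set \<Rightarrow> int" where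
  "phi scl P c = (THE m. \<exists>a \<in> c. \<exists>b. path b \<and> path_image b \<subseteq> projectors scl \<and> b 0 = P \<and>
     (\<forall>t \<in> {0..1}. calkin_proj scl (b t) = a t) \<and>
     m = relative_dim scl (range (blinfun_apply (b 1))) (range (blinfun_apply (b 0))))"


section \<open>The Calkin algebra is a ring and its norm topology is metric\<close>

lemma compact_op_iff_totally_bounded:
  "compact_op T \<longleftrightarrow>
    (\<forall>e>0. \<exists>k. finite k \<and> blinfun_apply T ` cball 0 1 \<subseteq> (\<Union>x\<in>k. ball x e))"
    (is "_ \<longleftrightarrow> ?R")
proof
  assume "compact_op T"
  then have "\<forall>e>0. \<exists>k. finite k \<and> closure (blinfun_apply T ` cball 0 1) \<subseteq> (\<Union>x\<in>k. ball x e)"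
    unfolding compact_op_def compact_eq_totally_bounded by blast
  then show ?R by (meson closure_subset order_trans)
next
  assume R: ?R
  show "compact_op T"
    unfolding compact_op_def compact_eq_totally_bounded
  proof (intro conjI allI impI)
    show "complete (closure (blinfun_apply T ` cball 0 1))"
      by (simp add: complete_eq_closed)
    fix e :: real assume "e > 0"
    then obtain k where k: "finite k" "blinfun_apply T ` cball 0 1 \<subseteq> (\<Union>x\<in>k. ball x (e/2))"
      using R half_gt_zero by blast
    then have "blinfun_apply T ` cball 0 1 \<subseteq> (\<Union>x\<in>k. cball x (e/2))"
      using ball_subset_cball by blast
    moreover have "closed (\<Union>x\<in>k. cball x (e/2))" using k by blast
    ultimately have "closure (blinfun_apply T ` cball 0 1) \<subseteq> (\<Union>x\<in>k. cball x (e/2))"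
      by (rule closure_minimal)
    also have "\<dots> \<subseteq> (\<Union>x\<in>k. ball x e)" using \<open>e > 0\<close> by force
    finally show "\<exists>k. finite k \<and> closure (blinfun_apply T ` cball 0 1) \<subseteq> (\<Union>x\<in>k. ball x e)"
      using k by blast
  qed
qed

lemma compact_op_limit:
  assumes "\<And>e. e > 0 \<Longrightarrow> \<exists>S. compact_op S \<and> norm (T - S) < e"
  shows "compact_op T"
  unfolding compact_op_iff_totally_bounded
proof (intro allI impI)
  fix e :: real assume "e > 0"
  then obtain S where S: "compact_op S" "norm (T - S) < e/2"
    using assms half_gt_zero by blast
  then obtain k where k: "finite k" "blinfun_apply S ` cball 0 1 \<subseteq> (\<Union>x\<in>k. ball x (e/2))"
    using \<open>e > 0\<close> unfolding compact_op_iff_totally_bounded by (meson half_gt_zero)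
  have "blinfun_apply T ` cball 0 1 \<subseteq> (\<Union>x\<in>k. ball x e)"
  proof clarify
    fix x :: 'a assume x: "x \<in> cball 0 1"
    then obtain y where y: "y \<in> k" "dist y (S x) < e/2" using k by fastforce
    have "dist (S x) (T x) = norm ((T - S) x)"
      by (simp add: dist_norm norm_minus_commute blinfun.diff_left)
    also have "\<dots> \<le> norm (T - S) * norm x" by (rule norm_blinfun)
    also have "\<dots> \<le> norm (T - S)" using x by (simp add: mult_left_le)
    finally have "dist y (T x) < e" using S y dist_triangle[of y "T x" "S x"] by linarith
    then show "T x \<in> (\<Union>x\<in>k. ball x e)" using y by auto
  qed
  then show "\<exists>k. finite k \<and> blinfun_apply T ` cball 0 1 \<subseteq> (\<Union>x\<in>k. ball x e)"
    using k by blast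
qed

lemma compact_opI:
  assumes "compact C" "blinfun_apply T ` cball 0 1 \<subseteq> C"
  shows "compact_op T"
proof -
  have "closure (blinfun_apply T ` cball 0 1) \<subseteq> C"
    using assms by (simp add: closure_minimal compact_imp_closed)
  then have "closure (blinfun_apply T ` cball 0 1) = C \<inter> closure (blinfun_apply T ` cball 0 1)"
    by blast
  then show ?thesis
    unfolding compact_op_def using compact_Int_closed[OF assms(1) closed_closure] by metis
qed

lemma compact_op_zero: "compact_op 0"
  by (simp add: compact_op_def image_constant_conv)

lemma compact_op_lincomb:
  assumes "compact_op S" "compact_op T"
  shows "compact_op (S + r *\<^sub>R T)"
proof -
  let ?A = "closure (blinfun_apply S ` cball 0 1)" and ?B = "closure (blinfun_apply T ` cball 0 1)"
  have "compact ((\<lambda>(x, y). x + r *\<^sub>R y) ` (?A \<times> ?B))"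
    using assms unfolding compact_op_def case_prod_unfold
    by (intro compact_continuous_image compact_Times continuous_intros) auto
  moreover have "blinfun_apply (S + r *\<^sub>R T) ` cball 0 1 \<subseteq> (\<lambda>(x, y). x + r *\<^sub>R y) ` (?A \<times> ?B)"
    using closure_subset by (fastforce simp: blinfun.add_left blinfun.scaleR_left)
  ultimately show ?thesis by (rule compact_opI)
qed

lemma compact_op_compose_left:
  assumes "compact_op T"
  shows "compact_op (S o\<^sub>L T)"
proof -
  let ?A = "closure (blinfun_apply T ` cball 0 1)"
  have "compact (blinfun_apply S ` ?A)"
    using assms unfolding compact_op_def
    by (intro compact_continuous_image continuous_intros) auto
  moreover have "blinfun_apply (S o\<^sub>L T) ` cball 0 1 \<subseteq> blinfun_apply S ` ?A"
    using closure_subset by (fastforce simp: blinfun_apply_blinfun_compose)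
  ultimately show ?thesis by (rule compact_opI)
qed

lemma compact_op_compose_right:
  assumes "compact_op T"
  shows "compact_op (T o\<^sub>L S)"
proof -
  let ?A = "closure (blinfun_apply T ` cball 0 1)" and ?r = "norm S + 1"
  have r: "?r > 0" by (simp add: add_nonneg_pos)
  have "compact ((\<lambda>y. ?r *\<^sub>R y) ` ?A)"
    using assms unfolding compact_op_def by (intro compact_scaling)
  moreover have "blinfun_apply (T o\<^sub>L S) ` cball 0 1 \<subseteq> (\<lambda>y. ?r *\<^sub>R y) ` ?A"
  proof clarify
    fix x :: 'a assume x: "x \<in> cball 0 1"
    have "norm (S x) \<le> norm S * norm x" by (rule norm_blinfun)
    also have "\<dots> \<le> ?r" using x by (simp add: mult_left_le add_increasing2)
    finally have "(1 / ?r) *\<^sub>R S x \<in> cball 0 1" using r by (simp add: field_simps)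
    then have "T ((1 / ?r) *\<^sub>R S x) \<in> ?A" by (intro subsetD[OF closure_subset] imageI)
    moreover have "(T o\<^sub>L S) x = ?r *\<^sub>R T ((1 / ?r) *\<^sub>R S x)"
      using r by (simp add: blinfun.scaleR_right)
    ultimately show "(T o\<^sub>L S) x \<in> (\<lambda>y. ?r *\<^sub>R y) ` ?A" by (intro image_eqI)
  qed
  ultimately show ?thesis by (rule compact_opI)
qed

context banach_space_over
begin

lemma scaleR_in_bounded_ops:
  assumes "T \<in> carrier (bounded_ops scl)"
  shows "r *\<^sub>R T \<in> carrier (bounded_ops scl)"
  using assms scale_left_commute[of "of_real r"]
  by (simp add: bounded_ops_def blinfun.scaleR_left flip: scale_of_real)

lemma ring_bounded_ops: "ring (bounded_ops scl)"
proof (rule ringI)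
  show "abelian_group (bounded_ops scl)"
  proof (rule abelian_groupI)
    fix x assume "x \<in> carrier (bounded_ops scl)"
    then show "\<exists>y \<in> carrier (bounded_ops scl). y \<oplus>\<^bsub>bounded_ops scl\<^esub> x = \<zero>\<^bsub>bounded_ops scl\<^esub>"
      by (intro bexI[of _ "- x"]) (auto simp: bounded_ops_def blinfun.minus_left scale_minus_right)
  qed (auto simp: bounded_ops_def blinfun.add_left scale_right_distrib add.assoc add.commute)
  show "monoid (bounded_ops scl)"
    by unfold_locales (auto simp: bounded_ops_def blinfun_eqI)
qed (auto simp: bounded_ops_def blinfun_eqI blinfun.add_left blinfun.add_right)

lemma ideal_compact_ops: "ideal (compact_ops scl) (bounded_ops scl)"
proof (rule idealI[OF ring_bounded_ops])
  interpret R: ring "bounded_ops scl" by (rule ring_bounded_ops)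
  have minus: "\<ominus>\<^bsub>bounded_ops scl\<^esub> T = (-1) *\<^sub>R T" if "T \<in> carrier (bounded_ops scl)" for T
    by (rule R.minus_equality) (use that scaleR_in_bounded_ops[of T "-1"] in \<open>auto simp: bounded_ops_def\<close>)
  show "subgroup (compact_ops scl) (add_monoid (bounded_ops scl))"
  proof (rule R.add.subgroupI)
    show "compact_ops scl \<noteq> {}"
      using compact_op_zero by (auto simp: compact_ops_def bounded_ops_def intro!: exI[of _ 0])
    show "compact_ops scl \<subseteq> carrier (bounded_ops scl)"
      by (auto simp: compact_ops_def)
    show "\<ominus>\<^bsub>bounded_ops scl\<^esub> a \<in> compact_ops scl" if "a \<in> compact_ops scl" for a
    proof -
      have a: "a \<in> carrier (bounded_ops scl)" "compact_op a" using that by (auto simp: compact_ops_def)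
      have "compact_op (0 + (-1) *\<^sub>R a)" by (rule compact_op_lincomb[OF compact_op_zero a(2)])
      then show ?thesis
        using minus[OF a(1)] scaleR_in_bounded_ops[OF a(1), of "-1"] by (simp add: compact_ops_def)
    qed
    show "a \<oplus>\<^bsub>bounded_ops scl\<^esub> b \<in> compact_ops scl"
      if "a \<in> compact_ops scl" "b \<in> compact_ops scl" for a b
      using that compact_op_lincomb[of a b 1]
      by (auto simp: compact_ops_def bounded_ops_def blinfun.add_left scale_right_distrib)
  qed
  show "x \<otimes>\<^bsub>bounded_ops scl\<^esub> a \<in> compact_ops scl" "a \<otimes>\<^bsub>bounded_ops scl\<^esub> x \<in> compact_ops scl"
    if "a \<in> compact_ops scl" "x \<in> carrier (bounded_ops scl)" for a x
    using that compact_op_compose_left[of a x] compact_op_compose_right[of a x]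
    by (auto simp: compact_ops_def bounded_ops_def)
qed

lemma ring_calkin: "ring (calkin scl)"
  unfolding calkin_def by (rule ideal.quotient_is_ring[OF ideal_compact_ops])

lemma calkin_proj_eq: "calkin_proj scl T = (\<lambda>K. K + T) ` compact_ops scl"
  by (auto simp: calkin_proj_def a_r_coset_def r_coset_def bounded_ops_def)

lemma carrier_calkin: "carrier (calkin scl) = calkin_proj scl ` carrier (bounded_ops scl)"
  by (auto simp: calkin_def FactRing_def A_RCOSETS_def' calkin_proj_def)

lemma compact_ops_diff:
  "S \<in> compact_ops scl \<Longrightarrow> T \<in> compact_ops scl \<Longrightarrow> S - T \<in> compact_ops scl"
  using compact_op_lincomb[of S T "-1"]
  by (auto simp: compact_ops_def bounded_ops_def blinfun.diff_left scale_right_diff_distrib)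

lemma compact_ops_zero: "0 \<in> compact_ops scl"
  using compact_op_zero by (auto simp: compact_ops_def bounded_ops_def)

lemma compact_ops_add:
  "S \<in> compact_ops scl \<Longrightarrow> T \<in> compact_ops scl \<Longrightarrow> S + T \<in> compact_ops scl"
  using compact_ops_diff[of S "0 - T"] compact_ops_diff[of 0 T] compact_ops_zero by simp

lemma setdist_calkin_proj:
  "setdist (calkin_proj scl S) (calkin_proj scl T) = (INF A \<in> calkin_proj scl (S - T). norm A)"
proof -
  have "{dist x y | x y. x \<in> calkin_proj scl S \<and> y \<in> calkin_proj scl T}
      = norm ` calkin_proj scl (S - T)" (is "?L = ?R")
  proof
    show "?L \<subseteq> ?R"
    proof clarify
      fix x y assume "x \<in> calkin_proj scl S" "y \<in> calkin_proj scl T"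
      then obtain K L where "K \<in> compact_ops scl" "L \<in> compact_ops scl" "x = K + S" "y = L + T"
        by (auto simp: calkin_proj_eq)
      then show "dist x y \<in> norm ` calkin_proj scl (S - T)"
        using compact_ops_diff[of K L]
        by (auto simp: calkin_proj_eq dist_norm image_image algebra_simps intro!: image_eqI[of _ _ "K - L"])
    qed
    show "?R \<subseteq> ?L"
    proof (rule image_subsetI)
      fix A assume "A \<in> calkin_proj scl (S - T)"
      then obtain K where "K \<in> compact_ops scl" "A = K + (S - T)" by (auto simp: calkin_proj_eq)
      then have "A = (K + S) - (0 + T)" "K + S \<in> calkin_proj scl S"
        "0 + T \<in> calkin_proj scl T"
        using compact_ops_zero unfolding calkin_proj_eq by auto
      then show "norm A \<in> {dist x y | x y. x \<in> calkin_proj scl S \<and> y \<in> calkin_proj scl T}"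
        unfolding dist_norm by blast
    qed
  qed
  moreover have "calkin_proj scl S \<noteq> {}" "calkin_proj scl T \<noteq> {}"
    using compact_ops_zero by (auto simp: calkin_proj_eq)
  ultimately show ?thesis by (simp add: setdist_def)
qed

lemma Metric_space_calkin: "Metric_space (carrier (calkin scl)) setdist"
proof
  fix x y z :: "('a \<Rightarrow>\<^sub>L 'a) set"
  show "0 \<le> setdist x y" "setdist x y = setdist y x"
    by (simp_all add: setdist_sym)
  show "setdist x y = 0 \<longleftrightarrow> x = y" if xy: "x \<in> carrier (calkin scl)" "y \<in> carrier (calkin scl)"
  proof
    obtain S T where ST: "S \<in> carrier (bounded_ops scl)" "T \<in> carrier (bounded_ops scl)"
      "x = calkin_proj scl S" "y = calkin_proj scl T"
      using xy by (auto simp: carrier_calkin)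
    assume "setdist x y = 0"
    then have inf: "(INF A \<in> calkin_proj scl (S - T). norm A) = 0"
      using ST setdist_calkin_proj by simp
    have "compact_op (S - T)"
    proof (rule compact_op_limit)
      fix e :: real assume "e > 0"
      moreover have "calkin_proj scl (S - T) \<noteq> {}"
        using compact_ops_zero by (auto simp: calkin_proj_eq)
      ultimately obtain A where A: "A \<in> calkin_proj scl (S - T)" "norm A < e"
        using inf cInf_lessD[of "norm ` calkin_proj scl (S - T)" e] by auto
      then obtain K where K: "K \<in> compact_ops scl" "A = K + (S - T)" by (auto simp: calkin_proj_eq)
      moreover have "S - T - (0 - K) = A" using K by simp
      ultimately show "\<exists>L. compact_op L \<and> norm (S - T - L) < e"
        using A compact_ops_diff[OF compact_ops_zero, of K]
        by (intro exI[of _ "0 - K"]) (simp add: compact_ops_def add.commute)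
    qed
    then have D: "S - T \<in> compact_ops scl"
      using ST by (auto simp: compact_ops_def bounded_ops_def blinfun.diff_left scale_right_diff_distrib)
    have "K + S \<in> calkin_proj scl T" "K + T \<in> calkin_proj scl S" if "K \<in> compact_ops scl" for K
    proof -
      have "(K + (S - T)) + T \<in> calkin_proj scl T" "(K - (S - T)) + S \<in> calkin_proj scl S"
        unfolding calkin_proj_eq using compact_ops_add[OF that D] compact_ops_diff[OF that D] by blast+
      then show "K + S \<in> calkin_proj scl T" "K + T \<in> calkin_proj scl S" by simp_all
    qed
    then show "x = y" unfolding ST by (fastforce simp: calkin_proj_eq[of S] calkin_proj_eq[of T])
  next
    assume "x = y"
    then show "setdist x y = 0" by (simp add: setdist_refl)
  qed
  show "setdist x z \<le> setdist x y + setdist y z"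
    if xyz: "x \<in> carrier (calkin scl)" "y \<in> carrier (calkin scl)" "z \<in> carrier (calkin scl)"
  proof -
    obtain S T U where STU: "x = calkin_proj scl S" "y = calkin_proj scl T" "z = calkin_proj scl U"
      using xyz by (auto simp: carrier_calkin)
    have ne: "calkin_proj scl V \<noteq> {}" for V
      using compact_ops_zero by (auto simp: calkin_proj_eq)
    show ?thesis
    proof (rule field_le_epsilon)
      fix e :: real assume "e > 0"
      then have "setdist x y < setdist x y + e/2" "setdist y z < setdist y z + e/2" by auto
      then obtain a b c d where abcd: "a \<in> x" "b \<in> y" "dist a b < setdist x y + e/2"
        "c \<in> y" "d \<in> z" "dist c d < setdist y z + e/2"
        using setdist_ltE[of x y "setdist x y + e/2"] setdist_ltE[of y z "setdist y z + e/2"]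
          ne STU by metis
      obtain K L M where KLM: "K \<in> compact_ops scl" "L \<in> compact_ops scl" "M \<in> compact_ops scl"
         "b = K + T" "c = L + T" "d = M + U"
        using abcd unfolding STU calkin_proj_eq by blast
      have "(M + (K - L)) + U \<in> z"
        using compact_ops_add[OF KLM(3) compact_ops_diff[OF KLM(1,2)]] unfolding STU calkin_proj_eq by blast
      then have "d + (b - c) \<in> z" using KLM by (simp add: algebra_simps)
      then have "setdist x z \<le> dist a (d + (b - c))" using abcd setdist_le_dist by blast
      also have "\<dots> \<le> dist a b + dist b (d + (b - c))" by (rule dist_triangle)
      also have "dist b (d + (b - c)) = dist c d" by (simp add: dist_norm algebra_simps)
      finally show "setdist x z \<le> setdist x y + setdist y z + e" using abcd by linarith
    qed
  qed
qed

end

end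

theory Submission
  imports Defs
begin

text \<open>
  Two projectors \<open>Q\<close>, \<open>Q'\<close> with \<open>Q - P\<close>, \<open>Q' - P\<close> compact lie in the same path component of the fiber
  \<open>{Q. Q - P compact}\<close> if and only if their ranges have the same relative dimension to the range of \<open>P\<close>.
  One direction is the stability of the index. For the other one, \<open>Q'\<close> is moved along a segment until
  its range and that of \<open>Q\<close> have a common subspace of finite codimension, the same in both when the
  relative dimensions agree; then vectors of the range are exchanged one at a time. Each of these
  moves is a segment from \<open>A\<close> to \<open>B\<close> with \<open>(A - B)\<^sup>2 = 0\<close>, on which all operators are idempotent. No
  connectedness of the group of invertible operators \<open>id + compact\<close> is used; it fails over the reals.

  A continuous family of idempotents of the Calkin algebra has a continuous family of operators as
  lift, by a continuous selection from the cosets. Products of intertwiners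
  \<open>id + (C' - C)(2 C - id)\<close> of nearby such lifts transport the fiber over the initial point along
  the family; this yields lifts of loops, lifts of homotopic loops with the same end point, and the
  fact that the end points of two lifts of a loop are connected in the fiber. So \<open>\<phi>\<close> is the relative
  dimension of the end point of any lift. Its image is described by projecting paths of
  projectors, and when two loops have the same value, their lifts can be joined by a path in the fiber,
  so they are homotopic as soon as the component of \<open>P\<close> is simply connected.
\<close>

section \<open>Complements and the index of a linear map\<close>

text \<open>The argument is the end of the exact homotopy sequence of the quotient map: loops in the
  base, path components of the fiber over the class of \<open>P\<close>, path components of the
  space of projectors. The homomorphism is the boundary map followed by the relative dimension. Its
  image is given by exactness at the components of the fiber. Injectivity is exactness at the
  fundamental group, together with the fact that the relative dimension separates the components of
  the fiber; this is the only place where equality of indices has to produce a path. Two loops with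
  equal values are compared directly and not through a kernel.

  The obstacle to stability is that kernels and images jump under small perturbations. The index is
  therefore read off from a subspace of finite codimension on which the operator is injective, with
  an image of finite codimension: these two codimensions do not move. Bounded functionals serve to
  build finite-rank projectors onto the finite-dimensional remainders and to exchange single
  vectors.\<close>

text \<open>A copy of the locale \<open>vector_space\<close>: its interpretation for \<open>scaleR\<close> has an optional
  qualifier, so that constants declared in \<open>vector_space\<close> itself would be read as the real ones.\<close>
locale vector_space_complements = vector_space scale
  for scale :: "'a::field \<Rightarrow> 'b::ab_group_add \<Rightarrow> 'b" (infixr \<open>*s\<close> 75)
begin

text \<open>\<open>dim\<close> is a cardinality, hence 0 on infinite-dimensional subspaces, so
  finiteness is recorded separately.\<close>

definition findim :: "'b set \<Rightarrow> bool" where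
  "findim V \<longleftrightarrow> (\<exists>B. finite B \<and> V \<subseteq> span B)"

text \<open>The conditions are those in the body of \<open>codim_in\<close>, so that a complement
  built by hand evaluates its definite description. Complements are algebraic; closedness is tracked
  apart.\<close>

definition complement_in :: "'b set \<Rightarrow> 'b set \<Rightarrow> 'b set \<Rightarrow> bool" where
  "complement_in W V C \<longleftrightarrow> subspace W \<and> subspace C \<and> W \<inter> C = {0} \<and>
     V = {w + c | w c. w \<in> W \<and> c \<in> C}"

lemma findim_mono: "findim V \<Longrightarrow> W \<subseteq> V \<Longrightarrow> findim W"
  unfolding findim_def by blast

lemma findim_basis:
  assumes "subspace V" "findim V"
  obtains B where "finite B" "independent B" "B \<subseteq> V" "span B = V" "card B = dim V"
proof -
  obtain B where B: "B \<subseteq> V" "independent B" "V \<subseteq> span B" "card B = dim V"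
    using basis_exists .
  obtain A where "finite A" "V \<subseteq> span A" using assms(2) unfolding findim_def by blast
  then have "finite B" using independent_span_bound[of A B] B by blast
  moreover have "span B = V" using B assms(1) by (simp add: span_subspace)
  ultimately show ?thesis using B that by blast
qed

lemma complement_inD:
  assumes "complement_in W V C"
  shows "subspace W" "subspace C" "W \<inter> C = {0}" "V = {w + c | w c. w \<in> W \<and> c \<in> C}"
    "subspace V" "W \<subseteq> V" "C \<subseteq> V"
proof -
  show *: "subspace W" "subspace C" "W \<inter> C = {0}" "V = {w + c | w c. w \<in> W \<and> c \<in> C}"
    using assms unfolding complement_in_def by blast+
  show "subspace V" using subspace_sums[OF *(1,2)] *(4) by simp
  show "W \<subseteq> V" "C \<subseteq> V"
    using *(4) subspace_0[OF *(1)] subspace_0[OF *(2)] by (force)+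
qed

lemma complement_in_zero: "complement_in W V C \<Longrightarrow> x \<in> W \<Longrightarrow> x \<in> C \<Longrightarrow> x = 0"
  using complement_inD(3) by blast

lemma complement_in_decomp:
  assumes "complement_in W V C" "v \<in> V"
  obtains w c where "w \<in> W" "c \<in> C" "v = w + c"
proof -
  have "v \<in> {w + c | w c. w \<in> W \<and> c \<in> C}" using complement_inD(4)[OF assms(1)] assms(2) by simp
  then show ?thesis using that by blast
qed

lemma complement_inI:
  assumes "subspace W" "subspace C" "\<And>x. x \<in> W \<Longrightarrow> x \<in> C \<Longrightarrow> x = 0" "subspace V" "W \<subseteq> V" "C \<subseteq> V"
    "\<And>v. v \<in> V \<Longrightarrow> \<exists>w\<in>W. v - w \<in> C"
  shows "complement_in W V C"
  unfolding complement_in_def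
proof (intro conjI)
  show "W \<inter> C = {0}" using assms(1-3) subspace_0 by blast
  show "V = {w + c | w c. w \<in> W \<and> c \<in> C}"
  proof (intro equalityI subsetI)
    fix v assume "v \<in> V"
    then obtain w where "w \<in> W" "v - w \<in> C" using assms(7) by blast
    then show "v \<in> {w + c | w c. w \<in> W \<and> c \<in> C}" by (intro CollectI exI[of _ w] exI[of _ "v - w"]) auto
  next
    fix v assume "v \<in> {w + c | w c. w \<in> W \<and> c \<in> C}"
    then obtain w c where "w \<in> W" "c \<in> C" "v = w + c" by blast
    then show "v \<in> V" using assms(5,6) subspace_add[OF assms(4)] by blast
  qed
qed (fact assms(1,2))+

lemma complement_exists:
  assumes "subspace W" "subspace V" "W \<subseteq> V"
  obtains C where "complement_in W V C"
proof -
  obtain B where B: "B \<subseteq> W" "independent B" "W \<subseteq> span B" using maximal_independent_subset .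
  obtain D where D: "B \<subseteq> D" "D \<subseteq> V" "independent D" "V \<subseteq> span D"
    using maximal_independent_subset_extend[OF subset_trans[OF B(1) assms(3)] B(2)] .
  have W: "span B = W" using B assms(1) by (simp add: span_subspace)
  have V: "span D = V" using D assms(2) by (simp add: span_subspace)
  have "complement_in W V (span (D - B))"
  proof (rule complement_inI)
    show "span (D - B) \<subseteq> V" using V span_mono[of "D - B" D] by blast
    fix x assume "x \<in> W" "x \<in> span (D - B)"
    then have x: "x \<in> span B" "x \<in> span (D - B)" using W by auto
    \<comment> \<open>The coordinates of \<open>x\<close> with respect to \<open>D\<close> vanish
      outside \<open>B\<close> and outside \<open>D - B\<close>, so all of them vanish.\<close>
    have "representation D x = representation B x" "representation D x = representation (D - B) x"
      using representation_extend[OF D(3) x(1) D(1)] representation_extend[OF D(3) x(2)] by auto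
    then have "representation D x b = 0" for b
      using representation_ne_zero[of B x b] representation_ne_zero[of "D - B" x b] by force
    moreover have "x \<in> span D" using x(1) span_mono[OF D(1)] by blast
    ultimately show "x = 0" using sum_nonzero_representation_eq[OF D(3)] by (metis (mono_tags, lifting) scale_zero_left sum.neutral)
  next
    fix v assume "v \<in> V"
    then have "v \<in> span (B \<union> (D - B))" using V D(1) by (simp add: Un_absorb1)
    then obtain w c where "w \<in> span B" "c \<in> span (D - B)" "v = w + c" unfolding span_Un by blast
    then show "\<exists>w\<in>W. v - w \<in> span (D - B)" using W by (intro bexI[of _ w]) auto
  qed (use assms in auto)
  then show ?thesis by (rule that)
qed

text \<open>Both complements are copies of the quotient of \<open>V\<close> by \<open>W\<close>; the
  isomorphism is the projection onto \<open>C'\<close> along \<open>W\<close>.\<close>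

lemma dim_complement_unique:
  assumes C: "complement_in W V C" and C': "complement_in W V C'" and fin: "findim C"
  shows "dim C' = dim C" "findim C'"
proof -
  interpret P: vector_space_pair scale scale by unfold_locales
  note c = complement_inD[OF C] and c' = complement_inD[OF C']
  obtain B where B: "finite B" "independent B" "B \<subseteq> C" "span B = C" "card B = dim C"
    using findim_basis[OF c(2) fin] .
  have "\<forall>b\<in>C. \<exists>d\<in>C'. b - d \<in> W"
  proof
    fix b assume "b \<in> C"
    then obtain w d where "w \<in> W" "d \<in> C'" "b = w + d" using c(7) complement_in_decomp[OF C'] by blast
    then show "\<exists>d\<in>C'. b - d \<in> W" by (intro bexI[of _ d]) auto
  qed
  then obtain f where f: "\<And>b. b \<in> C \<Longrightarrow> f b \<in> C' \<and> b - f b \<in> W" by metis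
  \<comment> \<open>\<open>f\<close> comes from a choice; the linear extension of its values on a
    basis is the projection along \<open>W\<close>, and is linear by construction.\<close>
  define p where "p = P.construct B f"
  have lp: "Vector_Spaces.linear scale scale p" unfolding p_def by (rule P.linear_construct[OF B(2)])
  have pB: "p b = f b" if "b \<in> B" for b unfolding p_def by (rule P.construct_basis[OF B(2) that])
  have p: "p x \<in> C' \<and> x - p x \<in> W" if "x \<in> C" for x
  proof -
    have "x \<in> span B" using that B by simp
    then show ?thesis
    proof (induction rule: span_induct_alt)
      case base
      show ?case using c(1) c'(2) P.linear_0[OF lp] by (simp add: subspace_0)
    next
      case (step k x y)
      have "p (k *s x + y) = k *s p x + p y"
        by (simp add: P.linear_add[OF lp] P.linear_scale[OF lp])
      moreover have "k *s x + y - (k *s p x + p y) = k *s (x - p x) + (y - p y)"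
        by (simp add: scale_right_diff_distrib)
      moreover have "p x \<in> C'" "x - p x \<in> W" using step(1) pB f B(3) by (auto)
      ultimately show ?case using step(2) c(1) c'(2) by (simp only: subspace_add subspace_scale simp_thms)
    qed
  qed
  have inj: "inj_on p C"
    unfolding P.linear_inj_on_iff_eq_0[OF lp c(2)]
  proof clarify
    fix x assume "x \<in> C" "p x = 0"
    then have "x \<in> W" using p[of x] by simp
    then show "x = 0" using \<open>x \<in> C\<close> c(3) by blast
  qed
  have im: "p ` C = C'"
  proof (intro equalityI subsetI)
    fix d assume d: "d \<in> C'"
    then obtain w x where wx: "w \<in> W" "x \<in> C" "d = w + x"
      using c'(7) complement_in_decomp[OF C] by blast
    have "d - p x = w + (x - p x)" using wx by simp
    moreover have "w + (x - p x) \<in> W" using p[OF wx(2)] by (intro subspace_add[OF c(1) wx(1)]) simp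
    ultimately have "d - p x \<in> W" by (simp add: wx(3) add_diff_eq)
    moreover have "d - p x \<in> C'" using d p[OF wx(2)] subspace_diff[OF c'(2)] by blast
    ultimately have "d - p x = 0" using c'(3) by blast
    then show "d \<in> p ` C" using wx(2) by simp
  qed (use p in auto)
  have sp: "span (p ` B) = C'" using P.linear_span_image[OF lp, of B] B im by simp
  have ind: "independent (p ` B)"
    using P.linear_independent_injective_image[OF lp B(2)] inj B by simp
  have "card (p ` B) = card B" using inj B card_image inj_on_subset by metis
  then show "dim C' = dim C" using sp dim_span_eq_card_independent[OF ind] B(5) by simp
  show "findim C'" unfolding findim_def using sp B(1) by (intro exI[of _ "p ` B"]) simp
qed

lemma codim_in_eq:
  assumes "complement_in W V C" "findim C"
  shows "codim_in scale W V = dim C"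
  unfolding codim_in_def
proof (rule the_equality)
  show "\<exists>C'. subspace C' \<and> W \<inter> C' = {0} \<and> V = {w + c | w c. w \<in> W \<and> c \<in> C'} \<and> dim C' = dim C"
    using complement_inD[OF assms(1)] by blast
  show "n = dim C" if "\<exists>C'. subspace C' \<and> W \<inter> C' = {0} \<and>
      V = {w + c | w c. w \<in> W \<and> c \<in> C'} \<and> dim C' = n" for n
    using that dim_complement_unique(1)[OF assms(1) _ assms(2)] complement_inD(1)[OF assms(1)]
    unfolding complement_in_def by blast
qed

lemma complement_in_trans:
  assumes C: "complement_in W V C" and D: "complement_in V U D"
  shows "complement_in W U {c + d | c d. c \<in> C \<and> d \<in> D}"
    and "complement_in C {c + d | c d. c \<in> C \<and> d \<in> D} D"
proof -
  note c = complement_inD[OF C] and d = complement_inD[OF D]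
  show 2: "complement_in C {c + d | c d. c \<in> C \<and> d \<in> D} D"
    unfolding complement_in_def
  proof (intro conjI refl c(2) d(2) equalityI subsetI)
    show "x \<in> {0}" if "x \<in> C \<inter> D" for x using that c(7) d(3) by blast
    show "x \<in> C \<inter> D" if "x \<in> {0}" for x using that subspace_0[OF c(2)] subspace_0[OF d(2)] by simp
  qed
  note e = complement_inD[OF 2]
  show "complement_in W U {c + d | c d. c \<in> C \<and> d \<in> D}"
  proof (rule complement_inI)
    show "W \<subseteq> U" using c(6) d(6) by simp
    show "{c + d | c d. c \<in> C \<and> d \<in> D} \<subseteq> U"
    proof clarify
      fix y z assume "y \<in> C" "z \<in> D"
      then show "y + z \<in> U" using c(7) d(6,7) by (intro subspace_add[OF d(5)]) auto
    qed
  next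
    fix x assume x: "x \<in> W" "x \<in> {c + d | c d. c \<in> C \<and> d \<in> D}"
    then obtain y z where yz: "y \<in> C" "z \<in> D" "x = y + z" by blast
    have "z = x - y" using yz by simp
    then have "z \<in> V" using x(1) yz c(6,7) subspace_diff[OF c(5)] by blast
    then have "z = 0" using yz d(3) by blast
    then show "x = 0" using x yz c(3) by auto
  next
    fix v assume "v \<in> U"
    then obtain u z where uz: "u \<in> V" "z \<in> D" "v = u + z" by (rule complement_in_decomp[OF D])
    then obtain w y where "w \<in> W" "y \<in> C" "u = w + y" using complement_in_decomp[OF C] by metis
    then show "\<exists>w\<in>W. v - w \<in> {c + d | c d. c \<in> C \<and> d \<in> D}"
      using uz by (intro bexI[of _ w]) (auto simp: add.assoc)
  qed (fact c(1) e(5) d(5))+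
qed

lemma dim_complement_in:
  assumes C: "complement_in W V C" and W: "findim W" and fC: "findim C"
  shows "dim V = dim W + dim C" "findim V"
proof -
  note c = complement_inD[OF C]
  obtain A where A: "finite A" "independent A" "A \<subseteq> W" "span A = W" "card A = dim W"
    using findim_basis[OF c(1) W] .
  obtain B where B: "finite B" "independent B" "B \<subseteq> C" "span B = C" "card B = dim C"
    using findim_basis[OF c(2) fC] .
  have sp: "span (A \<union> B) = V" unfolding span_Un using A B c by simp
  have "0 \<notin> A" using A(2) dependent_zero by blast
  then have disj: "A \<inter> B = {}" using A(3) B(3) complement_in_zero[OF C] by blast
  have "independent (A \<union> B)"
    using B(1) B(2,3)
  proof (induction B)
    case (insert b B)
    then have I: "independent (A \<union> B)" "B \<subseteq> C" "b \<in> C" "b \<notin> span B"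
      unfolding independent_insert by (simp_all split: if_splits)
    have "b \<notin> span (A \<union> B)"
    proof
      assume "b \<in> span (A \<union> B)"
      then obtain w y where wy: "w \<in> span A" "y \<in> span B" "b = w + y" unfolding span_Un by blast
      moreover have y: "y \<in> C" using wy(2) span_minimal[OF I(2) c(2)] by blast
      have "w \<in> C" using wy(3) subspace_diff[OF c(2) I(3) y] by simp
      then have "w = 0" using wy(1) A(4) complement_in_zero[OF C] by simp
      then show False using wy I(4) by simp
    qed
    then show ?case using I(1) by (simp add: independent_insertI)
  qed (use A in simp)
  then show "dim V = dim W + dim C"
    using dim_span_eq_card_independent[of "A \<union> B"] sp card_Un_disjoint[OF A(1) B(1) disj] A B by simp
  show "findim V" unfolding findim_def using sp A(1) B(1) by (intro exI[of _ "A \<union> B"]) simp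
qed

lemma dim_inj_image:
  assumes T: "Vector_Spaces.linear scale scale T" and "subspace C" "findim C" and inj: "\<And>x. x \<in> C \<Longrightarrow> T x = 0 \<Longrightarrow> x = 0"
  shows "dim (T ` C) = dim C" "findim (T ` C)"
proof -
  interpret P: vector_space_pair scale scale by unfold_locales
  obtain B where B: "finite B" "independent B" "B \<subseteq> C" "span B = C" "card B = dim C"
    using findim_basis[OF assms(2,3)] .
  have i: "inj_on T (span B)" unfolding P.linear_inj_on_iff_eq_0[OF T subspace_span] using inj B by blast
  have sp: "span (T ` B) = T ` C" using P.linear_span_image[OF T, of B] B by simp
  have ind: "independent (T ` B)"
    using P.linear_independent_injective_image[OF T B(2) i] .
  have "card (T ` B) = card B" using i span_superset card_image inj_on_subset by metis
  then show "dim (T ` C) = dim C" using sp dim_span_eq_card_independent[OF ind] B(5) by simp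
  show "findim (T ` C)" unfolding findim_def using sp B(1) by (intro exI[of _ "T ` B"]) simp
qed

lemma complement_in_image:
  assumes T: "Vector_Spaces.linear scale scale T" and C: "complement_in W V C"
    and inj: "\<And>x. x \<in> V \<Longrightarrow> T x = 0 \<Longrightarrow> x = 0"
  shows "complement_in (T ` W) (T ` V) (T ` C)"
proof -
  interpret P: vector_space_pair scale scale by unfold_locales
  note c = complement_inD[OF C]
  show ?thesis
  proof (rule complement_inI)
    fix x assume "x \<in> T ` W" "x \<in> T ` C"
    then obtain w y where wy: "w \<in> W" "y \<in> C" "x = T w" "x = T y" by blast
    then have "T (w - y) = 0" by (simp add: P.linear_diff[OF T])
    moreover have "w - y \<in> V" using wy c(6,7) subspace_diff[OF c(5)] by blast
    ultimately have "w - y = 0" using inj by blast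
    then have "w \<in> W \<inter> C" using wy by simp
    then show "x = 0" using c(3) wy P.linear_0[OF T] by auto
  next
    fix v assume "v \<in> T ` V"
    then obtain w y where "w \<in> W" "y \<in> C" "v = T (w + y)" using complement_in_decomp[OF C] by blast
    then have "v - T w = T y" "w \<in> W" "y \<in> C" by (auto simp: P.linear_add[OF T])
    then show "\<exists>w\<in>T ` W. v - w \<in> T ` C" by (metis imageI)
  qed (use c(1,2,5-7) P.linear_subspace_image[OF T] in auto)
qed

lemma subspace_zero_set:
  assumes T: "Vector_Spaces.linear scale scale T" and "subspace X"
  shows "subspace {x \<in> X. T x = 0}"
proof -
  interpret P: vector_space_pair scale scale by unfold_locales
  have "{x \<in> X. T x = 0} = X \<inter> {x. T x = 0}" by auto
  then show ?thesis using subspace_inter[OF assms(2) P.linear_subspace_kernel[OF T]] by simp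
qed

lemma fredholm_index_eq:
  assumes T: "Vector_Spaces.linear scale scale T" and N: "complement_in X0 X N" and M: "complement_in (T ` X0) Y M"
    and inj: "\<And>x. x \<in> X0 \<Longrightarrow> T x = 0 \<Longrightarrow> x = 0"
    and TX: "T ` X \<subseteq> Y" and fN: "findim N" and fM: "findim M"
  shows "fredholm_index scale X Y T = int (dim N) - int (dim M)"
proof -
  interpret P: vector_space_pair scale scale by unfold_locales
  note n = complement_inD[OF N] and m = complement_inD[OF M]
  define K where "K = {x \<in> X. T x = 0}"
  define X1 where "X1 = {x + k | x k. x \<in> X0 \<and> k \<in> K}"
  have sK: "subspace K" unfolding K_def by (rule subspace_zero_set[OF T n(5)])
  have K: "complement_in X0 X1 K"
    unfolding complement_in_def X1_def using n(1) sK inj subspace_0 by (auto simp: K_def)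
  note k = complement_inD[OF K]
  have "X1 \<subseteq> X" unfolding X1_def using n(5,6) subspace_add by (fastforce simp: K_def)
  then obtain C where C: "complement_in X1 X C" using complement_exists[OF k(5) n(5)] by blast
  note c = complement_inD[OF C]
  note KC = complement_in_trans[OF K C]
  have fKC: "findim {k + c | k c. k \<in> K \<and> c \<in> C}" "dim {k + c | k c. k \<in> K \<and> c \<in> C} = dim N"
    using dim_complement_unique[OF N KC(1) fN] by auto
  have fK: "findim K" and fC: "findim C"
    using fKC(1) complement_inD(6,7)[OF KC(2)] findim_mono by blast+
  have dN: "dim N = dim K + dim C" using dim_complement_in[OF KC(2) fK fC] fKC by simp
  have injC: "x = 0" if "x \<in> C" "T x = 0" for x
  proof -
    have "x \<in> K" using that c(7) by (auto simp: K_def)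
    then show ?thesis using that c(3) k(7) by blast
  qed
  have X0C: "complement_in (T ` X0) (T ` X) (T ` C)"
  proof (rule complement_inI)
    fix x assume "x \<in> T ` X0" "x \<in> T ` C"
    then obtain w y where wy: "w \<in> X0" "y \<in> C" "x = T w" "x = T y" by blast
    have "y - w \<in> K" using wy n(6) c(7) subspace_diff[OF n(5)] by (auto simp: K_def P.linear_diff[OF T])
    then have "w + (y - w) \<in> X1" unfolding X1_def using wy by blast
    then have "y = 0" using wy c(3) by auto
    then show "x = 0" using wy P.linear_0[OF T] by simp
  next
    fix v assume "v \<in> T ` X"
    then obtain u y where "u \<in> X1" "y \<in> C" "v = T (u + y)" using complement_in_decomp[OF C] by blast
    moreover obtain w z where "w \<in> X0" "z \<in> K" "u = w + z" using complement_in_decomp[OF K \<open>u \<in> X1\<close>] .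
    ultimately have "v - T w = T y" "w \<in> X0" "y \<in> C" by (simp_all add: P.linear_add[OF T] K_def)
    then show "\<exists>w\<in>T ` X0. v - w \<in> T ` C" by (metis imageI)
  qed (use n(1,5,6) c(2,7) P.linear_subspace_image[OF T] in auto)
  have fTC: "findim (T ` C)" "dim (T ` C) = dim C" using dim_inj_image[OF T c(2) fC injC] by auto
  obtain D where D: "complement_in (T ` X) Y D"
    using complement_exists[OF P.linear_subspace_image[OF T n(5)] m(5) TX] .
  note TCD = complement_in_trans[OF X0C D]
  have fTCD: "findim {k + c | k c. k \<in> T ` C \<and> c \<in> D}" "dim {k + c | k c. k \<in> T ` C \<and> c \<in> D} = dim M"
    using dim_complement_unique[OF M TCD(1) fM] by auto
  have fD: "findim D" using fTCD(1) complement_inD(7)[OF TCD(2)] findim_mono by blast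
  have "dim M = dim C + dim D" using dim_complement_in[OF TCD(2) fTC(1) fD] fTCD fTC by simp
  then show ?thesis
    unfolding fredholm_index_def using codim_in_eq[OF D fD] dN by (simp add: K_def)
qed

lemma complement_in_sym:
  assumes C: "complement_in W V C"
  shows "complement_in C V W"
proof (rule complement_inI)
  show "x = 0" if "x \<in> C" "x \<in> W" for x using complement_in_zero[OF C] that by blast
  fix v assume "v \<in> V"
  then obtain w c where "w \<in> W" "c \<in> C" "v = w + c" by (rule complement_in_decomp[OF C])
  then show "\<exists>c\<in>C. v - c \<in> W" by (intro bexI[of _ c]) simp_all
qed (fact complement_inD[OF C])+

text \<open>Moves a part \<open>C1\<close> of a complement of \<open>W\<close> into the base, for
  inductions on the codimension.\<close>

lemma complement_in_assoc:
  assumes C: "complement_in W V C" and D: "complement_in C1 C C2"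
  shows "complement_in W {w + c | w c. w \<in> W \<and> c \<in> C1} C1"
    and "complement_in {w + c | w c. w \<in> W \<and> c \<in> C1} V C2"
proof -
  note c = complement_inD[OF C] and d = complement_inD[OF D]
  show 1: "complement_in W {w + c | w c. w \<in> W \<and> c \<in> C1} C1"
    unfolding complement_in_def
  proof (intro conjI refl c(1) d(1) equalityI subsetI)
    show "x \<in> {0}" if "x \<in> W \<inter> C1" for x using that complement_in_zero[OF C] d(6) by blast
    show "x \<in> W \<inter> C1" if "x \<in> {0}" for x using that subspace_0[OF c(1)] subspace_0[OF d(1)] by simp
  qed
  note e = complement_inD[OF 1]
  show "complement_in {w + c | w c. w \<in> W \<and> c \<in> C1} V C2"
  proof (rule complement_inI)
    fix x assume x: "x \<in> {w + c | w c. w \<in> W \<and> c \<in> C1}" "x \<in> C2"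
    then obtain w y where wy: "w \<in> W" "y \<in> C1" "x = w + y" by blast
    have "x - y \<in> C" using x(2) wy(2) d(6,7) by (blast intro: subspace_diff[OF c(2)])
    then have "w = 0" using complement_in_zero[OF C] wy by simp
    then show "x = 0" using complement_in_zero[OF D] wy x(2) by simp
  next
    show "{w + c | w c. w \<in> W \<and> c \<in> C1} \<subseteq> V"
    proof clarify
      fix w y assume "w \<in> W" "y \<in> C1"
      then show "w + y \<in> V" using c(6,7) d(6) by (blast intro: subspace_add[OF c(5)])
    qed
    show "C2 \<subseteq> V" using c(7) d(7) by simp
    fix v assume "v \<in> V"
    then obtain w y where wy: "w \<in> W" "y \<in> C" "v = w + y" by (rule complement_in_decomp[OF C])
    obtain y1 y2 where y: "y1 \<in> C1" "y2 \<in> C2" "y = y1 + y2" using complement_in_decomp[OF D wy(2)] .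
    have "v - (w + y1) = y2" using wy y by simp
    moreover have "w + y1 \<in> {w + c | w c. w \<in> W \<and> c \<in> C1}" using wy y by blast
    ultimately show "\<exists>w\<in>{w + c | w c. w \<in> W \<and> c \<in> C1}. v - w \<in> C2"
      using y(2) by (intro bexI[of _ "w + y1"]) simp_all
  qed (fact e(5) d(2) c(5))+
qed

lemma dim_0_findim:
  assumes "subspace V" "findim V" "dim V = 0"
  shows "V = {0}"
proof -
  obtain B where "finite B" "span B = V" "card B = dim V" using findim_basis[OF assms(1,2)] by metis
  then show ?thesis using assms(3) by auto
qed

lemma dim_span_singleton: "x \<noteq> 0 \<Longrightarrow> dim (span {x}) = 1"
  using dim_span_eq_card_independent[of "{x}"] by (simp add: independent_insert)

lemma findim_span_singleton: "findim (span {x})"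
  unfolding findim_def by (intro exI[of _ "{x}"]) simp

end

section \<open>Bounded functionals\<close>

text \<open>A maximal subspace \<open>M\<close> missing a ball around \<open>e\<close> is a hyperplane complementary to \<open>e\<close>: a line
  parallel to \<open>e\<close> that missed \<open>M\<close> would be covered by the disjoint open sets \<open>C\<close> and \<open>- C\<close>, where
  \<open>C\<close> is the sum of \<open>M\<close> and the open cone over the ball.\<close>
lemma bounded_functional_separating:
  fixes W :: "'a::real_normed_vector set"
  assumes W: "subspace W" "closed W" and e: "e \<notin> W"
  obtains u where "bounded_linear u" "\<And>w. w \<in> W \<Longrightarrow> u w = (0::real)" "u e = 1"
proof -
  obtain d where d: "d > 0" "ball e d \<inter> W = {}"
    using W(2) e by (metis open_Compl Compl_iff open_contains_ball disjoint_eq_subset_Compl)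
  define \<A> where "\<A> = {M. subspace M \<and> W \<subseteq> M \<and> ball e d \<inter> M = {}}"
  have "\<exists>M\<in>\<A>. \<forall>X\<in>\<A>. M \<subseteq> X \<longrightarrow> X = M"
  proof (rule subset_Zorn_nonempty)
    show "\<A> \<noteq> {}" using W d by (auto simp: \<A>_def)
    fix \<C> assume ne: "\<C> \<noteq> {}" and ch: "subset.chain \<A> \<C>"
    have mem: "M \<in> \<C> \<Longrightarrow> subspace M \<and> W \<subseteq> M \<and> ball e d \<inter> M = {}" for M
      using ch by (auto simp: subset.chain_def \<A>_def)
    have "subspace (\<Union>\<C>)"
    proof (rule subspaceI)
      show "0 \<in> \<Union>\<C>" using ne mem subspace_0 by blast
      fix x y assume "x \<in> \<Union>\<C>" "y \<in> \<Union>\<C>"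
      then obtain A B where AB: "A \<in> \<C>" "B \<in> \<C>" "x \<in> A" "y \<in> B" by blast
      then have "A \<subseteq> B \<or> B \<subseteq> A" using ch by (auto simp: subset.chain_def)
      then show "x + y \<in> \<Union>\<C>" using AB mem subspace_add by blast
    qed (use mem subspace_scale in blast)
    then show "\<Union>\<C> \<in> \<A>" using ne mem by (auto simp: \<A>_def)
  qed
  then obtain M where M_in: "M \<in> \<A>" and M_max: "\<forall>X\<in>\<A>. M \<subseteq> X \<longrightarrow> X = M" by blast
  then have M: "subspace M" "W \<subseteq> M" "ball e d \<inter> M = {}" by (auto simp: \<A>_def)
  have max: "X = M" if "subspace X" "M \<subseteq> X" "ball e d \<inter> X = {}" for X
  proof -
    have "X \<in> \<A>" using that M(2) by (auto simp: \<A>_def)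
    then show ?thesis using M_max that(2) by blast
  qed
  have far: "d \<le> norm (m + e)" if "m \<in> M" for m
  proof -
    have "- m \<in> M" using that M(1) subspace_neg by blast
    then show ?thesis using M(3) by (force simp: dist_norm add.commute)
  qed
  define C where "C = (\<Union>m\<in>M. \<Union>l\<in>{0<..}. ball (m + l *\<^sub>R e) (l * d))"
  define C' where "C' = (\<Union>m\<in>M. \<Union>l\<in>{0<..}. ball (m - l *\<^sub>R e) (l * d))"
  have open_C: "open C" "open C'" unfolding C_def C'_def by auto
  have disj: "C \<inter> C' = {}"
  proof (rule ccontr)
    assume "C \<inter> C' \<noteq> {}"
    then obtain x m l m' l' where x: "m \<in> M" "m' \<in> M" "l > 0" "l' > 0"
      "dist (m + l *\<^sub>R e) x < l * d" "dist (m' - l' *\<^sub>R e) x < l' * d"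
      by (auto simp: C_def C'_def)
    have "dist (m + l *\<^sub>R e) (m' - l' *\<^sub>R e) < (l + l') * d"
      using x dist_triangle_less_add[of "m + l *\<^sub>R e" x "l * d" "m' - l' *\<^sub>R e" "l' * d"]
      by (simp add: dist_commute algebra_simps)
    moreover have "dist (m + l *\<^sub>R e) (m' - l' *\<^sub>R e) = norm ((l + l') *\<^sub>R ((1 / (l + l')) *\<^sub>R (m - m') + e))"
      using x by (simp add: dist_norm algebra_simps)
    moreover have "\<dots> = (l + l') * norm ((1 / (l + l')) *\<^sub>R (m - m') + e)" using x by simp
    ultimately have "norm ((1 / (l + l')) *\<^sub>R (m - m') + e) < d" using x by simp
    moreover have "(1 / (l + l')) *\<^sub>R (m - m') \<in> M" using x M(1) by (simp add: subspace_diff subspace_scale)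
    ultimately show False using far by fastforce
  qed
  have cover: "x \<in> M \<union> C \<union> C'" for x
  proof (rule ccontr)
    assume x: "x \<notin> M \<union> C \<union> C'"
    \<comment> \<open>Adjoining \<open>x\<close> would enlarge \<open>M\<close> to a subspace that
      still misses the ball: a point \<open>m + t x\<close> of the ball with
      \<open>t \<noteq> 0\<close> puts \<open>x\<close> into \<open>C\<close> or \<open>C'\<close>
      after division by \<open>t\<close>.\<close>
    define X where "X = {m + t *\<^sub>R x | m t. m \<in> M \<and> t \<in> UNIV}"
    have "subspace X" "M \<subseteq> X" "x \<in> X"
    proof -
      have "X = span (insert x M)"
      proof (intro equalityI subsetI)
        fix y assume "y \<in> X"
        then show "y \<in> span (insert x M)"
          unfolding X_def by (auto intro: span_add span_scale span_base)
      next
        fix y assume "y \<in> span (insert x M)"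
        then obtain k where "y - k *\<^sub>R x \<in> span M" by (auto simp: span_insert)
        then have "y - k *\<^sub>R x \<in> M" using M(1) by (metis span_eq_iff)
        then show "y \<in> X" unfolding X_def by (intro CollectI exI[of _ "y - k *\<^sub>R x"] exI[of _ k]) auto
      qed
      then show "subspace X" "M \<subseteq> X" "x \<in> X" by (auto intro: span_base)
    qed
    moreover have "ball e d \<inter> X = {}"
    proof (rule ccontr)
      assume "ball e d \<inter> X \<noteq> {}"
      then obtain m t where mt: "m \<in> M" "dist e (m + t *\<^sub>R x) < d" unfolding X_def by auto
      have m': "(- 1 / t) *\<^sub>R m \<in> M" using mt M(1) by (simp add: subspace_scale subspace_neg)
      consider "t = 0" | "t > 0" | "t < 0" by linarith
      then show False
      proof cases
        case 1
        then have "m \<in> ball e d \<inter> M" using mt by simp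
        then show False using M(3) by blast
      next
        case 2
        have "dist ((- 1 / t) *\<^sub>R m + (1 / t) *\<^sub>R e) x = norm ((1 / t) *\<^sub>R (e - (m + t *\<^sub>R x)))"
          using 2 by (simp add: dist_norm algebra_simps)
        also have "\<dots> = (1 / t) * dist e (m + t *\<^sub>R x)" using 2 by (simp add: dist_norm)
        also have "\<dots> < (1 / t) * d" using 2 mt by (simp add: divide_strict_right_mono)
        finally have "x \<in> C" unfolding C_def using 2 m' by (intro UN_I[of "(- 1 / t) *\<^sub>R m"] UN_I[of "1 / t"]) auto
        then show False using x by blast
      next
        case 3
        have "dist ((- 1 / t) *\<^sub>R m - (- 1 / t) *\<^sub>R e) x = norm ((1 / t) *\<^sub>R (e - (m + t *\<^sub>R x)))"
          using 3 by (simp add: dist_norm algebra_simps)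
        also have "\<dots> = (- 1 / t) * dist e (m + t *\<^sub>R x)" using 3 by (simp add: dist_norm)
        also have "\<dots> < (- 1 / t) * d" using 3 mt by (simp add: divide_strict_right_mono_neg)
        finally have "x \<in> C'" unfolding C'_def using 3 m' by (intro UN_I[of "(- 1 / t) *\<^sub>R m"] UN_I[of "- 1 / t"]) auto
        then show False using x by blast
      qed
    qed
    ultimately have "X = M" using max by blast
    then show False using \<open>x \<in> X\<close> x by blast
  qed
  have "\<exists>t. x - t *\<^sub>R e \<in> M" for x
  proof (rule ccontr)
    assume no: "\<nexists>t. x - t *\<^sub>R e \<in> M"
    define L where "L = range (\<lambda>t. x + t *\<^sub>R e)"
    have "connected L" unfolding L_def
      by (intro connected_continuous_image continuous_intros connected_UNIV)
    moreover have "L \<subseteq> C \<union> C'"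
    proof
      fix y assume "y \<in> L"
      then obtain t where "y = x - (- t) *\<^sub>R e" by (auto simp: L_def)
      then show "y \<in> C \<union> C'" using no cover by blast
    qed
    \<comment> \<open>\<open>r\<close> is so large that the balls of radius \<open>r * d\<close>
      around \<open>r e\<close> and \<open>- r e\<close> contain \<open>x + r e\<close> and
      \<open>x - r e\<close>.\<close>
    moreover define r where "r = (norm x + 1) / d"
    have r: "r > 0" "norm x < r * d" using d by (simp_all add: r_def add_nonneg_pos)
    have "x + r *\<^sub>R e \<in> C" unfolding C_def
      using r subspace_0[OF M(1)] by (intro UN_I[of 0] UN_I[of r]) (auto simp: dist_norm)
    moreover have "x + (- r) *\<^sub>R e \<in> C'" unfolding C'_def
      using r subspace_0[OF M(1)] by (intro UN_I[of 0] UN_I[of r]) (auto simp: dist_norm)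
    ultimately show False
      using connectedD[OF \<open>connected L\<close> open_C] disj unfolding L_def by blast
  qed
  then obtain u where u: "\<And>x. x - u x *\<^sub>R e \<in> M" by metis
  have "e \<notin> M" using M(3) d(1) by force
  have uniq: "t = u x" if "x - t *\<^sub>R e \<in> M" for x t
  proof (rule ccontr)
    assume ne: "t \<noteq> u x"
    have "(x - u x *\<^sub>R e) - (x - t *\<^sub>R e) \<in> M" using u that subspace_diff[OF M(1)] by blast
    then have "(t - u x) *\<^sub>R e \<in> M" by (simp add: algebra_simps)
    then have "(1 / (t - u x)) *\<^sub>R ((t - u x) *\<^sub>R e) \<in> M" using subspace_scale[OF M(1)] by blast
    then show False using ne \<open>e \<notin> M\<close> by simp
  qed
  have add: "u (x + y) = u x + u y" for x y
    using subspace_add[OF M(1) u[of x] u[of y]] by (intro uniq[symmetric]) (simp add: algebra_simps)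
  have scale: "u (c *\<^sub>R x) = c * u x" for c x
    using subspace_scale[OF M(1) u[of x], of c] by (intro uniq[symmetric]) (simp add: algebra_simps)
  have "norm (u x) \<le> norm x * (1 / d)" for x
  proof (cases "u x = 0")
    case False
    \<comment> \<open>Division by \<open>u x\<close> produces a vector of the form
      \<open>m + e\<close>, to which \<open>far\<close> applies.\<close>
    have "(1 / u x) *\<^sub>R (x - u x *\<^sub>R e) \<in> M" using u subspace_scale[OF M(1)] by blast
    then have "d \<le> norm ((1 / u x) *\<^sub>R (x - u x *\<^sub>R e) + e)" by (rule far)
    also have "(1 / u x) *\<^sub>R (x - u x *\<^sub>R e) + e = (1 / u x) *\<^sub>R x" using False by (simp add: algebra_simps)
    finally show ?thesis using False d(1) by (simp add: field_simps)
  qed (use d in simp)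
  then have "bounded_linear u" using add scale by (intro bounded_linear_intro[where K = "1/d"]) auto
  moreover have "u w = 0" if "w \<in> W" for w using that M(2) by (intro uniq[symmetric]) auto
  moreover have "u e = 1" using subspace_0[OF M(1)] by (intro uniq[symmetric]) auto
  ultimately show ?thesis by (rule that)
qed

section \<open>Bounded operators that are linear over the scalar field\<close>

sublocale banach_space_over \<subseteq> vector_space_complements scl ..

context banach_space_over
begin

abbreviation bops :: "('a \<Rightarrow>\<^sub>L 'a) set" where
  "bops \<equiv> carrier (bounded_ops scl)"

abbreviation rg :: "('a \<Rightarrow>\<^sub>L 'a) \<Rightarrow> 'a set" where
  "rg T \<equiv> range (blinfun_apply T)"

lemma bops_iff: "T \<in> bops \<longleftrightarrow> (\<forall>c x. T (scl c x) = scl c (T x))"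
  by (simp add: bounded_ops_def)

lemma bopsD: "T \<in> bops \<Longrightarrow> T (scl c x) = scl c (T x)"
  by (simp add: bops_iff)

lemma projectors_iff: "Q \<in> projectors scl \<longleftrightarrow> Q \<in> bops \<and> (\<forall>x. Q (Q x) = Q x)"
proof -
  have "Q \<otimes>\<^bsub>bounded_ops scl\<^esub> Q = Q \<longleftrightarrow> (\<forall>x. Q (Q x) = Q x)"
    by (auto simp: bounded_ops_def blinfun_eqI dest: arg_cong[where f = blinfun_apply] fun_cong)
      (metis blinfun_apply_blinfun_compose)
  then show ?thesis unfolding idempotents_def by blast
qed

lemma projectors_bops: "Q \<in> projectors scl \<Longrightarrow> Q \<in> bops"
  by (simp add: projectors_iff)

lemma projector_idem: "Q \<in> projectors scl \<Longrightarrow> Q (Q x) = Q x"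
  by (simp add: projectors_iff)

lemma bops_zero: "0 \<in> bops"
  and bops_id: "id_blinfun \<in> bops"
  and bops_add: "S \<in> bops \<Longrightarrow> T \<in> bops \<Longrightarrow> S + T \<in> bops"
  and bops_diff: "S \<in> bops \<Longrightarrow> T \<in> bops \<Longrightarrow> S - T \<in> bops"
  and bops_compose: "S \<in> bops \<Longrightarrow> T \<in> bops \<Longrightarrow> S o\<^sub>L T \<in> bops"
  by (simp_all add: bops_iff blinfun.add_left blinfun.diff_left scale_right_distrib scale_right_diff_distrib)

lemmas bops_intros = bops_zero bops_id bops_add bops_diff bops_compose scaleR_in_bounded_ops

lemma bops_linear: "T \<in> bops \<Longrightarrow> Vector_Spaces.linear scl scl (blinfun_apply T)"
  unfolding Vector_Spaces.linear_iff
  by (auto simp: bops_iff blinfun.add_right vector_space_axioms)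

lemma scale_scaleR_left: "scl (r *\<^sub>R k) x = r *\<^sub>R scl k x"
  by (metis scaleR_conv_of_real scale_of_real scale_scale)

lemma scale_scaleR_right: "scl k (r *\<^sub>R x) = r *\<^sub>R scl k x"
  by (metis scale_left_commute scale_of_real)

lemma bounded_bilinear_scale: "bounded_bilinear scl"
  by (rule bounded_bilinear.intro)
    (auto simp: scale_left_distrib scale_right_distrib scale_scaleR_left scale_scaleR_right norm_scale
      intro!: exI[of _ 1])

lemma real_subspace: "subspace W \<Longrightarrow> real_vector.subspace W"
  unfolding real_vector.subspace_def subspace_def by (metis scale_of_real)

lemma subspace_scaleR: "subspace W \<Longrightarrow> x \<in> W \<Longrightarrow> r *\<^sub>R x \<in> W"
  by (metis scale_of_real subspace_scale)

lemma span_subspace_eq: "subspace W \<Longrightarrow> span W = W"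
  by (simp only: span_eq_iff)

lemma subspace_range: "T \<in> bops \<Longrightarrow> subspace (rg T)"
proof -
  assume T: "T \<in> bops"
  interpret P: vector_space_pair scl scl by unfold_locales
  show ?thesis by (rule P.linear_subspace_image[OF bops_linear[OF T] subspace_UNIV])
qed

lemma subspace_image_bops: "T \<in> bops \<Longrightarrow> subspace W \<Longrightarrow> subspace (blinfun_apply T ` W)"
proof -
  assume T: "T \<in> bops" and W: "subspace W"
  interpret P: vector_space_pair scl scl by unfold_locales
  show ?thesis by (rule P.linear_subspace_image[OF bops_linear[OF T] W])
qed

lemma range_projector: "Q \<in> projectors scl \<Longrightarrow> x \<in> rg Q \<longleftrightarrow> Q x = x"
  by (metis projector_idem rangeE rangeI)

lemma closed_kernel: "closed {x. blinfun_apply T x = 0}"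
  by (intro closed_Collect_eq continuous_intros)

lemma closed_range_projector:
  assumes "Q \<in> projectors scl"
  shows "closed (rg Q)"
proof -
  have "rg Q = {x. Q x = x}" using range_projector[OF assms] by blast
  then show ?thesis by (simp add: closed_Collect_eq continuous_intros)
qed

lemma compact_op_add: "compact_op (S :: 'a \<Rightarrow>\<^sub>L 'a) \<Longrightarrow> compact_op T \<Longrightarrow> compact_op (S + T)"
  using compact_op_lincomb[of S T 1] by simp

lemma compact_op_diff: "compact_op (S :: 'a \<Rightarrow>\<^sub>L 'a) \<Longrightarrow> compact_op T \<Longrightarrow> compact_op (S - T)"
  using compact_op_lincomb[of S T "-1"] by simp

lemma compact_op_scaleR: "compact_op (T :: 'a \<Rightarrow>\<^sub>L 'a) \<Longrightarrow> compact_op (r *\<^sub>R T)"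
  using compact_op_lincomb[OF compact_op_zero, of T r] by simp

lemmas compact_op_intros = compact_op_zero compact_op_add compact_op_diff compact_op_scaleR
  compact_op_compose_left compact_op_compose_right

section \<open>Functionals and projectors onto finite-dimensional subspaces\<close>

text \<open>The real functional \<open>u\<close> induces a map \<open>w\<close> into the dual of the scalar field (identified with
  the field by its inner product), and \<open>c \<mapsto> w (scl c e)\<close> is onto for reasons of dimension. So
  \<open>x - scl (g x) e\<close> lies in the kernel of \<open>w\<close> for a unique \<open>g x\<close>.\<close>
lemma functional_separating:
  assumes W: "subspace W" "closed W" and e: "e \<notin> W"
  obtains g :: "'a \<Rightarrow>\<^sub>L 'k" where "\<And>c x. g (scl c x) = c * g x" "\<And>w. w \<in> W \<Longrightarrow> g w = 0" "g e = 1"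
proof -
  obtain u where u: "bounded_linear u" "\<And>w. w \<in> W \<Longrightarrow> u w = (0::real)" "u e = 1"
    using bounded_functional_separating[OF real_subspace[OF W(1)] W(2) e] by blast
  interpret s: bounded_bilinear scl by (rule bounded_bilinear_scale)
  \<comment> \<open>\<open>w x\<close> represents, by the inner product, the real functional
    \<open>k \<mapsto> u (scl k x)\<close> on the scalar field.\<close>
  define w where "w x = (\<Sum>b\<in>Basis. u (scl b x) *\<^sub>R b)" for x
  have blw: "bounded_linear w" unfolding w_def
    by (intro bounded_linear_sum bounded_linear_compose[OF bounded_linear_scaleR_left]
        bounded_linear_compose[OF u(1)] s.bounded_linear_right)
  have inner_w: "inner k (w x) = u (scl k x)" for k x
  proof -
    have bl: "bounded_linear (\<lambda>k. u (scl k x))"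
      by (intro bounded_linear_compose[OF u(1)] s.bounded_linear_left)
    interpret l: bounded_linear "\<lambda>k. u (scl k x)" by (rule bl)
    have "u (scl k x) = u (scl (\<Sum>b\<in>Basis. (inner k b) *\<^sub>R b) x)" by (simp add: euclidean_representation)
    also have "\<dots> = (\<Sum>b\<in>Basis. inner k b * u (scl b x))" by (simp add: l.sum l.scaleR)
    also have "\<dots> = inner k (w x)" by (simp add: w_def inner_sum_right mult.commute)
    finally show ?thesis by simp
  qed
  define j where "j c = w (scl c e)" for c
  have lj: "linear j" unfolding j_def
    using bounded_linear.linear[OF bounded_linear_compose[OF blw s.bounded_linear_left]] .
  have "inj j"
    unfolding linear_injective_0[OF lj]
  proof (intro allI impI)
    fix c assume "j c = 0"
    then have "u (scl (1 / c) (scl c e)) = 0" using inner_w[of "1/c" "scl c e"] by (simp add: j_def)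
    then show "c = 0" using u(3) by (cases "c = 0") auto
  qed
  then obtain f where f: "linear f" "\<And>x. f (j x) = x" "\<And>x. j (f x) = x"
    using linear_injective_isomorphism[OF lj] by blast
  define g where "g = Blinfun (\<lambda>x. f (w x))"
  have g: "blinfun_apply g x = f (w x)" for x
    unfolding g_def using bounded_linear_compose[OF f(1)[unfolded linear_conv_bounded_linear] blw]
    by (simp add: bounded_linear_Blinfun_apply)
  show ?thesis
  proof (rule that)
    fix c x
    have "j (c * g x) = j (g (scl c x))"
    proof (rule vector_eq_ldot[THEN iffD1], intro allI)
      fix l
      have "inner l (j (c * g x)) = u (scl (l * c) (scl (g x) e))"
        by (simp add: j_def inner_w mult.assoc)
      also have "\<dots> = inner (l * c) (j (g x))" by (simp add: j_def inner_w)
      also have "\<dots> = u (scl (l * c) x)" by (simp add: g f inner_w)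
      also have "\<dots> = inner l (j (g (scl c x)))" by (simp add: g f inner_w)
      finally show "inner l (j (c * g x)) = inner l (j (g (scl c x)))" .
    qed
    then show "g (scl c x) = c * g x" using \<open>inj j\<close> by (simp add: inj_eq)
  next
    fix x assume "x \<in> W"
    then have "w x = 0" unfolding w_def using u(2) subspace_scale[OF W(1)] by simp
    then show "g x = 0" using f(1) by (simp add: g linear_0)
  next
    have "j 1 = w e" by (simp add: j_def)
    then show "g e = 1" using f(2)[of 1] by (simp add: g)
  qed
qed

definition rank_one :: "'a \<Rightarrow> ('a \<Rightarrow>\<^sub>L 'k) \<Rightarrow> 'a \<Rightarrow>\<^sub>L 'a" where
  "rank_one e g = Blinfun (\<lambda>x. scl (g x) e)"

lemma rank_one_apply [simp]: "blinfun_apply (rank_one e g) x = scl (g x) e"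
proof -
  have "bounded_linear (\<lambda>x. scl (blinfun_apply g x) e)"
    by (intro bounded_linear_compose[OF bounded_bilinear.bounded_linear_left[OF bounded_bilinear_scale]]
        blinfun.bounded_linear_right)
  then show ?thesis by (simp add: rank_one_def bounded_linear_Blinfun_apply)
qed

lemma rank_one_bops: "(\<And>c x. blinfun_apply g (scl c x) = c * g x) \<Longrightarrow> rank_one e g \<in> bops"
  by (simp add: bops_iff)

text \<open>The unit ball is sent to multiples of \<open>e\<close> by scalars from a ball, which is
  compact because the field is finite-dimensional.\<close>

lemma compact_op_rank_one: "compact_op (rank_one e g)"
proof (rule compact_opI)
  show "compact ((\<lambda>k. scl k e) ` cball 0 (norm g))"
    using bounded_bilinear.bounded_linear_left[OF bounded_bilinear_scale]
    by (intro compact_continuous_image linear_continuous_on) auto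
  have "norm (g x) \<le> norm g" if "norm x \<le> 1" for x
    using norm_blinfun[of g x] mult_left_le[OF that norm_ge_zero[of g]] by linarith
  then show "blinfun_apply (rank_one e g) ` cball 0 1 \<subseteq> (\<lambda>k. scl k e) ` cball 0 (norm g)"
    by auto
qed

text \<open>A bounded functional that vanishes on \<open>W\<close> and is 1 at \<open>e\<close>
  reads off the coefficient of \<open>e\<close>, so the span is the preimage of \<open>W\<close>
  under a continuous map.\<close>

lemma closed_span_insert:
  assumes W: "subspace W" "closed W"
  shows "closed (span (insert e W))"
proof (cases "e \<in> W")
  case True
  then show ?thesis using W(2) by (simp add: insert_absorb span_subspace_eq[OF W(1)])
next
  case False
  then obtain g :: "'a \<Rightarrow>\<^sub>L 'k" where g: "\<And>c x. g (scl c x) = c * g x" "\<And>w. w \<in> W \<Longrightarrow> g w = 0" "g e = 1"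
    using functional_separating[OF W] by blast
  have "span (insert e W) = (\<lambda>x. x - rank_one e g x) -` W"
  proof (intro equalityI subsetI)
    fix x assume "x \<in> span (insert e W)"
    then obtain k where k: "x - scl k e \<in> W" by (auto simp: span_insert span_subspace_eq[OF W(1)])
    then have "g (x - scl k e) = 0" using g(2) by blast
    then have "g x = k" by (simp add: blinfun.diff_right g(1,3))
    then show "x \<in> (\<lambda>x. x - rank_one e g x) -` W" using k by simp
  next
    fix x assume "x \<in> (\<lambda>x. x - rank_one e g x) -` W"
    then show "x \<in> span (insert e W)" by (auto simp: span_insert span_subspace_eq[OF W(1)])
  qed
  moreover have "closed ((\<lambda>x. x - rank_one e g x) -` W)"
    by (intro closed_vimage[OF W(2)] continuous_intros)
  ultimately show ?thesis by simp
qed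

lemma closed_span_Un_finite:
  assumes "finite B" "subspace W" "closed W"
  shows "closed (span (W \<union> B))"
  using assms(1)
proof induction
  case (insert b B)
  have "span (W \<union> insert b B) = span (insert b (span (W \<union> B)))"
    by (simp add: span_insert span_span)
  then show ?case using closed_span_insert[OF subspace_span insert(3)] by simp
qed (use assms in \<open>simp add: span_subspace_eq\<close>)

lemma closed_complement_sum:
  assumes "complement_in W V M" "findim M" "closed W"
  shows "closed V"
proof -
  note C = complement_inD[OF assms(1)]
  obtain B where B: "finite B" "span B = M" using findim_basis[OF C(2) assms(2)] by metis
  have "span (W \<union> B) = V" unfolding span_Un B(2) span_subspace_eq[OF C(1)] by (rule C(4)[symmetric])
  then show ?thesis using closed_span_Un_finite[OF B(1) C(1) assms(3)] by simp
qed

text \<open>Induction with \<open>W\<close> arbitrary: the projector \<open>E\<close> onto the span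
  of \<open>B\<close> is chosen to kill \<open>b\<close> as well as \<open>W\<close>. A rank-one
  operator onto the line of \<open>b\<close> is added, with a functional that vanishes on
  \<open>W\<close> and \<open>B\<close>, so the two summands annihilate each other.\<close>

lemma compact_projector_span:
  assumes "finite B" "independent B" "subspace W" "closed W" "span B \<inter> W = {0}"
  shows "\<exists>E\<in>projectors scl. compact_op E \<and> rg E = span B \<and> (\<forall>w\<in>W. E w = 0)"
  using assms
proof (induction B arbitrary: W)
  case empty
  have "0 \<in> projectors scl" by (simp add: projectors_iff bops_zero)
  then show ?case by (intro bexI[of _ 0]) (auto simp: compact_op_zero)
next
  case (insert b B)
  have b: "b \<notin> span B" "independent B" using insert.prems(1) insert.hyps(2) by (auto simp: independent_insert)
  have span_B: "span B \<subseteq> span (insert b B)" "b \<in> span (insert b B)" by (auto intro: span_base subsetD[OF span_mono[of B "insert b B"]])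
  have zero: "x = 0" if "x \<in> span (insert b B)" "x \<in> W" for x using that insert.prems(4) by blast
  have "b \<notin> span (W \<union> B)"
  proof
    assume "b \<in> span (W \<union> B)"
    then obtain w y where wy: "w \<in> W" "y \<in> span B" "b = w + y"
      unfolding span_Un by (auto simp: span_subspace_eq[OF insert.prems(2)])
    then have "w = b - y" by simp
    then have "w \<in> span (insert b B)" using span_B wy(2) span_diff by blast
    then have "w = 0" using zero wy(1) by blast
    then show False using wy b(1) by simp
  qed
  then obtain g :: "'a \<Rightarrow>\<^sub>L 'k" where g: "\<And>c x. g (scl c x) = c * g x"
    "\<And>x. x \<in> span (W \<union> B) \<Longrightarrow> g x = 0" "g b = 1"
    using functional_separating[OF subspace_span closed_span_Un_finite[OF insert.hyps(1) insert.prems(2,3)]] by blast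
  have gW: "g x = 0" if "x \<in> W" for x using that g(2) span_base by blast
  have gB: "g x = 0" if "x \<in> span B" for x using that g(2) span_mono[of B "W \<union> B"] by blast
  have "span B \<inter> span (insert b W) = {0}"
  proof (intro equalityI subsetI)
    fix x assume x: "x \<in> span B \<inter> span (insert b W)"
    then obtain k where k: "x - scl k b \<in> W" by (auto simp: span_insert span_subspace_eq[OF insert.prems(2)])
    have "g (x - scl k b) = 0" using gW[OF k] .
    then have "k = 0" using gB x by (simp add: blinfun.diff_right g(1,3))
    then show "x \<in> {0}" using zero[of x] k x span_B by auto
  qed (auto simp: span_zero)
  from insert.IH[OF b(2) subspace_span closed_span_insert[OF insert.prems(2,3)] this]
  obtain E where E: "E \<in> projectors scl" "compact_op E" "rg E = span B"
    "\<And>w. w \<in> span (insert b W) \<Longrightarrow> E w = 0"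
    by (elim bexE conjE) simp
  have EW: "E w = 0" if "w \<in> W" for w using E(4) that by (auto intro: span_base)
  have gE: "g (E x) = 0" for x using gB E(3) by blast
  define F where "F = E + rank_one b g"
  have F: "F x = E x + scl (g x) b" for x by (simp add: F_def blinfun.add_left)
  have "F \<in> bops" unfolding F_def using E(1) g(1) by (intro bops_add projectors_bops rank_one_bops)
  moreover have "F (F x) = F x" for x
  proof -
    have Eb0: "E b = 0" by (rule E(4)) (simp add: span_base)
    show ?thesis
      by (simp add: F blinfun.add_right projector_idem[OF E(1)] bopsD[OF projectors_bops[OF E(1)]] Eb0 gE g(1,3))
  qed
  ultimately have FP: "F \<in> projectors scl" by (simp add: projectors_iff)
  moreover have "compact_op F" unfolding F_def by (intro compact_op_add E(2) compact_op_rank_one)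
  moreover have "F w = 0" if "w \<in> W" for w using that EW gW by (simp add: F)
  moreover have "rg F = span (insert b B)"
  proof (intro equalityI subsetI)
    fix x assume "x \<in> rg F"
    then obtain y where "x = E y + scl (g y) b" using F by auto
    moreover have "E y \<in> span B" using E(3) by blast
    ultimately show "x \<in> span (insert b B)" unfolding span_insert by (auto intro!: exI[of _ "g y"])
  next
    fix x assume "x \<in> span (insert b B)"
    then obtain k where k: "x - scl k b \<in> span B" by (auto simp: span_insert)
    define y where "y = x - scl k b"
    have Eb0: "E b = 0" by (rule E(4)) (simp add: span_base)
    have "E y = y" "g y = 0" using k E(1,3) range_projector gB unfolding y_def by blast+
    then have "F (y + scl k b) = y + scl k b"
      by (simp add: F blinfun.add_right g(1,3) bopsD[OF projectors_bops[OF E(1)]] Eb0)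
    moreover have "y + scl k b = x" by (simp add: y_def)
    ultimately show "x \<in> rg F" by (metis rangeI)
  qed
  ultimately show ?case by blast
qed

lemma compact_projector_onto:
  assumes "subspace M" "findim M" "subspace W" "closed W" "\<And>x. x \<in> W \<Longrightarrow> x \<in> M \<Longrightarrow> x = 0"
  obtains E where "E \<in> projectors scl" "compact_op E" "rg E = M" "\<And>w. w \<in> W \<Longrightarrow> E w = 0"
proof -
  obtain B where B: "finite B" "independent B" "span B = M"
    using findim_basis[OF assms(1,2)] by metis
  have "span B \<inter> W = {0}" using assms(5) subspace_0[OF assms(1)] subspace_0[OF assms(3)] B(3) by blast
  then show ?thesis using compact_projector_span[OF B(1,2) assms(3,4)] B(3) that by blast
qed

section \<open>Projectors that are compact perturbation of each other\<close>

text \<open>The images under \<open>K\<close> of vectors of \<open>V\<close> that are far apart modulo \<open>W\<close> are far apart, because \<open>K\<close>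
  acts on \<open>V\<close> as the identity modulo \<open>W\<close>.\<close>
lemma compact_op_finite_extension:
  assumes K: "compact_op K" and W: "subspace W" "closed W" and V: "subspace V" "W \<subseteq> V"
    and mod_W: "\<And>y. y \<in> V \<Longrightarrow> y - K y \<in> W"
  shows "\<exists>B. finite B \<and> B \<subseteq> V \<and> V \<subseteq> span (W \<union> B)"
proof (rule ccontr)
  assume no: "\<not> ?thesis"
  have sep: "\<exists>B. finite B \<and> card B = n \<and> B \<subseteq> V \<inter> cball 0 1 \<and>
      (\<forall>b\<in>B. \<forall>b'\<in>B. b \<noteq> b' \<longrightarrow> 1/2 \<le> dist (K b) (K b'))" for n
  proof (induction n)
    case 0
    show ?case by (intro exI[of _ "{}"]) simp
  next
    case (Suc n)
    then obtain B where B: "finite B" "card B = n" "B \<subseteq> V \<inter> cball 0 1"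
      and B_sep: "\<forall>b\<in>B. \<forall>b'\<in>B. b \<noteq> b' \<longrightarrow> 1/2 \<le> dist (K b) (K b')"
      by (elim exE conjE)
    define M where "M = span (W \<union> B)"
    have "W \<union> B \<subseteq> V" using B(3) V(2) by simp
    then have M: "subspace M" "closed M" "W \<subseteq> M" "B \<subseteq> M" "M \<subseteq> V"
      unfolding M_def using closed_span_Un_finite[OF B(1) W] span_superset[of "W \<union> B"]
        span_minimal[OF _ V(1)] by auto
    obtain v where v: "v \<in> V" "v \<notin> M" using no B(1,3) unfolding M_def by blast
    have "M \<noteq> {}" using subspace_0[OF M(1)] by blast
    then have d: "0 < infdist v M" using infdist_pos_not_in_closed[OF M(2)] v(2) by blast
    then have "infdist v M < 2 * infdist v M" by simp
    then obtain m where m: "m \<in> M" "dist v m < 2 * infdist v M"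
      using \<open>M \<noteq> {}\<close> cInf_lessD[of "dist v ` M"] unfolding infdist_def by force
    have r: "0 < norm (v - m)" using v(2) m(1) by auto
    \<comment> \<open>Riesz's lemma: \<open>m\<close> realizes the distance of \<open>v\<close> from
      \<open>M\<close> up to a factor 2, so the normalized difference has distance at least 1/2 from
      \<open>M\<close>.\<close>
    define y where "y = (1 / norm (v - m)) *\<^sub>R (v - m)"
    have y: "y \<in> V" "norm y = 1"
      unfolding y_def using v(1) m(1) M(5) V(1) r by (auto intro!: subspace_scaleR subspace_diff)
    have far: "1/2 \<le> dist y z" if "z \<in> M" for z
    proof -
      have "m + norm (v - m) *\<^sub>R z \<in> M" using that m(1) M(1) by (intro subspace_add subspace_scaleR)
      then have "infdist v M \<le> dist v (m + norm (v - m) *\<^sub>R z)" by (rule infdist_le)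
      also have "\<dots> = norm (norm (v - m) *\<^sub>R (y - z))" using r by (simp add: y_def dist_norm algebra_simps)
      also have "\<dots> = norm (v - m) * dist y z" by (simp add: dist_norm)
      finally have "infdist v M \<le> norm (v - m) * dist y z" .
      also have "\<dots> \<le> (2 * infdist v M) * dist y z"
        using m(2) by (intro mult_right_mono) (auto simp: dist_norm)
      finally show ?thesis using d by (simp add: field_simps)
    qed
    have Kfar: "1/2 \<le> dist (K y) (K b)" if b: "b \<in> B" for b
    proof -
      have "y - K y \<in> M" "b \<in> M" "b - K b \<in> M"
        using mod_W[OF y(1)] mod_W[of b] b B(3) M(3,4) by auto
      \<comment> \<open>\<open>K y - K b\<close> is \<open>y\<close> minus this element of
        \<open>M\<close>.\<close>
      then have "(y - K y) + (b - (b - K b)) \<in> M"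
        by (rule subspace_add[OF M(1) _ subspace_diff[OF M(1)]])
      from far[OF this] show ?thesis by (simp add: dist_norm algebra_simps)
    qed
    have "y \<notin> B" using far[of y] M(4) by auto
    then show ?case
      using B B_sep y Kfar by (intro exI[of _ "insert y B"]) (auto simp: dist_commute)
  qed
  \<comment> \<open>No ball of radius 1/4 contains two points at distance at least 1/2, so one point
    more than there are balls gives a contradiction.\<close>
  obtain k where k: "finite k" "blinfun_apply K ` cball 0 1 \<subseteq> (\<Union>x\<in>k. ball x (1/4))"
    using K unfolding compact_op_iff_totally_bounded by (meson zero_less_divide_1_iff zero_less_numeral)
  obtain B where B: "finite B" "card B = Suc (card k)" "B \<subseteq> V \<inter> cball 0 1"
    and B_sep: "\<forall>b\<in>B. \<forall>b'\<in>B. b \<noteq> b' \<longrightarrow> 1/2 \<le> dist (K b) (K b')"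
    using sep[of "Suc (card k)"] by (elim exE conjE)
  have "\<forall>b\<in>B. \<exists>x\<in>k. dist x (K b) < 1/4" using k(2) B(3) by fastforce
  then obtain f where f: "\<And>b. b \<in> B \<Longrightarrow> f b \<in> k \<and> dist (f b) (K b) < 1/4" by metis
  have "inj_on f B"
  proof (rule inj_onI, rule ccontr)
    fix b b' assume b: "b \<in> B" "b' \<in> B" "f b = f b'" "b \<noteq> b'"
    have "dist (K b) (K b') < 1/2"
      using f[OF b(1)] f[OF b(2)] b(3) dist_triangle_half_r[of "f b" "K b" "1/2" "K b'"] by simp
    then show False using B_sep b(1,2,4) by fastforce
  qed
  then have "card B \<le> card k" using f k(1) by (intro card_inj_on_le[of f]) auto
  then show False using B(2) by simp
qed

text \<open>Turns compactness into finite dimension: with \<open>W = {0}\<close> it bounds a kernel,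
  with an image for \<open>W\<close> a cokernel. The finite set generates \<open>V\<close> only
  together with \<open>W\<close>, and a complement of \<open>W\<close> is found inside its
  span.\<close>

lemma compact_op_findim_complement:
  assumes "compact_op K" "closed W" and C: "complement_in W V C"
    and mod_W: "\<And>y. y \<in> V \<Longrightarrow> y - K y \<in> W"
  shows "findim C"
proof -
  note c = complement_inD[OF C]
  obtain B where B: "finite B" "B \<subseteq> V" "V \<subseteq> span (W \<union> B)"
    using compact_op_finite_extension[OF assms(1) c(1) assms(2) c(5,6) mod_W] by blast
  have s: "subspace (W \<inter> span B)" by (intro subspace_inter c(1) subspace_span)
  obtain D where D: "complement_in (W \<inter> span B) (span B) D"
    using complement_exists[OF s subspace_span] by blast
  note d = complement_inD[OF D]
  have BV: "span B \<subseteq> V" using span_minimal[OF B(2) c(5)] .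
  have "complement_in W V D"
  proof (rule complement_inI)
    show "x = 0" if "x \<in> W" "x \<in> D" for x
      using complement_in_zero[OF D] that d(7) by blast
    show "D \<subseteq> V" using d(7) BV by blast
    fix v assume "v \<in> V"
    then have "v \<in> span (W \<union> B)" using B(3) by blast
    then obtain w y where wy: "w \<in> W" "y \<in> span B" "v = w + y"
      unfolding span_Un span_subspace_eq[OF c(1)] by blast
    obtain w' z where z: "w' \<in> W \<inter> span B" "z \<in> D" "y = w' + z" using complement_in_decomp[OF D wy(2)] .
    have "w + w' \<in> W" using wy z subspace_add[OF c(1)] by blast
    moreover have "v - (w + w') = z" using wy z by simp
    ultimately show "\<exists>w\<in>W. v - w \<in> D" using z(2) by metis
  qed (fact c(1) d(2) c(5) c(6))+
  moreover have "findim D" unfolding findim_def using B(1) d(7) by blast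
  ultimately show ?thesis using dim_complement_unique(2)[OF _ C] by blast
qed

text \<open>This is a relation between ranges, weaker than compactness of \<open>P - Q\<close>. It
  survives the replacement of \<open>P\<close> by another projector with the same range, which may
  differ from \<open>P\<close> by a noncompact operator.\<close>

definition compact_pert :: "('a \<Rightarrow>\<^sub>L 'a) \<Rightarrow> ('a \<Rightarrow>\<^sub>L 'a) \<Rightarrow> bool" where
  "compact_pert P Q \<longleftrightarrow> compact_op ((id_blinfun - P) o\<^sub>L Q) \<and> compact_op ((id_blinfun - Q) o\<^sub>L P)"

lemma compact_pert_if_diff:
  assumes P: "P \<in> projectors scl" and Q: "Q \<in> projectors scl" and K: "compact_op (Q - P)"
  shows "compact_pert P Q"
proof -
  have "(id_blinfun - P) o\<^sub>L Q = (Q - P) o\<^sub>L Q" "(id_blinfun - Q) o\<^sub>L P = 0 - ((Q - P) o\<^sub>L P)"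
    by (rule blinfun_eqI, simp add: blinfun.diff_left blinfun.minus_left projector_idem[OF P] projector_idem[OF Q])+
  then show ?thesis unfolding compact_pert_def
    by (metis K compact_op_compose_right compact_op_diff compact_op_zero)
qed

text \<open>\<open>S\<close> inverts \<open>P\<close> from \<open>P\<close> applied to its range
  back to its range, because \<open>S P = S\<close>. So \<open>P\<close> is injective there, and
  \<open>N\<close> and \<open>M\<close> are the finite-dimensional remainders in source and target;
  the index will be the difference of their dimensions.\<close>

definition splits :: "('a \<Rightarrow>\<^sub>L 'a) \<Rightarrow> ('a \<Rightarrow>\<^sub>L 'a) \<Rightarrow> ('a \<Rightarrow>\<^sub>L 'a) \<Rightarrow> 'a set \<Rightarrow> 'a set \<Rightarrow> bool" where
  "splits P Q S N M \<longleftrightarrow> S \<in> projectors scl \<and> (\<forall>x. S (P x) = S x) \<and> (\<forall>x. Q (S x) = S x) \<and>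
    complement_in (rg S) (rg Q) N \<and> findim N \<and>
    complement_in (blinfun_apply P ` rg S) (rg P) M \<and> findim M \<and>
    (\<forall>m\<in>M. S m = 0)"

lemma splitsD:
  assumes "splits P Q S N M"
  shows "S \<in> projectors scl" "S (P x) = S x" "Q (S x) = S x" "S (S x) = S x"
    "complement_in (rg S) (rg Q) N" "findim N"
    "complement_in (blinfun_apply P ` rg S) (rg P) M" "findim M"
    "m \<in> M \<Longrightarrow> S m = 0"
  using assms unfolding splits_def by (auto simp: projector_idem)

text \<open>Take for \<open>S\<close> the projector onto a complement \<open>X0\<close> of the kernel of \<open>P\<close> in the range of \<open>Q\<close> that
  vanishes on the kernel of \<open>P\<close> and on a complement \<open>M\<close> of \<open>P X0\<close> in the range of \<open>P\<close>.\<close>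
lemma splitting_projector:
  assumes P: "P \<in> projectors scl" and Q: "Q \<in> projectors scl"
    and pert: "compact_pert P Q"
  shows "\<exists>S N M. splits P Q S N M"
proof -
  have PQ: "compact_op ((id_blinfun - P) o\<^sub>L Q)" and QP: "compact_op ((id_blinfun - Q) o\<^sub>L P)"
    using pert by (auto simp: compact_pert_def)
  note Pb = projectors_bops[OF P] and Qb = projectors_bops[OF Q]
  note PP = projector_idem[OF P] and QQ = projector_idem[OF Q]
  define X where "X = rg Q"
  define Y where "Y = rg P"
  have X: "subspace X" "closed X" "x \<in> X \<longleftrightarrow> Q x = x" for x
    unfolding X_def by (fact subspace_range[OF Qb] closed_range_projector[OF Q] range_projector[OF Q])+
  have Y: "subspace Y" "closed Y" "y \<in> Y \<longleftrightarrow> P y = y" for y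
    unfolding Y_def by (fact subspace_range[OF Pb] closed_range_projector[OF P] range_projector[OF P])+
  define N where "N = {x \<in> X. P x = 0}"
  have N: "subspace N" unfolding N_def by (rule subspace_zero_set[OF bops_linear[OF Pb] X(1)])
  have "complement_in {0} N N"
    by (rule complement_inI) (use N subspace_0[OF N] in auto)
  \<comment> \<open>On \<open>N\<close> the operator \<open>(id - P) Q\<close> is the
    identity.\<close>
  then have fN: "findim N"
    by (rule compact_op_findim_complement[OF PQ, rotated])
      (auto simp: N_def X(3) blinfun.diff_left)
  obtain E where E: "E \<in> projectors scl" "rg E = N"
    using compact_projector_onto[OF N fN subspace_single_0 closed_singleton] by blast
  define X0 where "X0 = {x \<in> X. E x = 0}"
  have X0: "subspace X0" unfolding X0_def by (rule subspace_zero_set[OF bops_linear[OF projectors_bops[OF E(1)]] X(1)])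
  have X0_closed: "closed X0"
    unfolding X0_def Collect_conj_eq by (simp add: X(2) closed_Int closed_kernel)
  have EN: "E x = x" if "x \<in> N" for x using that E range_projector by blast
  have X0N: "complement_in X0 X N"
  proof (rule complement_inI)
    show "x = 0" if "x \<in> X0" "x \<in> N" for x using that EN unfolding X0_def by auto
    fix x assume x: "x \<in> X"
    have "E x \<in> N" using E(2) by blast
    then have "x - E x \<in> X" using x X(1) unfolding N_def by (blast intro: subspace_diff)
    then have "x - E x \<in> X0" unfolding X0_def by (simp add: blinfun.diff_right projector_idem[OF E(1)])
    then show "\<exists>w\<in>X0. x - w \<in> N" using \<open>E x \<in> N\<close> by (intro bexI[of _ "x - E x"]) auto
  qed (use X0 N X(1) in \<open>auto simp: X0_def N_def\<close>)
  have inj: "x = 0" if "x \<in> X0" "P x = 0" for x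
    using complement_in_zero[OF X0N that(1)] that unfolding N_def X0_def by blast
  \<comment> \<open>\<open>P\<close> is bounded below on \<open>X0\<close>. Otherwise there are unit
    vectors in \<open>X0\<close> with images tending to 0; they differ from their images by values
    of the compact operator \<open>(id - P) Q\<close>, so a subsequence converges to a unit vector
    of \<open>X0\<close> in the kernel of \<open>P\<close>.\<close>
  have "\<exists>c>0. \<forall>x\<in>X0. c * norm x \<le> norm (P x)"
  proof (rule ccontr)
    assume no: "\<not> (\<exists>c>0. \<forall>x\<in>X0. c * norm x \<le> norm (P x))"
    have "\<exists>x\<in>X0. norm x = 1 \<and> norm (P x) < 1 / real (Suc n)" for n
    proof -
      have "\<not> (\<forall>x\<in>X0. (1 / real (Suc n)) * norm x \<le> norm (P x))"
        using no by (metis divide_pos_pos of_nat_0_less_iff zero_less_Suc zero_less_one)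
      then obtain x where x: "x \<in> X0" "norm (P x) < (1 / real (Suc n)) * norm x" by (meson not_le)
      then have "x \<noteq> 0" by auto
      then have "norm (P ((1 / norm x) *\<^sub>R x)) < 1 / real (Suc n)"
        using x(2) by (simp add: blinfun.scaleR_right field_simps)
      then show ?thesis using x(1) \<open>x \<noteq> 0\<close> X0 by (intro bexI[of _ "(1 / norm x) *\<^sub>R x"]) (auto intro: subspace_scaleR)
    qed
    then obtain f where f: "\<And>n. f n \<in> X0" "\<And>n. norm (f n) = 1" "\<And>n. norm (P (f n)) < 1 / real (Suc n)" by metis
    define g where "g n = f n - P (f n)" for n
    have "g n = ((id_blinfun - P) o\<^sub>L Q) (f n)" for n
      using f(1)[of n] by (auto simp: g_def X0_def X(3) blinfun.diff_left)
    then have "g n \<in> closure (blinfun_apply ((id_blinfun - P) o\<^sub>L Q) ` cball 0 1)" for n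
      using f(2)[of n] by (intro subsetD[OF closure_subset]) auto
    then obtain l r where r: "strict_mono r" "(g \<circ> r) \<longlonglongrightarrow> l"
      using PQ unfolding compact_op_def compact_def by blast
    have "(\<lambda>n. P (f n)) \<longlonglongrightarrow> 0"
      by (rule Lim_null_comparison[OF _ LIMSEQ_inverse_real_of_nat])
        (use f(3) in \<open>auto simp: inverse_eq_divide intro!: always_eventually less_imp_le\<close>)
    then have Pf: "(\<lambda>n. P (f (r n))) \<longlonglongrightarrow> 0" using LIMSEQ_subseq_LIMSEQ[OF _ r(1)] by (fastforce simp: o_def)
    have "(\<lambda>n. g (r n) + P (f (r n))) \<longlonglongrightarrow> l + 0"
      using r(2) Pf by (intro tendsto_add) (simp_all add: o_def)
    then have lim: "(\<lambda>n. f (r n)) \<longlonglongrightarrow> l" by (simp add: g_def)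
    have "l \<in> X0" using closed_sequentially[OF X0_closed _ lim] f(1) by blast
    moreover have "(\<lambda>n. P (f (r n))) \<longlonglongrightarrow> P l" by (intro tendsto_intros lim)
    then have "P l = 0" using LIMSEQ_unique[OF Pf] by simp
    moreover have "(\<lambda>n. norm (f (r n))) \<longlonglongrightarrow> norm l" by (intro tendsto_intros lim)
    then have "norm l = 1" using f(2) LIMSEQ_unique[OF tendsto_const] by fastforce
    ultimately show False using inj by force
  qed
  then obtain c where c: "c > 0" "\<And>x. x \<in> X0 \<Longrightarrow> c * norm x \<le> norm (P x)" by blast
  define Y0 where "Y0 = blinfun_apply P ` X0"
  have Y0: "subspace Y0" unfolding Y0_def by (rule subspace_image_bops[OF Pb X0])
  have Y0_closed: "closed Y0"
    unfolding Y0_def complete_eq_closed[symmetric]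
    by (rule complete_isometric_image[OF c(1) real_subspace[OF X0] blinfun.bounded_linear_right])
      (use c(2) X0_closed in \<open>auto simp: complete_eq_closed\<close>)
  have PX: "P x \<in> Y0" if x: "x \<in> X" for x
  proof -
    obtain y n where "y \<in> X0" "n \<in> N" "x = y + n" using complement_in_decomp[OF X0N x] .
    then show ?thesis by (simp add: Y0_def N_def blinfun.add_right)
  qed
  have "Y0 \<subseteq> Y" unfolding Y0_def Y_def by blast
  then obtain M where M: "complement_in Y0 Y M" using complement_exists[OF Y0 Y(1)] by blast
  note m = complement_inD[OF M]
  \<comment> \<open>On \<open>Y\<close> this operator differs from the identity by
    \<open>P Q\<close>, whose values lie in \<open>Y0\<close>.\<close>
  have "compact_op (P o\<^sub>L ((id_blinfun - Q) o\<^sub>L P))" by (rule compact_op_compose_left[OF QP])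
  then have fM: "findim M"
  proof (rule compact_op_findim_complement[OF _ Y0_closed M])
    fix y assume "y \<in> Y"
    then have "y - (P o\<^sub>L ((id_blinfun - Q) o\<^sub>L P)) y = P (Q y)"
      by (simp add: Y(3) blinfun.diff_left blinfun.diff_right)
    then show "y - (P o\<^sub>L ((id_blinfun - Q) o\<^sub>L P)) y \<in> Y0" using PX by (simp add: X(3) QQ)
  qed
  obtain F where F: "F \<in> projectors scl" "rg F = M" "\<And>w. w \<in> Y0 \<Longrightarrow> F w = 0"
    using compact_projector_onto[OF m(2) fM Y0 Y0_closed] complement_in_zero[OF M] by blast
  have FM: "F x = x" if "x \<in> M" for x using that F(1,2) range_projector by blast
  \<comment> \<open>\<open>G\<close> is \<open>P\<close> followed by the projection onto
    \<open>Y0\<close> along \<open>M\<close>. The splitting projector is \<open>G\<close> followed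
    by the inverse of \<open>P\<close> from \<open>Y0\<close> to \<open>X0\<close>, bounded by the
    lower estimate with \<open>c\<close>.\<close>
  define G where "G = P - (F o\<^sub>L P)"
  have G: "G \<in> bops" unfolding G_def using F(1) Pb by (intro bops_intros projectors_bops[OF F(1)])
  have GY0: "G y \<in> Y0" for y
  proof -
    obtain w z where wz: "w \<in> Y0" "z \<in> M" "P y = w + z"
      using complement_in_decomp[OF M, of "P y"] by (auto simp: Y_def)
    then have "G y = w" using F(3) FM by (simp add: G_def blinfun.diff_left blinfun.add_right)
    then show ?thesis using wz(1) by simp
  qed
  then have "\<forall>y. \<exists>x\<in>X0. P x = G y" unfolding Y0_def by (metis imageE)
  then obtain s where s: "\<And>y. s y \<in> X0" "\<And>y. P (s y) = G y" by metis
  have s_unique: "s y = x" if "x \<in> X0" "P x = G y" for x y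
  proof -
    have "s y - x \<in> X0" "P (s y - x) = 0" using s that X0 by (auto simp: subspace_diff blinfun.diff_right)
    then show ?thesis using inj by force
  qed
  have s_add: "s (x + y) = s x + s y" for x y
    using s X0 by (intro s_unique) (auto simp: subspace_add blinfun.add_right)
  have s_scale: "s (scl k y) = scl k (s y)" for k y
    using s X0 by (intro s_unique) (auto simp: subspace_scale bopsD[OF Pb] bopsD[OF G])
  have "bounded_linear s"
  proof (rule bounded_linear_intro[where K = "norm G / c"])
    show "s (r *\<^sub>R x) = r *\<^sub>R s x" for r x using s_scale[of "of_real r" x] by (simp add: scale_of_real)
    show "norm (s x) \<le> norm x * (norm G / c)" for x
      using c(2)[OF s(1)[of x]] s(2)[of x] norm_blinfun[of G x] c(1) by (simp add: field_simps)
  qed (rule s_add)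
  then have S: "blinfun_apply (Blinfun s) x = s x" for x by (simp add: bounded_linear_Blinfun_apply)
  have sX0: "s x = x" if "x \<in> X0" for x
    using that F(3) by (intro s_unique) (auto simp: G_def blinfun.diff_left Y0_def)
  have rS: "rg (Blinfun s) = X0"
    using s(1) sX0 by (auto simp: S image_iff) (metis sX0)
  have "splits P Q (Blinfun s) N M"
    unfolding splits_def
  proof (intro conjI allI ballI)
    show "Blinfun s \<in> projectors scl" using s_scale sX0[OF s(1)] by (simp add: projectors_iff bops_iff S)
    show "Blinfun s (P x) = Blinfun s x" for x
      unfolding S using s by (intro s_unique) (auto simp: G_def blinfun.diff_left PP)
    show "Q (Blinfun s x) = Blinfun s x" for x using s(1)[of x] by (simp add: S X0_def X(3))
    show "Blinfun s m = 0" if "m \<in> M" for m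
    proof -
      have "P m = m" using that m(7) Y(3) by blast
      then show ?thesis unfolding S using FM[OF that] subspace_0[OF X0]
        by (intro s_unique) (auto simp: G_def blinfun.diff_left blinfun.zero_right)
    qed
  qed (use X0N M fN fM in \<open>auto simp: rS X_def Y_def Y0_def\<close>)
  then show ?thesis by blast
qed

section \<open>Stability of the relative dimension\<close>

text \<open>The value of the inverse at \<open>y\<close> is the fixed point of the contraction
  \<open>x \<mapsto> y - A x\<close>. Uniqueness of the fixed point makes it linear over the scalar
  field; the norm bound serves the continuity of inverses.\<close>

lemma inverse_id_plus:
  assumes A: "A \<in> bops" "norm A < 1"
  shows "\<exists>W. W \<in> bops \<and> W o\<^sub>L (id_blinfun + A) = id_blinfun \<and> (id_blinfun + A) o\<^sub>L W = id_blinfun \<and>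
    norm W \<le> 1 / (1 - norm A)"
proof -
  have "\<exists>!x. y - A x = x" for y
  proof (rule banach_fix_type[of "norm A"])
    show "\<forall>x x'. dist (y - A x) (y - A x') \<le> norm A * dist x x'"
    proof (intro allI)
      fix x x'
      have "dist (y - A x) (y - A x') = norm (A (x' - x))" by (simp add: dist_norm blinfun.diff_right)
      also have "\<dots> \<le> norm A * dist x x'" using norm_blinfun[of A "x' - x"] by (simp add: dist_norm norm_minus_commute)
      finally show "dist (y - A x) (y - A x') \<le> norm A * dist x x'" .
    qed
  qed (use A in auto)
  then obtain w where w: "\<And>y. y - A (w y) = w y" and unique: "\<And>x y. y - A x = x \<Longrightarrow> w y = x" by metis
  have bound: "norm (w y) \<le> norm y * (1 / (1 - norm A))" for y
  proof -
    have "norm (w y) \<le> norm y + norm (A (w y))" using norm_triangle_ineq4[of y "A (w y)"] w[of y] by simp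
    then have "norm (w y) \<le> norm y + norm A * norm (w y)" using norm_blinfun[of A "w y"] by simp
    then have "norm (w y) * (1 - norm A) \<le> norm y" by (simp add: algebra_simps)
    then show ?thesis using A(2) by (simp add: field_simps)
  qed
  have add: "w (x + y) = w x + w y" for x y
    by (rule unique) (metis w add_diff_add blinfun.add_right)
  have scale: "w (scl c y) = scl c (w y)" for c y
    by (rule unique) (metis w A(1) bopsD scale_right_diff_distrib)
  have "bounded_linear w"
  proof (rule bounded_linear_intro[OF add _ bound])
    show "w (r *\<^sub>R x) = r *\<^sub>R w x" for r x using scale[of "of_real r" x] by (simp add: scale_of_real)
  qed
  then have W: "blinfun_apply (Blinfun w) = w" by (rule bounded_linear_Blinfun_apply)
  show ?thesis
  proof (intro exI[of _ "Blinfun w"] conjI)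
    show "Blinfun w \<in> bops" using scale by (simp add: bops_iff W)
    show "Blinfun w o\<^sub>L (id_blinfun + A) = id_blinfun"
      by (rule blinfun_eqI) (simp add: W blinfun.add_left unique)
    show "(id_blinfun + A) o\<^sub>L Blinfun w = id_blinfun"
    proof (rule blinfun_eqI)
      show "((id_blinfun + A) o\<^sub>L Blinfun w) y = id_blinfun y" for y
        using w[of y] by (simp add: W blinfun.add_left) (metis diff_add_cancel)
    qed
    show "norm (Blinfun w) \<le> 1 / (1 - norm A)"
      by (rule norm_blinfun_bound) (use bound A(2) in \<open>auto simp: W mult.commute\<close>)
  qed
qed

text \<open>The invertible operator \<open>V = id + (T - P) S\<close> is the identity on
  \<open>M\<close> and on the kernel of \<open>P\<close>, preserves the range of \<open>P\<close>,
  and satisfies \<open>V (P x) = T x\<close> on the range of \<open>S\<close>. So it carries the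
  decomposition given by \<open>P\<close> to one given by \<open>T\<close>, with the same
  \<open>M\<close>.\<close>

lemma perturbed_complement:
  assumes P: "P \<in> projectors scl" and splits: "splits P Q S N M"
    and T: "T \<in> bops" "\<And>x. P (T (S x)) = T (S x)" "norm (T - P) * norm S < 1"
  shows "complement_in (blinfun_apply T ` rg S) (rg P) M"
    and "\<And>x. x \<in> rg S \<Longrightarrow> T x = 0 \<Longrightarrow> x = 0"
proof -
  note Pb = projectors_bops[OF P] and S = projectors_bops[OF splitsD(1)[OF splits]] splitsD(4,2)[OF splits]
    and M = splitsD(7)[OF splits] and SM = splitsD(9)[OF splits]
  define A where "A = (T - P) o\<^sub>L S"
  have A: "A \<in> bops" "norm A < 1"
    unfolding A_def using norm_blinfun_compose[of "T - P" S] T(1,3) S(1) Pb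
    by (auto intro: bops_intros)
  obtain W where W: "W \<in> bops" "W o\<^sub>L (id_blinfun + A) = id_blinfun" "(id_blinfun + A) o\<^sub>L W = id_blinfun"
    using inverse_id_plus[OF A] by blast
  define V where "V = id_blinfun + A"
  have Vb: "V \<in> bops" unfolding V_def using A by (intro bops_intros)
  have V: "V x = x + A x" for x by (simp add: V_def blinfun.add_left)
  have VW: "V (W y) = y" "W (V y) = y" for y
    using W(2,3) unfolding V_def by (metis blinfun_apply_blinfun_compose blinfun_apply_id_blinfun id_apply)+
  have VP: "V (P x) = T x" if "x \<in> rg S" for x
    using that S(2,3) by (auto simp: V A_def blinfun.diff_left)
  have VM: "V m = m" if "m \<in> M" for m using SM[OF that] by (simp add: V A_def blinfun.zero_right)
  have VY: "blinfun_apply V ` rg P = rg P"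
  proof (intro equalityI subsetI)
    fix y assume "y \<in> blinfun_apply V ` rg P"
    then obtain x where "y = V (P x)" by blast
    then have "P y = y" using T(2)
      by (simp add: V A_def blinfun.diff_left blinfun.add_right blinfun.diff_right projector_idem[OF P])
    then show "y \<in> rg P" using range_projector[OF P] by blast
  next
    fix y assume y: "y \<in> rg P"
    define z where "z = W y"
    \<comment> \<open>The preimage \<open>z\<close> of \<open>y\<close> need not lie in the range of
      \<open>P\<close>; its component in the kernel is fixed by \<open>V\<close> and so contributes
      nothing to \<open>P y\<close>.\<close>
    have "S (z - P z) = 0" by (simp add: blinfun.diff_right S(3))
    then have "V (z - P z) = z - P z" by (simp add: V A_def blinfun.zero_right)
    moreover have "P (V (P z)) = V (P z)" using T(2)
      by (simp add: V A_def blinfun.diff_left blinfun.add_right blinfun.diff_right projector_idem[OF P])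
    moreover have "y = V (P z) + V (z - P z)" by (simp add: VW z_def flip: blinfun.add_right)
    ultimately have "P y = V (P z)" by (simp add: blinfun.add_right blinfun.diff_right projector_idem[OF P])
    then have "y = V (P z)" using y range_projector[OF P] by metis
    then show "y \<in> blinfun_apply V ` rg P" by blast
  qed
  have injV: "x = 0" if "V x = 0" for x using VW(2)[of x] that by (simp add: blinfun.zero_right)
  have "complement_in (blinfun_apply V ` blinfun_apply P ` rg S) (rg P)
      (blinfun_apply V ` M)"
    using complement_in_image[OF bops_linear[OF Vb] M injV] VY by simp
  moreover have "blinfun_apply V ` blinfun_apply P ` rg S = blinfun_apply T ` rg S"
    unfolding image_image using VP by (auto intro!: image_cong)
  moreover have "blinfun_apply V ` M = M" using VM by auto
  ultimately show "complement_in (blinfun_apply T ` rg S) (rg P) M" by simp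
  fix x assume x: "x \<in> rg S" "T x = 0"
  then have "P x = 0" using VP injV by metis
  then have "S x = 0" using S(3)[of x] by (simp add: blinfun.zero_right)
  then show "x = 0" using x(1) S(2) by auto
qed

text \<open>The segment from \<open>P\<close> to \<open>P'\<close> consists of projectors with the
  same range. A splitting at one point of it computes the index at all nearby points, so the index
  is locally constant along the segment.\<close>

lemma fredholm_index_projector_unique:
  assumes P: "P \<in> projectors scl" and Q: "Q \<in> projectors scl" and pert: "compact_pert P Q"
    and P': "P' \<in> projectors scl" and rng: "rg P' = rg P"
  shows "fredholm_index scl (rg Q) (rg P) (blinfun_apply P')
    = fredholm_index scl (rg Q) (rg P) (blinfun_apply P)"
proof -
  define R where "R t = P + t *\<^sub>R (P' - P)" for t :: real
  have R: "R t x = P x + t *\<^sub>R (P' x - P x)" for t x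
    by (simp add: R_def blinfun.add_left blinfun.scaleR_left blinfun.diff_left)
  have PP': "P (P' x) = P' x" "P' (P x) = P x" for x
    using rng range_projector[OF P] range_projector[OF P'] by blast+
  note PP = projector_idem[OF P] projector_idem[OF P'] PP'
  have RP: "R t (P x) = P x" "P (R t x) = R t x" for t x
    by (simp_all add: R blinfun.add_right blinfun.diff_right blinfun.scaleR_right PP)
  have Rb: "R t \<in> bops" for t
    unfolding R_def using projectors_bops[OF P] projectors_bops[OF P'] by (intro bops_intros)
  have Rproj: "R t \<in> projectors scl" for t
  proof -
    have "R t (R t x) = R t x" for x using RP(1)[of t "R t x"] RP(2)[of t x] by simp
    then show ?thesis using Rb by (simp add: projectors_iff)
  qed
  have Rrange: "rg (R t) = rg P" for t
    using RP by (metis (no_types, lifting) equalityI image_subsetI rangeI range_projector[OF P] range_projector[OF Rproj] subsetI)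
  have Rpert: "compact_pert (R t) Q" for t
  proof -
    let ?K = "(id_blinfun - P) o\<^sub>L Q" and ?L = "(id_blinfun - Q) o\<^sub>L P"
    have "(id_blinfun - R t) o\<^sub>L Q = ?K - t *\<^sub>R ((P' - P) o\<^sub>L ?K)" "(id_blinfun - Q) o\<^sub>L R t = ?L o\<^sub>L R t"
      by (rule blinfun_eqI, simp add: R PP blinfun.diff_left blinfun.add_right blinfun.diff_right blinfun.scaleR_left
          blinfun.scaleR_right)+
    then show ?thesis
      using pert unfolding compact_pert_def
      by (simp_all add: compact_op_diff compact_op_scaleR compact_op_compose_left compact_op_compose_right)
  qed
  define f where "f t = fredholm_index scl (rg Q) (rg P) (blinfun_apply (R t))" for t
  have "f 0 = f 1"
  proof (rule connected_local_const[OF connected_UNIV])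
    show "\<forall>t\<in>UNIV. eventually (\<lambda>t'. f t = f t') (at t)"
    proof
      fix t
      obtain S N M where sp: "splits (R t) Q S N M" using splitting_projector[OF Rproj Q Rpert] by blast
      have index: "f t' = int (dim N) - int (dim M)" if "norm (R t' - R t) * norm S < 1" for t'
        unfolding f_def
      proof (rule fredholm_index_eq[OF bops_linear[OF Rb] splitsD(5)[OF sp] _ _ _ splitsD(6,8)[OF sp]])
        have RR: "R t (R t' (S x)) = R t' (S x)" for x
          by (metis Rrange rangeI range_projector[OF Rproj])
        show "complement_in (blinfun_apply (R t') ` rg S) (rg P) M"
          using perturbed_complement(1)[OF Rproj sp Rb RR that]
          by (simp add: Rrange)
        show "x = 0" if "x \<in> rg S" "R t' x = 0" for x
          using perturbed_complement(2)[OF Rproj sp Rb RR]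
            that \<open>norm (R t' - R t) * norm S < 1\<close> by blast
        show "blinfun_apply (R t') ` rg Q \<subseteq> rg P"
          using Rrange by blast
      qed
      have "((\<lambda>t'. norm (R t' - R t) * norm S) \<longlongrightarrow> norm (R t - R t) * norm S) (at t)"
        unfolding R_def by (intro tendsto_intros)
      then have "eventually (\<lambda>t'. norm (R t' - R t) * norm S < 1) (at t)"
        by (rule order_tendstoD) simp
      then show "eventually (\<lambda>t'. f t = f t') (at t)"
        by eventually_elim (use index index[of t] in simp)
    qed
  qed auto
  then show ?thesis by (simp add: f_def R_def)
qed

lemma relative_dim_eq:
  assumes "P \<in> projectors scl" "Q \<in> projectors scl" "compact_pert P Q"
  shows "relative_dim scl (rg Q) (rg P)
    = fredholm_index scl (rg Q) (rg P) (blinfun_apply P)"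
  unfolding relative_dim_def
proof (rule the_equality)
  show "\<exists>P'\<in>projectors scl. rg P' = rg P \<and>
      fredholm_index scl (rg Q) (rg P) (blinfun_apply P)
        = fredholm_index scl (rg Q) (rg P) (blinfun_apply P')"
    using assms(1) by blast
  fix m
  assume "\<exists>P'\<in>projectors scl. rg P' = rg P \<and>
      m = fredholm_index scl (rg Q) (rg P) (blinfun_apply P')"
  then obtain P' where "P' \<in> projectors scl" "rg P' = rg P"
    "m = fredholm_index scl (rg Q) (rg P) (blinfun_apply P')"
    by blast
  then show "m = fredholm_index scl (rg Q) (rg P) (blinfun_apply P)"
    using fredholm_index_projector_unique[OF assms] by simp
qed

lemma relative_dim_splitting:
  assumes P: "P \<in> projectors scl" and Q: "Q \<in> projectors scl" and pert: "compact_pert P Q"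
    and SP: "\<And>x. blinfun_apply S (P x) = S x" and S: "S \<in> projectors scl"
    and N: "complement_in (rg S) (rg Q) N" "findim N"
    and M: "complement_in (blinfun_apply P ` rg S) (rg P) M" "findim M"
  shows "relative_dim scl (rg Q) (rg P) = int (dim N) - int (dim M)"
  unfolding relative_dim_eq[OF P Q pert]
proof (rule fredholm_index_eq[OF bops_linear[OF projectors_bops[OF P]] N(1) M(1) _ _ N(2) M(2)])
  fix x assume "x \<in> rg S" "P x = 0"
  then have "x = S (P x)" using SP range_projector[OF S] by metis
  then show "x = 0" using \<open>P x = 0\<close> by (simp add: blinfun.zero_right)
qed auto

text \<open>The invertible operator \<open>U\<close> intertwines \<open>Q\<close> and \<open>Q'\<close>, so it identifies their ranges.\<close>
lemma relative_dim_locally_constant: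
  assumes P: "P \<in> projectors scl" and Q: "Q \<in> projectors scl" and pert: "compact_pert P Q"
  shows "\<exists>e>0. \<forall>Q'\<in>projectors scl. compact_pert P Q' \<longrightarrow> dist Q' Q < e \<longrightarrow>
    relative_dim scl (rg Q') (rg P)
      = relative_dim scl (rg Q) (rg P)"
proof -
  obtain S N M where sp: "splits P Q S N M" using splitting_projector[OF P Q pert] by blast
  note S = splitsD(1,2)[OF sp] and N = splitsD(5,6)[OF sp] and M = splitsD(7,8)[OF sp]
  note index = relative_dim_splitting[OF P Q pert S(2) S(1) N M]
  \<comment> \<open>\<open>id + (Q' - Q) B\<close> equals \<open>Q' Q + (id - Q') (id - Q)\<close>,
    which intertwines \<open>Q\<close> and \<open>Q'\<close>. The constant \<open>c\<close> ensures
    both \<open>norm A < 1\<close>, for invertibility, and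
    \<open>norm A * (norm P * norm S) < 1\<close>, for the perturbed splitting.\<close>
  define B where "B = 2 *\<^sub>R Q - id_blinfun"
  define c where "c = (1 + norm B) * (1 + norm P) * (1 + norm S)"
  have "1 \<le> 1 + norm B" "1 \<le> 1 + norm P" "1 \<le> 1 + norm S" by auto
  then have c: "c > 0" unfolding c_def by (intro mult_pos_pos) linarith+
  show ?thesis
  proof (intro exI[of _ "1 / c"] conjI ballI impI)
    show "1 / c > 0" using c by simp
    fix Q' assume Q': "Q' \<in> projectors scl" "compact_pert P Q'" "dist Q' Q < 1 / c"
    define A where "A = (Q' - Q) o\<^sub>L B"
    have nA: "norm A \<le> norm (Q' - Q) * norm B" unfolding A_def by (rule norm_blinfun_compose)
    have d: "norm (Q' - Q) * c < 1" using Q'(3) c by (simp add: dist_norm field_simps)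
    have "norm A * ((1 + norm P) * (1 + norm S)) \<le> norm (Q' - Q) * (1 + norm B) * ((1 + norm P) * (1 + norm S))"
      by (intro mult_right_mono order_trans[OF nA] mult_left_mono) auto
    then have nA': "norm A * ((1 + norm P) * (1 + norm S)) < 1" using d by (simp add: c_def mult_ac)
    have "norm A * 1 \<le> norm A * ((1 + norm P) * (1 + norm S))"
      by (intro mult_left_mono) (auto simp: algebra_simps)
    then have A: "norm A < 1" using nA' by simp
    have "norm P * norm S \<le> (1 + norm P) * (1 + norm S)" by (simp add: algebra_simps)
    then have "norm A * (norm P * norm S) \<le> norm A * ((1 + norm P) * (1 + norm S))"
      by (intro mult_left_mono) auto
    then have APS: "norm A * (norm P * norm S) < 1" using nA' by simp
    have Bb: "B \<in> bops" unfolding B_def using projectors_bops[OF Q] by (intro bops_intros)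
    have Ab: "A \<in> bops"
      unfolding A_def using Bb projectors_bops[OF Q] projectors_bops[OF Q'(1)] by (intro bops_intros)
    obtain W where W: "W \<in> bops" "W o\<^sub>L (id_blinfun + A) = id_blinfun" "(id_blinfun + A) o\<^sub>L W = id_blinfun"
    using inverse_id_plus[OF Ab A] by blast
    define U where "U = id_blinfun + A"
    have Ub: "U \<in> bops" unfolding U_def using Ab by (intro bops_intros)
    have U: "U x = x + A x" for x by (simp add: U_def blinfun.add_left)
    have UW: "U (W y) = y" "W (U y) = y" for y
      using W(2,3) unfolding U_def by (metis blinfun_apply_blinfun_compose blinfun_apply_id_blinfun id_apply)+
    have UQ: "U (Q x) = Q' (U x)" for x
      by (simp add: U A_def B_def blinfun.add_left blinfun.diff_left blinfun.scaleR_left blinfun.add_right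
          blinfun.diff_right blinfun.scaleR_right projector_idem[OF Q] projector_idem[OF Q'(1)] scaleR_2)
    have rng: "rg Q' = blinfun_apply U ` rg Q"
    proof (intro equalityI subsetI)
      fix y assume "y \<in> rg Q'"
      then obtain x where "y = Q' (U (W x))" using UW(1) by auto
      then have "y = U (Q (W x))" using UQ by simp
      then show "y \<in> blinfun_apply U ` rg Q" by blast
    qed (use UQ in auto)
    have injU: "x = 0" if "U x = 0" for x using UW(2)[of x] that by (simp add: blinfun.zero_right)
    define T where "T = P o\<^sub>L U"
    have T: "T \<in> bops" "P (T (S x)) = T (S x)" for x
      unfolding T_def using Ub projectors_bops[OF P] by (auto intro: bops_intros simp: projector_idem[OF P])
    have "T - P = P o\<^sub>L A"
      by (rule blinfun_eqI) (simp add: T_def U blinfun.diff_left blinfun.add_right)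
    then have "norm (T - P) * norm S \<le> (norm P * norm A) * norm S"
      by (simp add: mult_right_mono norm_blinfun_compose)
    then have nT: "norm (T - P) * norm S < 1" using APS by (simp add: mult_ac)
    note pc = perturbed_complement[OF P sp T nT]
    have UN: "complement_in (blinfun_apply U ` rg S) (rg Q') (blinfun_apply U ` N)"
      unfolding rng using complement_in_image[OF bops_linear[OF Ub] N(1)] injU by blast
    have fUN: "findim (blinfun_apply U ` N)" "dim (blinfun_apply U ` N) = dim N"
      using dim_inj_image[OF bops_linear[OF Ub] complement_inD(2)[OF N(1)] N(2)] injU by blast+
    have "relative_dim scl (rg Q') (rg P) = int (dim (blinfun_apply U ` N)) - int (dim M)"
      unfolding relative_dim_eq[OF P Q'(1,2)]
    proof (rule fredholm_index_eq[OF bops_linear[OF projectors_bops[OF P]] UN _ _ _ fUN(1) M(2)])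
      show "complement_in (blinfun_apply P ` blinfun_apply U ` rg S) (rg P) M"
        using pc(1) by (simp add: T_def image_image)
      fix x assume "x \<in> blinfun_apply U ` rg S" "P x = 0"
      then obtain s where s: "s \<in> rg S" "x = U s" by blast
      then have "T s = 0" using \<open>P x = 0\<close> by (simp add: T_def)
      then show "x = 0" using pc(2)[OF s(1)] s(2) by (simp add: blinfun.zero_right)
    qed auto
    then show "relative_dim scl (rg Q') (rg P)
      = relative_dim scl (rg Q) (rg P)"
      using index fUN(2) by simp
  qed
qed

text \<open>A splitting of \<open>S\<close> also splits \<open>Q\<close>: the complement in the
  source grows by \<open>N\<close>, and the one in the target stays.\<close>

lemma relative_dim_extension:
  assumes P: "P \<in> projectors scl" and Q: "Q \<in> projectors scl" "compact_pert P Q"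
    and S: "S \<in> projectors scl" "compact_pert P S"
    and N: "complement_in (rg S) (rg Q) N" "findim N"
  shows "relative_dim scl (rg Q) (rg P)
    = relative_dim scl (rg S) (rg P) + int (dim N)"
proof -
  obtain S' N' M' where sp: "splits P S S' N' M'" using splitting_projector[OF P S] by blast
  note S' = splitsD(1,2)[OF sp] and N' = splitsD(5,6)[OF sp] and M' = splitsD(7,8)[OF sp]
  note t = complement_in_trans[OF N'(1) N(1)] and d = dim_complement_in[OF complement_in_trans(2)[OF N'(1) N(1)] N'(2) N(2)]
  show ?thesis
    using relative_dim_splitting[OF P Q S'(2,1) t(1) d(2) M'] relative_dim_splitting[OF P S S'(2,1) N' M'] d(1)
    by simp
qed

section \<open>Path components of the compact perturbations of a projector\<close>

definition fiber :: "('a \<Rightarrow>\<^sub>L 'a) \<Rightarrow> ('a \<Rightarrow>\<^sub>L 'a) set" where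
  "fiber P = {Q \<in> projectors scl. compact_op (Q - P)}"

lemma fiberD: "Q \<in> fiber P \<Longrightarrow> Q \<in> projectors scl" "Q \<in> fiber P \<Longrightarrow> compact_op (Q - P)"
  by (auto simp: fiber_def)

lemma compact_op_diff_trans:
  assumes "compact_op (A - B)" "compact_op (B - C :: 'a \<Rightarrow>\<^sub>L 'a)"
  shows "compact_op (A - C)"
  using compact_op_add[OF assms] by simp

lemma compact_op_diff_commute: "compact_op (A - B) \<Longrightarrow> compact_op (B - A :: 'a \<Rightarrow>\<^sub>L 'a)"
  using compact_op_scaleR[of "A - B" "-1"] by simp

lemma relative_dim_path_component:
  assumes P: "P \<in> projectors scl" and "path_component (fiber P) Q Q'"
  shows "relative_dim scl (rg Q) (rg P)
    = relative_dim scl (rg Q') (rg P)"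
proof -
  obtain p where p: "path p" "path_image p \<subseteq> fiber P" "pathstart p = Q" "pathfinish p = Q'"
    using assms(2) unfolding path_component_def by blast
  define f where "f R = relative_dim scl (rg R) (rg P)" for R :: "'a \<Rightarrow>\<^sub>L 'a"
  have pert: "compact_pert P R" if "R \<in> fiber P" for R
    using that compact_pert_if_diff[OF P] by (auto simp: fiber_def)
  have "f Q = f Q'"
  proof (rule connected_local_const[OF connected_path_image[OF p(1)]])
    show "Q \<in> path_image p" "Q' \<in> path_image p" using p(3,4) by auto
    show "\<forall>R\<in>path_image p. eventually (\<lambda>R'. f R = f R') (at R within path_image p)"
    proof
      fix R assume "R \<in> path_image p"
      then have R: "R \<in> fiber P" using p(2) by blast
      obtain e where e: "e > 0" "\<And>R'. R' \<in> projectors scl \<Longrightarrow> compact_pert P R' \<Longrightarrow> dist R' R < e \<Longrightarrow> f R' = f R"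
        using relative_dim_locally_constant[OF P fiberD(1)[OF R] pert[OF R]] unfolding f_def by blast
      show "eventually (\<lambda>R'. f R = f R') (at R within path_image p)"
        unfolding eventually_at
      proof (intro exI[of _ e] conjI ballI impI e(1))
        fix R' assume "R' \<in> path_image p" "R' \<noteq> R \<and> dist R' R < e"
        then have "R' \<in> fiber P" "dist R' R < e" using p(2) by auto
        then show "f R = f R'" using e(2)[of R'] pert fiberD(1) by simp
      qed
    qed
  qed
  then show ?thesis by (simp add: f_def)
qed

text \<open>The hypotheses on \<open>D\<close> say that \<open>A\<close> and \<open>A + D\<close> are idempotent and that their difference has
  square zero; then the whole segment consists of idempotents.\<close>
lemma path_component_segment:
  assumes A: "A \<in> fiber P" and D: "D \<in> bops" "compact_op D" "\<And>x. A (D x) + D (A x) = D x" "\<And>x. D (D x) = 0"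
  shows "A + D \<in> fiber P" "path_component (fiber P) A (A + D)"
proof -
  have seg: "A + t *\<^sub>R D \<in> fiber P" for t
  proof -
    have "(A + t *\<^sub>R D) - P = (A - P) + t *\<^sub>R D" by simp
    then have "compact_op ((A + t *\<^sub>R D) - P)"
      using compact_op_add[OF fiberD(2)[OF A] compact_op_scaleR[OF D(2)]] by metis
    moreover have "(A + t *\<^sub>R D) ((A + t *\<^sub>R D) x) = (A + t *\<^sub>R D) x" for x
    proof -
      have "(A + t *\<^sub>R D) ((A + t *\<^sub>R D) x) = A x + t *\<^sub>R (A (D x) + D (A x))"
        by (simp add: blinfun.add_left blinfun.add_right blinfun.scaleR_left blinfun.scaleR_right
            projector_idem[OF fiberD(1)[OF A]] D(4) scaleR_add_right)
      also have "\<dots> = (A + t *\<^sub>R D) x" using D(3)[of x] by (simp add: blinfun.add_left blinfun.scaleR_left)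
      finally show ?thesis .
    qed
    moreover have "A + t *\<^sub>R D \<in> bops" using projectors_bops[OF fiberD(1)[OF A]] D(1) by (intro bops_intros)
    ultimately show ?thesis by (simp add: fiber_def projectors_iff)
  qed
  show "A + D \<in> fiber P" using seg[of 1] by simp
  show "path_component (fiber P) A (A + D)"
    unfolding path_component_def
  proof (intro exI conjI)
    show "path_image (linepath A (A + D)) \<subseteq> fiber P"
    proof (clarsimp simp: path_image_def linepath_def)
      fix t :: real
      have "(1 - t) *\<^sub>R A + t *\<^sub>R (A + D) = A + t *\<^sub>R D" by (simp add: algebra_simps)
      then show "(1 - t) *\<^sub>R A + t *\<^sub>R (A + D) \<in> fiber P" using seg by simp
    qed
  qed auto
qed

text \<open>Two segments: the first one fixes the range and makes the projector map \<open>f\<close> to \<open>e\<close>, the second one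
  fixes the kernel.\<close>
lemma path_component_exchange:
  assumes Q: "Q \<in> fiber P" and Z: "complement_in Z (rg Q) (span {e})" "closed Z" "e \<noteq> 0"
    and f: "f \<notin> rg Q"
  shows "\<exists>Q1\<in>fiber P. path_component (fiber P) Q Q1 \<and> complement_in Z (rg Q1) (span {f})"
proof -
  note Qp = fiberD(1)[OF Q] and z = complement_inD[OF Z(1)]
  note QQ = projector_idem[OF Qp] and Qb = projectors_bops[OF Qp]
  have e: "e \<notin> Z" using complement_in_zero[OF Z(1), of e] Z(3) span_base[of e "{e}"] by auto
  have Qe: "Q e = e" using z(7) range_projector[OF Qp] span_base[of e "{e}"] by blast
  have QZ: "Q w = w" if "w \<in> Z" for w using that z(6) range_projector[OF Qp] by blast
  obtain h :: "'a \<Rightarrow>\<^sub>L 'k" where h: "\<And>c x. h (scl c x) = c * h x" "\<And>w. w \<in> rg Q \<Longrightarrow> h w = 0" "h f = 1"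
    using functional_separating[OF subspace_range[OF Qb] closed_range_projector[OF Qp] f] by blast
  obtain g :: "'a \<Rightarrow>\<^sub>L 'k" where g: "\<And>c x. g (scl c x) = c * g x" "\<And>w. w \<in> Z \<Longrightarrow> g w = 0" "g e = 1"
    using functional_separating[OF z(1) Z(2) e] by blast
  have hQ: "h (Q x) = 0" for x using h(2) by simp
  have he: "h e = 0" using hQ[of e] Qe by simp
  \<comment> \<open>\<open>D1\<close> vanishes on the range of \<open>Q\<close> and takes values in
    it; it corrects the image of \<open>f\<close> from \<open>Q f\<close> to
    \<open>e\<close>.\<close>
  define D1 where "D1 = rank_one (e - Q f) h"
  define Q0 where "Q0 = Q + D1"
  have Q0: "Q0 \<in> fiber P" "path_component (fiber P) Q Q0"
  proof -
    have "D1 \<in> bops" "compact_op D1" unfolding D1_def by (rule rank_one_bops[OF h(1)] compact_op_rank_one)+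
    moreover have "Q (D1 x) + D1 (Q x) = D1 x" "D1 (D1 x) = 0" for x
      unfolding D1_def by (simp_all add: bopsD[OF Qb] blinfun.diff_right QQ Qe hQ he h(1))
    ultimately show "Q0 \<in> fiber P" "path_component (fiber P) Q Q0"
      unfolding Q0_def using path_component_segment[OF Q] by simp_all
  qed
  note Q0p = fiberD(1)[OF Q0(1)]
  have Q0_apply: "Q0 x = Q x + scl (h x) (e - Q f)" for x by (simp add: Q0_def D1_def blinfun.add_left)
  have Q0f: "Q0 f = e" and Q0e: "Q0 e = e" and Q0Z: "\<And>w. w \<in> Z \<Longrightarrow> Q0 w = w" and QQ0: "\<And>x. Q (Q0 x) = Q0 x"
    using h(2)[of w for w] z(6)
    by (auto simp: Q0_apply h(3) he Qe QZ subset_iff blinfun.add_right bopsD[OF Qb] blinfun.diff_right QQ)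
  \<comment> \<open>\<open>f - e\<close> lies in the kernel of \<open>Q0\<close>, as
    \<open>Q0\<close> sends both vectors to \<open>e\<close>. \<open>D2\<close> vanishes on this
    kernel and on \<open>Z\<close>, and \<open>Q0 + D2\<close> sends \<open>e\<close> to
    \<open>f\<close>.\<close>
  define D2 where "D2 = rank_one (f - e) (g o\<^sub>L Q0)"
  define Q1 where "Q1 = Q0 + D2"
  have gl: "(g o\<^sub>L Q0) (scl c x) = c * (g o\<^sub>L Q0) x" for c x
    by (simp add: bopsD[OF projectors_bops[OF Q0p]] g(1))
  have Q1: "Q1 \<in> fiber P" "path_component (fiber P) Q0 Q1"
  proof -
    have "D2 \<in> bops" "compact_op D2" unfolding D2_def by (rule rank_one_bops[OF gl] compact_op_rank_one)+
    moreover have "Q0 (D2 x) + D2 (Q0 x) = D2 x" "D2 (D2 x) = 0" for x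
      unfolding D2_def
      by (simp_all add: bopsD[OF projectors_bops[OF Q0p]] blinfun.diff_right projector_idem[OF Q0p] Q0f Q0e g(1))
    ultimately show "Q1 \<in> fiber P" "path_component (fiber P) Q0 Q1"
      unfolding Q1_def using path_component_segment[OF Q0(1)] by simp_all
  qed
  have Q1_apply: "Q1 x = Q0 x + scl (g (Q0 x)) (f - e)" for x by (simp add: Q1_def D2_def blinfun.add_left)
  have Q1f: "Q1 f = f" and Q1Z: "\<And>w. w \<in> Z \<Longrightarrow> Q1 w = w" by (simp_all add: Q1_apply Q0f Q0Z g)
  note Q1p = fiberD(1)[OF Q1(1)]
  have "complement_in Z (rg Q1) (span {f})"
  proof (rule complement_inI)
    show "subspace (rg Q1)" by (rule subspace_range[OF projectors_bops[OF Q1p]])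
    show "span {f} \<subseteq> rg Q1"
      by (rule span_minimal[OF _ subspace_range[OF projectors_bops[OF Q1p]]]) (use Q1f in \<open>simp add: range_projector[OF Q1p]\<close>)
    show "Z \<subseteq> rg Q1" using Q1Z by (metis rangeI subsetI)
    show "x = 0" if x: "x \<in> Z" "x \<in> span {f}" for x
    proof -
      obtain k where k: "x = scl k f" using x(2) by (auto simp: span_singleton)
      have "x \<in> rg Q" using x(1) z(6) by blast
      then have "h x = 0" using h(2) by blast
      then show ?thesis using k by (simp add: h(1,3))
    qed
    fix v assume "v \<in> rg Q1"
    then obtain x where x: "v = Q1 x" by blast
    have "Q0 x \<in> rg Q" using QQ0 by (metis rangeI)
    then obtain w c where wc: "w \<in> Z" "c \<in> span {e}" "Q0 x = w + c" using complement_in_decomp[OF Z(1)] by metis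
    then obtain k where k: "c = scl k e" by (auto simp: span_singleton)
    have "g (Q0 x) = k" using wc k by (simp add: blinfun.add_right g)
    then have "v - w = scl k f" using x wc k by (simp add: Q1_apply scale_right_diff_distrib)
    then show "\<exists>w\<in>Z. v - w \<in> span {f}" using wc(1) by (intro bexI[of _ w]) (simp_all add: span_base span_scale)
  qed (fact z(1) subspace_span)+
  moreover have "path_component (fiber P) Q Q1" using path_component_trans[OF Q0(2) Q1(2)] .
  ultimately show ?thesis using Q1(1) by blast
qed

text \<open>Each projector fixes the range of the other, so their difference has square
  zero.\<close>

lemma path_component_same_range:
  assumes Q: "Q \<in> fiber P" and Q': "Q' \<in> fiber P" and rng: "rg Q = rg Q'"
  shows "path_component (fiber P) Q Q'"
proof -
  have QQ': "Q (Q' x) = Q' x" "Q' (Q x) = Q x" for x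
    using rng range_projector[OF fiberD(1)[OF Q]] range_projector[OF fiberD(1)[OF Q']] by blast+
  have "compact_op ((Q' - P) - (Q - P))" using fiberD(2)[OF Q] fiberD(2)[OF Q'] by (rule compact_op_diff[rotated])
  then have "compact_op (Q' - Q)" by simp
  moreover have "Q' - Q \<in> bops" using projectors_bops fiberD(1) Q Q' by (intro bops_intros) blast+
  ultimately have "path_component (fiber P) Q (Q + (Q' - Q))"
    by (intro path_component_segment(2)[OF Q])
      (simp_all add: blinfun.diff_left blinfun.diff_right QQ' projector_idem[OF fiberD(1)[OF Q]]
        projector_idem[OF fiberD(1)[OF Q']])
  then show ?thesis by simp
qed

text \<open>Induction on the common codimension of \<open>X0\<close>. A vector \<open>f\<close> of
  \<open>M\<close> is added to \<open>X0\<close>: at no cost if the range of \<open>Q\<close>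
  contains it, otherwise after exchanging a vector of \<open>N\<close> for it. Either way both
  codimensions drop by one, so their equality persists.\<close>

lemma path_component_commensurable:
  assumes "closed X0" "Q \<in> fiber P" "Q' \<in> fiber P"
    "complement_in X0 (rg Q) N" "findim N"
    "complement_in X0 (rg Q') M" "findim M" "dim N = dim M"
  shows "path_component (fiber P) Q Q'"
  using assms
proof (induction "dim M" arbitrary: X0 Q N M)
  case 0
  then have "N = {0}" "M = {0}" using dim_0_findim complement_inD(2) by metis+
  then have "rg Q = X0" "rg Q' = X0"
    using complement_inD(4)[OF "0.prems"(4)] complement_inD(4)[OF "0.prems"(6)] by simp_all
  then show ?case using path_component_same_range "0.prems"(2,3) by simp
next
  case (Suc n)
  note Q = Suc.prems(2) and Q' = Suc.prems(3) and N = Suc.prems(4,5) and M = Suc.prems(6,7)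
  have "M \<noteq> {0}" using Suc.hyps(2) dim_span[of "{}"] dim_eq_card_independent[OF independent_empty] by (auto simp: span_empty)
  then obtain f where f: "f \<in> M" "f \<noteq> 0" using subspace_0[OF complement_inD(2)[OF M(1)]] by blast
  have "span {f} \<subseteq> M" using span_minimal[OF _ complement_inD(2)[OF M(1)]] f(1) by simp
  then obtain M1 where M1: "complement_in (span {f}) M M1"
    using complement_exists[OF subspace_span complement_inD(2)[OF M(1)]] by blast
  have fM1: "findim M1" using findim_mono[OF M(2) complement_inD(7)[OF M1]] .
  have dM1: "n = dim M1"
    using dim_complement_in(1)[OF M1 findim_span_singleton fM1] dim_span_singleton[OF f(2)] Suc.hyps(2)
    by (simp only:)
  define X1 where "X1 = {w + c | w c. w \<in> X0 \<and> c \<in> span {f}}"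
  note X1 = complement_in_assoc[OF M(1) M1, folded X1_def]
  have X1_closed: "closed X1" by (rule closed_complement_sum[OF X1(1) findim_span_singleton Suc.prems(1)])
  show ?case
  proof (cases "f \<in> rg Q")
    case True
    note n = complement_inD[OF N(1)]
    have "X1 \<subseteq> rg Q"
    proof
      fix x assume "x \<in> X1"
      then obtain w c where wc: "w \<in> X0" "c \<in> span {f}" "x = w + c" by (rule complement_in_decomp[OF X1(1)])
      have "c \<in> rg Q" using wc(2) span_minimal[OF _ n(5), of "{f}"] True by blast
      then show "x \<in> rg Q" using wc(1,3) n(6) by (auto intro: subspace_add[OF n(5)])
    qed
    then obtain N1 where N1: "complement_in X1 (rg Q) N1"
      using complement_exists[OF complement_inD(5)[OF X1(1)] n(5)] by blast
    note t = complement_in_trans[OF X1(1) N1]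
    note u = dim_complement_unique[OF N(1) t(1) N(2)]
    have fN1: "findim N1" using findim_mono[OF u(2) complement_inD(7)[OF t(2)]] .
    have "dim N1 = n"
      using dim_complement_in(1)[OF t(2) findim_span_singleton fN1] dim_span_singleton[OF f(2)] Suc.hyps(2)
        Suc.prems(8) u(1) by simp
    then show ?thesis
      using Suc.hyps(1)[OF dM1 X1_closed Q Q' N1 fN1 X1(2) fM1] dM1 by simp
  next
    case False
    have "N \<noteq> {0}" using Suc.hyps(2) Suc.prems(8) dim_span[of "{}"] dim_eq_card_independent[OF independent_empty]
      by (auto simp: span_empty)
    then obtain e where e: "e \<in> N" "e \<noteq> 0" using subspace_0[OF complement_inD(2)[OF N(1)]] by blast
    have "span {e} \<subseteq> N" using span_minimal[OF _ complement_inD(2)[OF N(1)]] e(1) by simp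
    then obtain N1 where N1: "complement_in (span {e}) N N1"
      using complement_exists[OF subspace_span complement_inD(2)[OF N(1)]] by blast
    have fN1: "findim N1" using findim_mono[OF N(2) complement_inD(7)[OF N1]] .
    have dN1: "dim N1 = n"
      using dim_complement_in(1)[OF N1 findim_span_singleton fN1] dim_span_singleton[OF e(2)] Suc.hyps(2)
        Suc.prems(8) by simp
    \<comment> \<open>\<open>Z\<close> is the hyperplane of the range of \<open>Q\<close> that is
      kept while \<open>e\<close> is exchanged for \<open>f\<close>.\<close>
    define Z where "Z = {w + c | w c. w \<in> X0 \<and> c \<in> N1}"
    note Z = complement_in_assoc[OF N(1) complement_in_sym[OF N1], folded Z_def]
    have Z_closed: "closed Z" by (rule closed_complement_sum[OF Z(1) fN1 Suc.prems(1)])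
    obtain Q1 where Q1: "Q1 \<in> fiber P" "path_component (fiber P) Q Q1"
      "complement_in Z (rg Q1) (span {f})"
      using path_component_exchange[OF Q Z(2) Z_closed e(2) False] by blast
    note t = complement_in_trans[OF Z(1) Q1(3)]
    have "complement_in X1 (rg Q1) N1"
      using complement_in_assoc(2)[OF t(1) complement_in_sym[OF t(2)]] by (simp add: X1_def)
    then have "path_component (fiber P) Q1 Q'"
      using Suc.hyps(1)[OF dM1 X1_closed Q1(1) Q' _ fN1 X1(2) fM1] dN1 dM1 by simp
    then show ?thesis using path_component_trans[OF Q1(2)] by blast
  qed
qed

theorem path_component_fiber_iff:
  assumes P: "P \<in> projectors scl" and Q: "Q \<in> fiber P" and Q': "Q' \<in> fiber P"
  shows "path_component (fiber P) Q Q' \<longleftrightarrow>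
    relative_dim scl (rg Q) (rg P)
      = relative_dim scl (rg Q') (rg P)"
proof
  assume eq: "relative_dim scl (rg Q) (rg P)
      = relative_dim scl (rg Q') (rg P)"
  note Qp = fiberD(1)[OF Q] and Qp' = fiberD(1)[OF Q']
  have "compact_op ((Q - P) - (Q' - P))" by (rule compact_op_diff[OF fiberD(2)[OF Q] fiberD(2)[OF Q']])
  then have pert: "compact_pert Q' Q" using compact_pert_if_diff[OF Qp' Qp] by simp
  obtain S N M where sp: "splits Q' Q S N M" using splitting_projector[OF Qp' Qp pert] by blast
  note S = splitsD(1-4)[OF sp] and N = splitsD(5,6)[OF sp] and M = splitsD(7-9)[OF sp]
  note n = complement_inD[OF N(1)] and m = complement_inD[OF M(1)]
  \<comment> \<open>\<open>Q' + D\<close> tilts the range of \<open>Q'\<close> along its kernel: the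
    part \<open>Q' (S x)\<close> is moved to \<open>S x\<close>, and \<open>M\<close> is left in
    place. As \<open>S Q' = S\<close>, the square of \<open>D\<close> is zero.\<close>
  define D where "D = (id_blinfun - Q') o\<^sub>L S"
  have D: "D x = S x - Q' (S x)" for x by (simp add: D_def blinfun.diff_left)
  have "D = ((id_blinfun - Q') o\<^sub>L Q) o\<^sub>L S" by (rule blinfun_eqI) (simp add: D blinfun.diff_left S(3))
  then have "compact_op D" using pert by (simp add: compact_pert_def compact_op_compose_right)
  moreover have "D \<in> bops" unfolding D_def using projectors_bops[OF Qp'] projectors_bops[OF S(1)] by (intro bops_intros)
  ultimately have Q1: "Q' + D \<in> fiber P" "path_component (fiber P) Q' (Q' + D)"
    using path_component_segment[OF Q', of D] by (simp_all add: D blinfun.diff_right projector_idem[OF Qp'] S(2))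
  have Q1S: "(Q' + D) x = x" if "x \<in> rg S" for x
    using that S(4) by (auto simp: blinfun.add_left D)
  have MQ': "Q' x = x" if "x \<in> M" for x using that m(7) range_projector[OF Qp'] by blast
  have Q1M: "(Q' + D) x = x" if "x \<in> M" for x
    using MQ'[OF that] M(3)[OF that] by (simp add: blinfun.add_left D blinfun.zero_right)
  note Q1p = fiberD(1)[OF Q1(1)]
  have M1: "complement_in (rg S) (rg (Q' + D)) M"
  proof (rule complement_inI)
    show "rg S \<subseteq> rg (Q' + D)" using Q1S by (metis rangeI subsetI)
    show "M \<subseteq> rg (Q' + D)" using Q1M by (metis rangeI subsetI)
    show "subspace (rg (Q' + D))" by (rule subspace_range[OF projectors_bops[OF Q1p]])
    show "x = 0" if "x \<in> rg S" "x \<in> M" for x using M(3)[OF that(2)] that(1) S(4) by auto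
    fix v assume "v \<in> rg (Q' + D)"
    then obtain x where x: "v = Q' x + (S x - Q' (S x))" by (auto simp: blinfun.add_left D)
    obtain y c where yc: "y \<in> blinfun_apply Q' ` rg S" "c \<in> M" "Q' x = y + c"
      using complement_in_decomp[OF M(1), of "Q' x"] by blast
    then obtain s where s: "y = Q' (S s)" by blast
    have "S x = S (Q' x)" by (simp add: S(2))
    also have "\<dots> = S s" using M(3)[OF yc(2)] by (simp add: yc(3) s blinfun.add_right S(2,4))
    finally have "v - S s = c" using x yc(3) s by simp
    then show "\<exists>w\<in>rg S. v - w \<in> M" using yc(2) by (intro bexI[of _ "S s"]) auto
  qed (fact n(1) m(2))+
  obtain E where E: "E \<in> projectors scl" "compact_op E" "rg E = N"
    "\<And>w. w \<in> rg S \<Longrightarrow> E w = 0"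
    using compact_projector_onto[OF n(2) N(2) n(1) closed_range_projector[OF S(1)]] complement_in_zero[OF N(1)] by blast
  have EN: "E x = x" if "x \<in> N" for x using that range_projector[OF E(1)] E(3) by blast
  \<comment> \<open>Modulo the range of \<open>S\<close>, the range of \<open>Q\<close> is
    \<open>N\<close>, so the compact projector \<open>E\<close> may be inserted; this makes
    \<open>S\<close> comparable with \<open>P\<close>.\<close>
  have "(id_blinfun - S) o\<^sub>L Q = (id_blinfun - S) o\<^sub>L (E o\<^sub>L Q)"
  proof (rule blinfun_eqI)
    fix x
    obtain s c where sc: "s \<in> rg S" "c \<in> N" "Q x = s + c"
      using complement_in_decomp[OF N(1), of "Q x"] by blast
    have "S s = s" using sc(1) S(4) by auto
    then show "((id_blinfun - S) o\<^sub>L Q) x = ((id_blinfun - S) o\<^sub>L (E o\<^sub>L Q)) x"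
      using E(4)[OF sc(1)] EN[OF sc(2)] by (simp add: sc(3) blinfun.diff_left blinfun.add_right)
  qed
  then have SQ: "compact_op ((id_blinfun - S) o\<^sub>L Q)"
    using E(2) by (simp add: compact_op_compose_left compact_op_compose_right)
  have pertQ: "compact_pert P Q" and pertQ1: "compact_pert P (Q' + D)"
    using compact_pert_if_diff[OF P] fiberD Q Q1(1) by blast+
  have "(id_blinfun - P) o\<^sub>L S = ((id_blinfun - P) o\<^sub>L Q) o\<^sub>L S"
    "(id_blinfun - S) o\<^sub>L P = (((id_blinfun - S) o\<^sub>L Q) o\<^sub>L P) + ((id_blinfun - S) o\<^sub>L ((id_blinfun - Q) o\<^sub>L P))"
    by (rule blinfun_eqI, simp add: blinfun.diff_left blinfun.add_left blinfun.diff_right S(3))+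
  then have pertS: "compact_pert P S"
    using pertQ SQ unfolding compact_pert_def
    by (simp add: compact_op_add compact_op_compose_left compact_op_compose_right)
  \<comment> \<open>Both relative dimensions are that of the range of \<open>S\<close> plus its
    codimension in the respective range.\<close>
  have "int (dim N) = int (dim M)"
    using relative_dim_extension[OF P Qp pertQ S(1) pertS N] relative_dim_extension[OF P Q1p pertQ1 S(1) pertS M1 M(2)]
      relative_dim_path_component[OF P Q1(2)] eq by simp
  then have "path_component (fiber P) Q (Q' + D)"
    using path_component_commensurable[OF closed_range_projector[OF S(1)] Q Q1(1) N M1 M(2)] by simp
  then show "path_component (fiber P) Q Q'"
    using path_component_trans path_component_sym[OF Q1(2)] by blast
qed (rule relative_dim_path_component[OF P])

end

section \<open>Continuous selections\<close>

definition lower_hemicontinuous_on :: "'s::metric_space set \<Rightarrow> ('s \<Rightarrow> 'b::metric_space set) \<Rightarrow> bool" where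
  "lower_hemicontinuous_on S F \<longleftrightarrow>
    (\<forall>y\<in>S. \<forall>T\<in>F y. \<forall>e>0. \<exists>d>0. \<forall>x\<in>S. dist x y < d \<longrightarrow> (\<exists>T'\<in>F x. dist T T' < e))"

lemma convex_infdist_less:
  fixes F :: "'b::real_normed_vector set"
  assumes "convex F"
  shows "convex {g. \<exists>T\<in>F. dist g T < e}"
proof -
  have "{g. \<exists>T\<in>F. dist g T < e} = (\<Union>T\<in>F. \<Union>b\<in>ball 0 e. {T + b})"
  proof (intro equalityI subsetI)
    fix g assume "g \<in> {g. \<exists>T\<in>F. dist g T < e}"
    then obtain T where "T \<in> F" "dist g T < e" by blast
    then show "g \<in> (\<Union>T\<in>F. \<Union>b\<in>ball 0 e. {T + b})"
      by (intro UN_I[of T F] UN_I[of "g - T" "ball 0 e"]) (simp_all add: dist_norm norm_minus_commute)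
  next
    fix g assume "g \<in> (\<Union>T\<in>F. \<Union>b\<in>ball 0 e. {T + b})"
    then obtain T b where "T \<in> F" "norm b < e" "g = T + b" by auto
    then show "g \<in> {g. \<exists>T\<in>F. dist g T < e}" by (auto simp: dist_norm intro!: bexI[of _ T])
  qed
  then show ?thesis using convex_sums[OF assms convex_ball[of 0 e]] by simp
qed

text \<open>One step of the iteration for the selection theorem. Near each \<open>y\<close> a
  constant \<open>T y\<close> is good enough by lower hemicontinuity; a partition of unity glues
  these constants, since closeness to \<open>G x\<close> and closeness to the convex set
  \<open>F x\<close> are convex conditions.\<close>

lemma approximate_selection:
  fixes S :: "'s::metric_space set" and F :: "'s \<Rightarrow> 'b::real_normed_vector set"
  assumes S: "compact S" and F: "\<And>x. x \<in> S \<Longrightarrow> convex (F x)" "lower_hemicontinuous_on S F"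
    and G: "continuous_on S G" "\<And>x. x \<in> S \<Longrightarrow> \<exists>T\<in>F x. dist (G x) T < e" and e': "0 < e'"
  shows "\<exists>G'. continuous_on S G' \<and> (\<forall>x\<in>S. dist (G x) (G' x) < e \<and> (\<exists>T\<in>F x. dist (G' x) T < e'))"
proof (cases "S = {}")
  case True
  then show ?thesis by simp
next
  case False
  have "\<exists>T d. d > 0 \<and> (\<forall>x\<in>S. dist x y < d \<longrightarrow> (\<exists>T'\<in>F x. dist T T' < e') \<and> dist (G x) T < e)" if y: "y \<in> S" for y
  proof -
    obtain T where T: "T \<in> F y" "dist (G y) T < e" using G(2)[OF y] by blast
    obtain d1 where d1: "d1 > 0" "\<And>x. x \<in> S \<Longrightarrow> dist x y < d1 \<Longrightarrow> \<exists>T'\<in>F x. dist T T' < e'"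
      using F(2) y T(1) e' unfolding lower_hemicontinuous_on_def by blast
    obtain d2 where d2: "d2 > 0" "\<And>x. x \<in> S \<Longrightarrow> dist x y < d2 \<Longrightarrow> dist (G x) (G y) < e - dist (G y) T"
      using G(1) y T(2) unfolding continuous_on_iff by (metis diff_gt_0_iff_gt)
    have "dist (G x) T < e" if "x \<in> S" "dist x y < d2" for x
      using d2(2)[OF that] dist_triangle[of "G x" T "G y"] by linarith
    then show ?thesis using d1 d2(1) by (intro exI[of _ T] exI[of _ "min d1 d2"]) auto
  qed
  then obtain T d where Td: "\<And>y. y \<in> S \<Longrightarrow> d y > 0" "\<And>x y. y \<in> S \<Longrightarrow> x \<in> S \<Longrightarrow> dist x y < d y \<Longrightarrow> \<exists>T'\<in>F x. dist (T y) T' < e'"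
    "\<And>x y. y \<in> S \<Longrightarrow> x \<in> S \<Longrightarrow> dist x y < d y \<Longrightarrow> dist (G x) (T y) < e"
    by metis
  have "S \<subseteq> (\<Union>y\<in>S. ball y (d y))" using Td(1) by force
  then obtain C where C: "C \<subseteq> S" "finite C" "S \<subseteq> (\<Union>y\<in>C. ball y (d y))"
    using compactE_image[OF S, of S "\<lambda>y. ball y (d y)"] by blast
  \<comment> \<open>An unnormalized partition of unity: \<open>w y\<close> is positive exactly on
    the ball of radius \<open>d y\<close> around \<open>y\<close>.\<close>
  define w where "w y x = max 0 (d y - dist x y)" for y x
  define s where "s x = (\<Sum>y\<in>C. w y x)" for x
  have w0: "w y x \<ge> 0" for y x by (simp add: w_def)
  have s: "s x > 0" if x: "x \<in> S" for x
  proof -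
    obtain y where y: "y \<in> C" "dist y x < d y" using x C(3) by (meson UN_E mem_ball subsetD)
    have "0 < w y x" using y(2) by (simp add: w_def dist_commute)
    also have "\<dots> \<le> s x" unfolding s_def by (rule member_le_sum[OF y(1) w0 C(2)])
    finally show ?thesis .
  qed
  define G' where "G' x = (\<Sum>y\<in>C. (w y x / s x) *\<^sub>R T y)" for x
  have "continuous_on S G'"
    unfolding G'_def w_def s_def
    by (intro continuous_intros) (use s in \<open>auto simp: s_def w_def less_imp_neq[symmetric]\<close>)
  \<comment> \<open>At \<open>x\<close> only centres within their radius carry weight, so
    \<open>G' x\<close> is a convex combination of points of \<open>K\<close>. Both estimates are
    instances.\<close>
  moreover have "G' x \<in> K" if x: "x \<in> S" and K: "convex K" "\<And>y. y \<in> S \<Longrightarrow> dist x y < d y \<Longrightarrow> T y \<in> K" for x K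
  proof -
    define C' where "C' = {y \<in> C. dist x y < d y}"
    have C': "finite C'" "C' \<subseteq> C" using C(2) by (auto simp: C'_def)
    have zero: "w y x = 0" if "y \<in> C - C'" for y using that by (auto simp: w_def C'_def)
    have "G' x = (\<Sum>y\<in>C'. (w y x / s x) *\<^sub>R T y)"
      unfolding G'_def by (rule sum.mono_neutral_right[OF C(2) C'(2)]) (simp add: zero)
    moreover have "s x = (\<Sum>y\<in>C'. w y x)"
      unfolding s_def by (rule sum.mono_neutral_right[OF C(2) C'(2)]) (simp add: zero)
    then have "(\<Sum>y\<in>C'. w y x / s x) = 1" using s[OF x] by (simp flip: sum_divide_distrib)
    ultimately show ?thesis
      using convex_sum[OF C'(1) K(1), of "\<lambda>y. w y x / s x" T] w0 s[OF x] K(2) C(1)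
      by (auto simp: C'_def less_imp_le)
  qed
  note inK = this
  have "dist (G x) (G' x) < e \<and> (\<exists>T\<in>F x. dist (G' x) T < e')" if x: "x \<in> S" for x
  proof
    have "G' x \<in> ball (G x) e" by (rule inK[OF x]) (use Td(3) x in auto)
    then show "dist (G x) (G' x) < e" by simp
    have "G' x \<in> {g. \<exists>T\<in>F x. dist g T < e'}"
      by (rule inK[OF x convex_infdist_less[OF F(1)[OF x]]]) (use Td(2) x in auto)
    then show "\<exists>T\<in>F x. dist (G' x) T < e'" by simp
  qed
  ultimately show ?thesis by blast
qed

text \<open>Michael's selection theorem, for a compact metric domain.\<close>
theorem continuous_selection:
  fixes S :: "'s::metric_space set" and F :: "'s \<Rightarrow> 'b::banach set"
  assumes S: "compact S" and F: "\<And>x. x \<in> S \<Longrightarrow> convex (F x)" "\<And>x. x \<in> S \<Longrightarrow> closed (F x)"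
    "\<And>x. x \<in> S \<Longrightarrow> F x \<noteq> {}" "lower_hemicontinuous_on S F"
  shows "\<exists>C. continuous_on S C \<and> (\<forall>x\<in>S. C x \<in> F x)"
proof -
  \<comment> \<open>A uniform bound on the distance of 0 from the sets \<open>F x\<close> allows the
    iteration to start at the zero map.\<close>
  have "\<exists>M>0. \<forall>x\<in>S. \<exists>T\<in>F x. dist 0 T < M"
  proof -
    have "\<exists>r d. d > 0 \<and> (\<forall>x\<in>S. dist x y < d \<longrightarrow> (\<exists>T\<in>F x. dist 0 T < r))" if y: "y \<in> S" for y
    proof -
      obtain T where T: "T \<in> F y" using F(3)[OF y] by blast
      obtain d where d: "d > 0" "\<And>x. x \<in> S \<Longrightarrow> dist x y < d \<Longrightarrow> \<exists>T'\<in>F x. dist T T' < 1"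
        using F(4) y T unfolding lower_hemicontinuous_on_def by (meson zero_less_one)
      have "\<exists>T'\<in>F x. dist 0 T' < norm T + 1" if x: "x \<in> S" "dist x y < d" for x
      proof -
        obtain T' where T': "T' \<in> F x" "dist T T' < 1" using d(2)[OF x] by blast
        have "dist 0 T' < norm T + 1" using dist_triangle[of 0 T' T] T'(2) by simp
        then show ?thesis using T'(1) by blast
      qed
      then show ?thesis using d(1) by blast
    qed
    then obtain r d where rd: "\<And>y. y \<in> S \<Longrightarrow> d y > 0"
      "\<And>x y. y \<in> S \<Longrightarrow> x \<in> S \<Longrightarrow> dist x y < d y \<Longrightarrow> \<exists>T\<in>F x. dist 0 T < r y"
      by metis
    have "S \<subseteq> (\<Union>y\<in>S. ball y (d y))" using rd(1) by force
    then obtain C where C: "C \<subseteq> S" "finite C" "S \<subseteq> (\<Union>y\<in>C. ball y (d y))"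
      using compactE_image[OF S, of S "\<lambda>y. ball y (d y)"] by blast
    have "\<exists>T\<in>F x. dist 0 T < (\<Sum>y\<in>C. \<bar>r y\<bar>) + 1" if x: "x \<in> S" for x
    proof -
      obtain y where y: "y \<in> C" "dist x y < d y" using x C(3) by (metis UN_E mem_ball subsetD dist_commute)
      then obtain T where "T \<in> F x" "dist 0 T < r y" using rd(2)[of y x] C(1) x by blast
      moreover have "\<bar>r y\<bar> \<le> (\<Sum>y\<in>C. \<bar>r y\<bar>)" by (rule member_le_sum[OF y(1) _ C(2)]) auto
      ultimately show ?thesis by (intro bexI[of _ T]) auto
    qed
    moreover have "(\<Sum>y\<in>C. \<bar>r y\<bar>) + 1 > 0" by (simp add: add_nonneg_pos sum_nonneg)
    ultimately show ?thesis by blast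
  qed
  then obtain M where M: "M > 0" "\<And>x. x \<in> S \<Longrightarrow> \<exists>T\<in>F x. dist 0 T < M" by blast
  \<comment> \<open>The error is halved at each step, and successive approximations differ by less
    than the current error, so they converge uniformly.\<close>
  define A where "A n G \<longleftrightarrow> continuous_on S G \<and> (\<forall>x\<in>S. \<exists>T\<in>F x. dist (G x) T < M / 2 ^ n)" for n and G :: "'s \<Rightarrow> 'b"
  have step: "\<exists>G'. A (Suc n) G' \<and> (\<forall>x\<in>S. dist (G x) (G' x) < M / 2 ^ n)" if "A n G" for n G
    using approximate_selection[OF S F(1,4), of G "M / 2 ^ n" "M / 2 ^ Suc n"] that M(1) unfolding A_def by fastforce
  have "\<exists>f. \<forall>n. (A n (f n) \<and> (n = 0 \<longrightarrow> f n = (\<lambda>_. 0))) \<and> (\<forall>x\<in>S. dist (f n x) (f (Suc n) x) < M / 2 ^ n)"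
  proof (rule dependent_nat_choice)
    show "\<exists>G. A 0 G \<and> (0 = 0 \<longrightarrow> G = (\<lambda>_. 0))" using M by (auto simp: A_def)
  qed (use step in auto)
  then obtain G where G: "\<And>n. A n (G n)" "G 0 = (\<lambda>_. 0)"
    "\<And>n x. x \<in> S \<Longrightarrow> dist (G n x) (G (Suc n) x) < M / 2 ^ n"
    by blast
  define C where "C x = (\<Sum>n. G (Suc n) x - G n x)" for x
  have "summable (\<lambda>n. M * (1/2) ^ n)" by (intro summable_mult summable_geometric) simp
  moreover have "norm (G (Suc n) x - G n x) \<le> M * (1/2) ^ n" if "x \<in> S" for n x
    using G(3)[OF that, of n] by (simp add: dist_norm norm_minus_commute power_one_over)
  ultimately have "uniform_limit S (\<lambda>n x. \<Sum>i<n. G (Suc i) x - G i x) C sequentially"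
    unfolding C_def by (intro Weierstrass_m_test)
  then have lim: "uniform_limit S G C sequentially"
    by (simp add: sum_lessThan_telescope[of "\<lambda>i. G i _"] G(2))
  have "continuous_on S C"
    by (rule uniform_limit_theorem[OF _ lim]) (use G(1) in \<open>auto simp: A_def\<close>)
  moreover have "C x \<in> F x" if x: "x \<in> S" for x
  proof -
    have "\<forall>n. \<exists>T. T \<in> F x \<and> dist (G n x) T < M * (1/2) ^ n" using G(1) x by (auto simp: A_def power_one_over)
    then obtain T where T: "\<And>n. T n \<in> F x" "\<And>n. dist (G n x) (T n) < M * (1/2) ^ n" by metis
    have "(\<lambda>n. M * (1/2) ^ n) \<longlonglongrightarrow> M * 0" by (intro tendsto_mult tendsto_const LIMSEQ_power_zero) simp
    then have "(\<lambda>n. M * (1/2) ^ n) \<longlonglongrightarrow> 0" by simp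
    then have "(\<lambda>n. G n x - T n) \<longlonglongrightarrow> 0"
      by (rule Lim_null_comparison[rotated]) (use T(2) in \<open>auto simp: dist_norm intro!: always_eventually less_imp_le\<close>)
    then have "(\<lambda>n. G n x - (G n x - T n)) \<longlonglongrightarrow> C x - 0"
      by (intro tendsto_diff tendsto_uniform_limitI[OF lim x])
    then have "T \<longlonglongrightarrow> C x" by simp
    then show ?thesis using closed_sequentially[OF F(2)[OF x]] T(1) by blast
  qed
  ultimately show ?thesis by blast
qed

section \<open>Lifting continuous maps into the Calkin algebra\<close>

context banach_space_over
begin

lemma calkin_proj_cong: "compact_op (S - T) \<Longrightarrow> S \<in> bops \<Longrightarrow> T \<in> bops \<Longrightarrow> calkin_proj scl S = calkin_proj scl T"
proof -
  have *: "calkin_proj scl S \<subseteq> calkin_proj scl T" if "compact_op (S - T)" "S \<in> bops" "T \<in> bops" for S T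
  proof
    fix A assume "A \<in> calkin_proj scl S"
    then obtain K where K: "K \<in> compact_ops scl" "A = K + S" by (auto simp: calkin_proj_eq)
    have "S - T \<in> compact_ops scl" using that by (simp add: compact_ops_def bops_diff)
    then have "K + (S - T) \<in> compact_ops scl" by (rule compact_ops_add[OF K(1)])
    moreover have "A = K + (S - T) + T" using K(2) by simp
    ultimately show "A \<in> calkin_proj scl T" unfolding calkin_proj_eq by blast
  qed
  assume "compact_op (S - T)" "S \<in> bops" "T \<in> bops"
  then show ?thesis using * compact_op_diff_commute by blast
qed

lemma calkin_proj_self: "T \<in> calkin_proj scl T"
  unfolding calkin_proj_eq using compact_ops_zero by (intro image_eqI[of _ _ 0]) auto

lemma calkin_proj_memD:
  assumes "A \<in> calkin_proj scl T" "T \<in> bops"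
  shows "A \<in> bops" "compact_op (A - T)" "calkin_proj scl A = calkin_proj scl T"
proof -
  obtain K where K: "K \<in> compact_ops scl" "A = K + T" using assms(1) by (auto simp: calkin_proj_eq)
  then show "A \<in> bops" "compact_op (A - T)" using assms(2) by (auto simp: compact_ops_def bops_add)
  then show "calkin_proj scl A = calkin_proj scl T" using assms(2) by (intro calkin_proj_cong)
qed

lemma calkin_proj_eq_iff:
  assumes "S \<in> bops" "T \<in> bops"
  shows "calkin_proj scl S = calkin_proj scl T \<longleftrightarrow> compact_op (S - T)"
  using assms calkin_proj_cong calkin_proj_memD(2) calkin_proj_self by metis

lemma calkin_proj_idempotent_iff:
  assumes T: "T \<in> bops"
  shows "calkin_proj scl T \<in> idempotents (calkin scl) \<longleftrightarrow> compact_op ((T o\<^sub>L T) - T)"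
proof -
  have mult: "mult (bounded_ops scl) T T = (T o\<^sub>L T)" by (simp add: bounded_ops_def)
  have "calkin_proj scl T \<otimes>\<^bsub>calkin scl\<^esub> calkin_proj scl T = calkin_proj scl (T o\<^sub>L T)"
    unfolding calkin_def FactRing_def calkin_proj_def
    using ideal.rcoset_mult_add[OF ideal_compact_ops T T] by (simp add: mult)
  then show ?thesis
    unfolding idempotents_def using calkin_proj_eq_iff[OF bops_compose[OF T T] T] T by (auto simp: carrier_calkin)
qed

lemma convex_calkin_proj: "convex (calkin_proj scl T)"
proof (rule convexI)
  fix A B and u v :: real
  assume "A \<in> calkin_proj scl T" "B \<in> calkin_proj scl T" and uv: "u + v = 1"
  then obtain K L where KL: "K \<in> compact_ops scl" "L \<in> compact_ops scl" "A = K + T" "B = L + T"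
    by (auto simp: calkin_proj_eq)
  have "u *\<^sub>R K + v *\<^sub>R L \<in> compact_ops scl"
    using KL by (auto simp: compact_ops_def intro: compact_op_intros bops_intros)
  moreover have "u *\<^sub>R A + v *\<^sub>R B = (u *\<^sub>R K + v *\<^sub>R L) + (u + v) *\<^sub>R T"
    using KL by (simp add: algebra_simps)
  ultimately show "u *\<^sub>R A + v *\<^sub>R B \<in> calkin_proj scl T" unfolding calkin_proj_eq using uv by auto
qed

lemma closed_bops: "closed bops"
proof -
  have "bops = (\<Inter>c. \<Inter>x. {T. blinfun_apply T (scl c x) = scl c (blinfun_apply T x)})"
    by (auto simp: bops_iff)
  moreover have "closed {T. blinfun_apply T (scl c x) = scl c (blinfun_apply T x)}" for c x
    by (intro closed_Collect_eq continuous_intros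
        bounded_linear.continuous_on[OF bounded_bilinear.bounded_linear_right[OF bounded_bilinear_scale]])
  ultimately show ?thesis by (simp add: closed_INT)
qed

lemma closed_calkin_proj:
  assumes T: "T \<in> bops"
  shows "closed (calkin_proj scl T)"
  unfolding closed_sequential_limits
proof (intro allI impI, elim conjE)
  fix X A assume X: "\<forall>n. X n \<in> calkin_proj scl T" and lim: "X \<longlonglongrightarrow> A"
  have Xn: "X n \<in> bops" "compact_op (X n - T)" for n using X calkin_proj_memD[OF _ T] by blast+
  have "A \<in> bops" using closed_sequentially[OF closed_bops _ lim] Xn(1) by blast
  moreover have "compact_op (A - T)"
  proof (rule compact_op_limit)
    fix e :: real assume "e > 0"
    then obtain n where "norm (X n - A) < e" using lim unfolding LIMSEQ_iff by blast
    then show "\<exists>S. compact_op S \<and> norm (A - T - S) < e"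
      using Xn(2)[of n] by (intro exI[of _ "X n - T"]) (simp add: norm_minus_commute)
  qed
  ultimately show "A \<in> calkin_proj scl T" using calkin_proj_cong[OF _ _ T] calkin_proj_self by metis
qed

lemma topspace_calkin: "topspace (calkin_topology scl) = carrier (calkin scl)"
  unfolding calkin_topology_def by (rule Metric_space.topspace_mtopology[OF Metric_space_calkin])

text \<open>Elements of the Calkin algebra are cosets, so \<open>f\<close> is itself a set-valued
  map with closed convex values, and a continuous selection of it is a lift.\<close>

lemma continuous_map_calkin_lift:
  assumes S: "compact (S :: 's::metric_space set)" and f: "continuous_map (top_of_set S) (calkin_topology scl) f"
  shows "\<exists>C. continuous_on S C \<and> (\<forall>x\<in>S. C x \<in> bops \<and> calkin_proj scl (C x) = f x)"
proof -
  have "\<forall>x\<in>S. \<exists>T\<in>bops. f x = calkin_proj scl T"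
    using continuous_map_image_subset_topspace[OF f] by (auto simp: topspace_calkin carrier_calkin)
  then obtain A where A: "\<And>x. x \<in> S \<Longrightarrow> A x \<in> bops" "\<And>x. x \<in> S \<Longrightarrow> f x = calkin_proj scl (A x)" by metis
  have "lower_hemicontinuous_on S f"
    unfolding lower_hemicontinuous_on_def
  proof (intro ballI allI impI)
    fix y T and e :: real assume y: "y \<in> S" "T \<in> f y" and e: "e > 0"
    obtain U where U: "openin (top_of_set S) U" "y \<in> U" "\<And>x. x \<in> U \<Longrightarrow> f x \<in> Metric_space.mball (carrier (calkin scl)) setdist (f y) e"
      using f y(1) e unfolding calkin_topology_def Metric_space.continuous_map_to_metric[OF Metric_space_calkin]
      by (metis topspace_euclidean_subtopology)
    obtain d where d: "d > 0" "\<And>x. x \<in> S \<Longrightarrow> dist x y < d \<Longrightarrow> x \<in> U"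
      using U(1,2) unfolding openin_euclidean_subtopology_iff by blast
    have "\<exists>T'\<in>f x. dist T T' < e" if x: "x \<in> S" "dist x y < d" for x
    proof -
      have "setdist (f y) (f x) < e"
        using U(3)[OF d(2)[OF x]] Metric_space.in_mball[OF Metric_space_calkin] by blast
      moreover have "f y \<noteq> {}" "f x \<noteq> {}" using A(2) x(1) y(1) calkin_proj_self by fastforce+
      ultimately obtain R R' where R: "R \<in> f y" "R' \<in> f x" "dist R R' < e" using setdist_ltE by metis
      have "compact_op (T - A y)" "compact_op (R - A y)" "compact_op (R' - A x)" "T \<in> bops" "R \<in> bops" "R' \<in> bops"
        using y(2) R(1,2) calkin_proj_memD(1,2)[OF _ A(1)[OF y(1)]] calkin_proj_memD(1,2)[OF _ A(1)[OF x(1)]]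
        unfolding A(2)[OF y(1)] A(2)[OF x(1)] by blast+
      then have "compact_op (((R' - A x) - (R - A y)) + (T - A y))" "(R' - R) + T \<in> bops"
        by (simp_all only: compact_op_add compact_op_diff bops_add bops_diff)
      then have "compact_op (((R' - R) + T) - A x)" by (simp add: algebra_simps)
      \<comment> \<open>Cosets are parallel, so the near pair \<open>R\<close>, \<open>R'\<close>
        can be translated to start at the given \<open>T\<close>.\<close>
      then have "(R' - R) + T \<in> f x"
        using calkin_proj_cong[OF _ \<open>(R' - R) + T \<in> bops\<close> A(1)[OF x(1)]] A(2)[OF x(1)] calkin_proj_self by metis
      moreover have "dist T ((R' - R) + T) = dist R R'" by (simp add: dist_norm norm_minus_commute)
      ultimately show ?thesis using R(3) by (intro bexI[of _ "(R' - R) + T"]) simp_all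
    qed
    then show "\<exists>d>0. \<forall>x\<in>S. dist x y < d \<longrightarrow> (\<exists>T'\<in>f x. dist T T' < e)" using d(1) by blast
  qed
  moreover have "convex (f x)" "closed (f x)" "f x \<noteq> {}" if "x \<in> S" for x
    unfolding A(2)[OF that] using A(1)[OF that] convex_calkin_proj closed_calkin_proj calkin_proj_self by blast+
  ultimately obtain C where C: "continuous_on S C" "\<And>x. x \<in> S \<Longrightarrow> C x \<in> f x"
    using continuous_selection[OF S, of f] by blast
  have "C x \<in> bops \<and> calkin_proj scl (C x) = f x" if "x \<in> S" for x
    using C(2)[OF that] calkin_proj_memD(1,3)[OF _ A(1)[OF that]] unfolding A(2)[OF that] by blast
  then show ?thesis using C(1) by blast
qed

text \<open>The quotient map does not increase distances.\<close>

lemma continuous_map_calkin_proj: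
  assumes C: "continuous_on S C" "\<And>x. x \<in> S \<Longrightarrow> C x \<in> bops"
  shows "continuous_map (top_of_set S) (calkin_topology scl) (\<lambda>x. calkin_proj scl (C x))"
  unfolding calkin_topology_def Metric_space.continuous_map_to_metric[OF Metric_space_calkin]
proof (intro ballI allI impI)
  fix x and e :: real assume x: "x \<in> topspace (top_of_set S)" and e: "e > 0"
  have "openin (top_of_set S) (S \<inter> C -` ball (C x) e)"
    by (rule continuous_openin_preimage_gen[OF C(1) open_ball])
  moreover have "setdist (calkin_proj scl (C x)) (calkin_proj scl (C y)) \<le> dist (C x) (C y)" for y
    by (intro setdist_le_dist calkin_proj_self)
  then have "setdist (calkin_proj scl (C x)) (calkin_proj scl (C y)) < e" if "dist (C x) (C y) < e" for y
    using that le_less_trans by blast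
  ultimately show "\<exists>U. openin (top_of_set S) U \<and> x \<in> U \<and>
      (\<forall>y\<in>U. calkin_proj scl (C y) \<in> Metric_space.mball (carrier (calkin scl)) setdist (calkin_proj scl (C x)) e)"
    using x e C(2) unfolding Metric_space.in_mball[OF Metric_space_calkin]
    by (intro exI[of _ "S \<inter> C -` ball (C x) e"]) (auto simp: carrier_calkin)
qed

section \<open>Lifting paths and homotopies of idempotents\<close>

lemmas blinfun_linear_simps = blinfun.add_left blinfun.add_right blinfun.diff_left blinfun.diff_right
  blinfun.scaleR_left blinfun.scaleR_right

section \<open>Congruence modulo compact operators\<close>

definition mod_compact :: "('a \<Rightarrow>\<^sub>L 'a) \<Rightarrow> ('a \<Rightarrow>\<^sub>L 'a) \<Rightarrow> bool" (infix "\<simeq>\<^sub>K" 50) where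
  "A \<simeq>\<^sub>K B \<longleftrightarrow> compact_op (A - B)"

lemma mod_compact_refl: "A \<simeq>\<^sub>K A"
  by (simp add: mod_compact_def compact_op_zero)

lemma mod_compact_sym: "A \<simeq>\<^sub>K B \<Longrightarrow> B \<simeq>\<^sub>K A"
  unfolding mod_compact_def by (rule compact_op_diff_commute)

lemma mod_compact_trans [trans]: "A \<simeq>\<^sub>K B \<Longrightarrow> B \<simeq>\<^sub>K C \<Longrightarrow> A \<simeq>\<^sub>K C"
  unfolding mod_compact_def by (rule compact_op_diff_trans)

lemma mod_compact_left: "A \<simeq>\<^sub>K B \<Longrightarrow> (T o\<^sub>L A) \<simeq>\<^sub>K (T o\<^sub>L B)"
proof -
  have "(T o\<^sub>L A) - (T o\<^sub>L B) = (T o\<^sub>L (A - B))" by (rule blinfun_eqI) (simp add: blinfun_linear_simps)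
  then show "A \<simeq>\<^sub>K B \<Longrightarrow> (T o\<^sub>L A) \<simeq>\<^sub>K (T o\<^sub>L B)" unfolding mod_compact_def by (metis compact_op_compose_left)
qed

lemma mod_compact_right: "A \<simeq>\<^sub>K B \<Longrightarrow> (A o\<^sub>L T) \<simeq>\<^sub>K (B o\<^sub>L T)"
proof -
  have "(A o\<^sub>L T) - (B o\<^sub>L T) = ((A - B) o\<^sub>L T)" by (rule blinfun_eqI) (simp add: blinfun_linear_simps)
  then show "A \<simeq>\<^sub>K B \<Longrightarrow> (A o\<^sub>L T) \<simeq>\<^sub>K (B o\<^sub>L T)" unfolding mod_compact_def by (metis compact_op_compose_right)
qed

lemma calkin_proj_eq_iff': "S \<in> bops \<Longrightarrow> T \<in> bops \<Longrightarrow> calkin_proj scl S = calkin_proj scl T \<longleftrightarrow> S \<simeq>\<^sub>K T"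
  unfolding mod_compact_def by (rule calkin_proj_eq_iff)

lemma blinfun_compose_assoc: "((A o\<^sub>L B) o\<^sub>L C) = (A o\<^sub>L (B o\<^sub>L C))"
  by (rule blinfun_eqI) simp

lemma blinfun_compose_id: "(A o\<^sub>L id_blinfun) = A" "(id_blinfun o\<^sub>L A) = A"
  by (rule blinfun_eqI, simp)+

text \<open>The inverses have norm at most 2, as \<open>norm (A x) \<le> 1/2\<close>; with the
  resolvent identity, \<open>W\<close> varies by at most 4 times the variation of
  \<open>A\<close>.\<close>

lemma continuous_inverse:
  fixes A :: "'s::metric_space \<Rightarrow> 'a \<Rightarrow>\<^sub>L 'a"
  assumes A: "continuous_on K A" "\<And>x. x \<in> K \<Longrightarrow> A x \<in> bops \<and> norm (A x) \<le> 1/2"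
  shows "\<exists>W. continuous_on K W \<and> (\<forall>x\<in>K. W x \<in> bops \<and> (W x o\<^sub>L (id_blinfun + A x)) = id_blinfun \<and>
    ((id_blinfun + A x) o\<^sub>L W x) = id_blinfun)"
proof -
  have "\<exists>V. V \<in> bops \<and> (V o\<^sub>L (id_blinfun + A x)) = id_blinfun \<and> ((id_blinfun + A x) o\<^sub>L V) = id_blinfun \<and> norm V \<le> 2"
    if x: "x \<in> K" for x
  proof -
    have n: "norm (A x) \<le> 1/2" "norm (A x) < 1" "A x \<in> bops" using A(2)[OF x] by auto
    have "1 / (1 - norm (A x)) \<le> 2" using n by (simp add: field_simps)
    then show ?thesis using inverse_id_plus[OF n(3,2)] by (meson order_trans)
  qed
  then obtain W where W: "\<And>x. x \<in> K \<Longrightarrow> W x \<in> bops" "\<And>x. x \<in> K \<Longrightarrow> (W x o\<^sub>L (id_blinfun + A x)) = id_blinfun"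
    "\<And>x. x \<in> K \<Longrightarrow> ((id_blinfun + A x) o\<^sub>L W x) = id_blinfun" "\<And>x. x \<in> K \<Longrightarrow> norm (W x) \<le> 2"
    by metis
  have lip: "dist (W x) (W y) \<le> 4 * dist (A x) (A y)" if "x \<in> K" "y \<in> K" for x y
  proof -
    have "W x - W y = ((W x o\<^sub>L ((id_blinfun + A y) o\<^sub>L W y)) - ((W x o\<^sub>L (id_blinfun + A x)) o\<^sub>L W y))"
      using W(2)[OF that(1)] W(3)[OF that(2)] by (simp add: blinfun_compose_id)
    also have "\<dots> = (W x o\<^sub>L ((A y - A x) o\<^sub>L W y))"
      by (rule blinfun_eqI) (simp add: blinfun_linear_simps)
    finally have "norm (W x - W y) \<le> norm (W x) * norm ((A y - A x) o\<^sub>L W y)"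
      by (simp only: norm_blinfun_compose)
    also have "\<dots> \<le> norm (W x) * (norm (A y - A x) * norm (W y))"
      by (intro mult_left_mono norm_blinfun_compose) simp
    also have "\<dots> \<le> 2 * (norm (A y - A x) * 2)"
      using W(4) that by (intro mult_mono) auto
    finally show ?thesis by (simp add: dist_norm norm_minus_commute)
  qed
  have "continuous_on K W"
    unfolding continuous_on_iff
  proof (intro ballI allI impI)
    fix x and e :: real assume x: "x \<in> K" and e: "e > 0"
    then have "e / 4 > 0" by simp
    then obtain d where d: "d > 0" "\<And>y. y \<in> K \<Longrightarrow> dist y x < d \<Longrightarrow> dist (A y) (A x) < e / 4"
      using A(1)[unfolded continuous_on_iff, rule_format, OF x] by blast
    have "dist (W y) (W x) < e" if "y \<in> K" "dist y x < d" for y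
      using lip[OF that(1) x] d(2)[OF that] by simp
    then show "\<exists>d>0. \<forall>y\<in>K. dist y x < d \<longrightarrow> dist (W y) (W x) < e" using d(1) by blast
  qed
  then show ?thesis using W(1-3) by blast
qed

text \<open>Modulo compact operators, \<open>id + (C' - C)(2 C - id)\<close> is \<open>C' C + (id - C')(id - C)\<close>, which intertwines
  the idempotents \<open>C\<close> and \<open>C'\<close>; the first form is close to \<open>id\<close> for \<open>C'\<close> close to \<open>C\<close>.\<close>
lemma intertwiner_mod_compact:
  assumes "(C o\<^sub>L C) \<simeq>\<^sub>K C" "(C' o\<^sub>L C') \<simeq>\<^sub>K C'"
  shows "((id_blinfun + ((C' - C) o\<^sub>L (2 *\<^sub>R C - id_blinfun))) o\<^sub>L C)
    \<simeq>\<^sub>K (C' o\<^sub>L (id_blinfun + ((C' - C) o\<^sub>L (2 *\<^sub>R C - id_blinfun))))"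
proof -
  define k where "k = (C o\<^sub>L C) - C"
  define k' where "k' = (C' o\<^sub>L C') - C'"
  let ?U = "id_blinfun + ((C' - C) o\<^sub>L (2 *\<^sub>R C - id_blinfun))"
  \<comment> \<open>An exact identity: the failure to intertwine is a combination of the failures
    \<open>k\<close>, \<open>k'\<close> of idempotency.\<close>
  have "(?U o\<^sub>L C) - (C' o\<^sub>L ?U) =
      ((2 *\<^sub>R (C' - C) - id_blinfun + 2 *\<^sub>R C') o\<^sub>L k) - (k' o\<^sub>L (2 *\<^sub>R C - id_blinfun))"
    by (rule blinfun_eqI) (simp add: k_def k'_def blinfun_linear_simps scaleR_2)
  moreover have "compact_op k" "compact_op k'"
    using assms by (simp_all add: mod_compact_def k_def k'_def)
  ultimately show ?thesis
    unfolding mod_compact_def by (simp add: compact_op_diff compact_op_compose_left compact_op_compose_right)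
qed

text \<open>The transport runs in the real variable; \<open>T\<close> is a parameter space, a point
  for a single path and an interval for a homotopy. The inverse \<open>W\<close> is carried along
  for its continuity. By the last clause nothing moves where \<open>C\<close> is constant, which
  keeps the ends of lifted paths fixed under a homotopy.\<close>

definition transports :: "'t set \<Rightarrow> (real \<times> 't::metric_space \<Rightarrow> 'a \<Rightarrow>\<^sub>L 'a) \<Rightarrow> (real \<times> 't \<Rightarrow> 'a \<Rightarrow>\<^sub>L 'a) \<Rightarrow>
    (real \<times> 't \<Rightarrow> 'a \<Rightarrow>\<^sub>L 'a) \<Rightarrow> bool" where
  "transports T C V W \<longleftrightarrow> continuous_on ({0..1} \<times> T) V \<and> continuous_on ({0..1} \<times> T) W \<and>
    (\<forall>s\<in>{0..1}. \<forall>t\<in>T. V (s, t) \<in> bops \<and> W (s, t) \<in> bops \<and>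
       (V (s, t) o\<^sub>L W (s, t)) = id_blinfun \<and> (W (s, t) o\<^sub>L V (s, t)) = id_blinfun \<and>
       (V (s, t) o\<^sub>L C (0, t)) \<simeq>\<^sub>K (C (s, t) o\<^sub>L V (s, t)) \<and> V (0, t) = id_blinfun \<and>
       ((\<forall>s'\<in>{0..1}. C (s', t) = C (0, t)) \<longrightarrow> V (s, t) = id_blinfun))"

lemma transportsD:
  assumes "transports T C V W"
  shows "continuous_on ({0..1} \<times> T) V" "continuous_on ({0..1} \<times> T) W"
    "s \<in> {0..1} \<Longrightarrow> t \<in> T \<Longrightarrow> V (s, t) \<in> bops" "s \<in> {0..1} \<Longrightarrow> t \<in> T \<Longrightarrow> W (s, t) \<in> bops"
    "s \<in> {0..1} \<Longrightarrow> t \<in> T \<Longrightarrow> (V (s, t) o\<^sub>L W (s, t)) = id_blinfun"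
    "s \<in> {0..1} \<Longrightarrow> t \<in> T \<Longrightarrow> (W (s, t) o\<^sub>L V (s, t)) = id_blinfun"
    "s \<in> {0..1} \<Longrightarrow> t \<in> T \<Longrightarrow> (V (s, t) o\<^sub>L C (0, t)) \<simeq>\<^sub>K (C (s, t) o\<^sub>L V (s, t))"
    "t \<in> T \<Longrightarrow> V (0, t) = id_blinfun"
    "s \<in> {0..1} \<Longrightarrow> t \<in> T \<Longrightarrow> (\<And>s'. s' \<in> {0..1} \<Longrightarrow> C (s', t) = C (0, t)) \<Longrightarrow> V (s, t) = id_blinfun"
proof -
  have "\<And>t. t \<in> T \<Longrightarrow> (0::real) \<in> {0..1}" by simp
  then show "t \<in> T \<Longrightarrow> V (0, t) = id_blinfun" using assms unfolding transports_def by blast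
qed (use assms in \<open>(unfold transports_def, blast)+\<close>)

text \<open>The transport \<open>V\<close> is a product of intertwiners over a fine subdivision of the unit interval.\<close>
lemma idempotent_transport:
  fixes C :: "real \<times> 't::metric_space \<Rightarrow> 'a \<Rightarrow>\<^sub>L 'a"
  assumes T: "compact T" and C: "continuous_on ({0..1} \<times> T) C"
    "\<And>s t. s \<in> {0..1} \<Longrightarrow> t \<in> T \<Longrightarrow> C (s, t) \<in> bops \<and> (C (s, t) o\<^sub>L C (s, t)) \<simeq>\<^sub>K C (s, t)"
  shows "\<exists>V W. transports T C V W"
proof -
  let ?K = "{0..1::real} \<times> T"
  have K: "compact ?K" using T by (intro compact_Times compact_Icc)
  define B where "B x = 2 *\<^sub>R C x - id_blinfun" for x
  have contB: "continuous_on ?K B" unfolding B_def by (intro continuous_intros C(1))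
  obtain M where M: "M > 0" "\<And>x. x \<in> ?K \<Longrightarrow> norm (B x) \<le> M"
    using compact_imp_bounded[OF compact_continuous_image[OF contB K]] unfolding bounded_pos by auto
  have uc: "uniformly_continuous_on ?K C" by (rule compact_uniformly_continuous[OF C(1) K])
  \<comment> \<open>This bound on the variation of \<open>C\<close> yields
    \<open>norm (A x) \<le> 1/2\<close>, as \<open>norm (B x) \<le> M\<close>.\<close>
  have "1 / (2 * M) > 0" using M(1) by simp
  then obtain d where d: "d > 0" "\<And>x y. x \<in> ?K \<Longrightarrow> y \<in> ?K \<Longrightarrow> dist y x < d \<Longrightarrow> dist (C y) (C x) < 1 / (2 * M)"
    using uc[unfolded uniformly_continuous_on_def, rule_format] by blast
  obtain m where "1 / real (Suc m) < d" using nat_approx_posE[OF d(1)] .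
  then obtain n :: nat where n: "n > 0" "1 / real n < d" by blast
  \<comment> \<open>The invariant is a transport that stops at parameter
    \<open>j / n\<close>.\<close>
  define I where "I j V W \<longleftrightarrow> continuous_on ?K V \<and> continuous_on ?K W \<and>
    (\<forall>s\<in>{0..1}. \<forall>t\<in>T. V (s, t) \<in> bops \<and> W (s, t) \<in> bops \<and>
       (V (s, t) o\<^sub>L W (s, t)) = id_blinfun \<and> (W (s, t) o\<^sub>L V (s, t)) = id_blinfun \<and>
       (V (s, t) o\<^sub>L C (0, t)) \<simeq>\<^sub>K (C (min s (real j / real n), t) o\<^sub>L V (s, t)) \<and>
       V (0, t) = id_blinfun \<and>
       ((\<forall>s'\<in>{0..1}. C (s', t) = C (0, t)) \<longrightarrow> V (s, t) = id_blinfun))"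
    for j and V W :: "real \<times> 't \<Rightarrow> 'a \<Rightarrow>\<^sub>L 'a"
  have "\<exists>V W. I j V W" if "j \<le> n" for j
    using that
  proof (induction j)
    case 0
    have "I 0 (\<lambda>_. id_blinfun) (\<lambda>_. id_blinfun)"
      unfolding I_def by (auto simp: bops_id blinfun_compose_id mod_compact_refl)
    then show ?case by blast
  next
    case (Suc j)
    then obtain V W where VW: "I j V W" by auto
    define a b where "a = real j / real n" and "b = real (Suc j) / real n"
    have ab: "0 \<le> a" "a \<le> b" "b \<le> 1" "b - a = 1 / real n"
      using Suc.prems n(1) by (auto simp: a_def b_def field_simps)
    \<comment> \<open>Clamping to the current subinterval makes the new factor \<open>id + A\<close>
      trivial up to \<open>a\<close> and constant from \<open>b\<close> on, hence continuous on the
      whole interval.\<close>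
    define c where "c s = max a (min s b)" for s :: real
    have c: "c s \<in> {0..1}" "\<bar>c s - a\<bar> < d" for s
      using ab n(2) by (auto simp: c_def)
    define A where "A x = ((C (c (fst x), snd x) - C (a, snd x)) o\<^sub>L B (a, snd x))" for x
    have "continuous_on ?K A"
      unfolding A_def
    proof (intro continuous_intros bounded_bilinear.continuous_on[OF bounded_bilinear_blinfun_compose])
      show "continuous_on ?K (\<lambda>x. C (c (fst x), snd x))"
        unfolding c_def
        by (rule continuous_on_compose2[OF C(1)]) (use c(1) in \<open>auto intro!: continuous_intros simp: c_def\<close>)
      show "continuous_on ?K (\<lambda>x. C (a, snd x))"
        by (rule continuous_on_compose2[OF C(1)]) (use ab in \<open>auto intro!: continuous_intros\<close>)
      show "continuous_on ?K (\<lambda>x. B (a, snd x))"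
        by (rule continuous_on_compose2[OF contB]) (use ab in \<open>auto intro!: continuous_intros\<close>)
    qed
    moreover have "A x \<in> bops \<and> norm (A x) \<le> 1/2" if x: "x \<in> ?K" for x
    proof
      have t: "snd x \<in> T" and a: "a \<in> {0..1}" using x ab by auto
      show "A x \<in> bops" unfolding A_def B_def
        using C(2)[OF a t] C(2)[OF c(1) t] by (intro bops_intros) blast+
      have "dist (c (fst x), snd x) (a, snd x) < d" using c(2) by (simp add: dist_Pair_Pair dist_real_def)
      then have "norm (C (c (fst x), snd x) - C (a, snd x)) < 1 / (2 * M)"
        using d(2)[of "(a, snd x)" "(c (fst x), snd x)"] t a c(1) by (simp add: dist_norm)
      then have "norm (C (c (fst x), snd x) - C (a, snd x)) * norm (B (a, snd x)) \<le> 1 / (2 * M) * M"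
        using M(1) M(2)[of "(a, snd x)"] t a by (intro mult_mono) auto
      also have "1 / (2 * M) * M = 1/2" using M(1) by simp
      finally show "norm (A x) \<le> 1/2"
        using norm_blinfun_compose[of "C (c (fst x), snd x) - C (a, snd x)" "B (a, snd x)"] unfolding A_def by linarith
    qed
    ultimately obtain R where R: "continuous_on ?K R" "\<And>x. x \<in> ?K \<Longrightarrow> R x \<in> bops"
      "\<And>x. x \<in> ?K \<Longrightarrow> (R x o\<^sub>L (id_blinfun + A x)) = id_blinfun"
      "\<And>x. x \<in> ?K \<Longrightarrow> ((id_blinfun + A x) o\<^sub>L R x) = id_blinfun" and A: "continuous_on ?K A" "\<And>x. x \<in> ?K \<Longrightarrow> A x \<in> bops"
      using continuous_inverse[of ?K A] by blast
    define V' where "V' x = ((id_blinfun + A x) o\<^sub>L V x)" for x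
    define W' where "W' x = (W x o\<^sub>L R x)" for x
    have "I (Suc j) V' W'"
      unfolding I_def
    proof (intro conjI ballI)
      show "continuous_on ?K V'" "continuous_on ?K W'"
        unfolding V'_def W'_def using VW R(1) A(1)
        by (auto simp: I_def intro!: continuous_intros bounded_bilinear.continuous_on[OF bounded_bilinear_blinfun_compose])
      fix s t assume st: "s \<in> {0..1::real}" "t \<in> T"
      then have x: "(s, t) \<in> ?K" by simp
      have a: "a \<in> {0..1}" using ab by simp
      have v: "V (s, t) \<in> bops" "W (s, t) \<in> bops" "(V (s, t) o\<^sub>L W (s, t)) = id_blinfun" "(W (s, t) o\<^sub>L V (s, t)) = id_blinfun"
        "(V (s, t) o\<^sub>L C (0, t)) \<simeq>\<^sub>K (C (min s a, t) o\<^sub>L V (s, t))" "V (0, t) = id_blinfun"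
        "(\<forall>s'\<in>{0..1}. C (s', t) = C (0, t)) \<Longrightarrow> V (s, t) = id_blinfun"
        using VW st unfolding I_def a_def by blast+
      show "V' (s, t) \<in> bops" "W' (s, t) \<in> bops"
        unfolding V'_def W'_def using v A(2)[OF x] R(2)[OF x] by (auto intro!: bops_intros)
      have "(V' (s, t) o\<^sub>L W' (s, t)) = ((id_blinfun + A (s, t)) o\<^sub>L ((V (s, t) o\<^sub>L W (s, t)) o\<^sub>L R (s, t)))"
        by (simp add: V'_def W'_def blinfun_compose_assoc)
      then show "(V' (s, t) o\<^sub>L W' (s, t)) = id_blinfun" using v(3) R(4)[OF x] by (simp add: blinfun_compose_id)
      have "(W' (s, t) o\<^sub>L V' (s, t)) = (W (s, t) o\<^sub>L ((R (s, t) o\<^sub>L (id_blinfun + A (s, t))) o\<^sub>L V (s, t)))"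
        by (simp add: V'_def W'_def blinfun_compose_assoc)
      then show "(W' (s, t) o\<^sub>L V' (s, t)) = id_blinfun" using v(4) R(3)[OF x] by (simp add: blinfun_compose_id)
      have A0: "A (s', t) = 0" if "c s' = a" for s' by (simp add: A_def that)
      show "(V' (s, t) o\<^sub>L C (0, t)) \<simeq>\<^sub>K (C (min s (real (Suc j) / real n), t) o\<^sub>L V' (s, t))"
      proof (cases "s \<le> a")
        case True
        then have "c s = a" "min s a = s" "min s b = s" using ab by (auto simp: c_def)
        then show ?thesis
          unfolding b_def[symmetric] using v(5) A0[of s] by (simp add: V'_def blinfun_compose_id)
      next
        case False
        then have m: "min s a = a" "min s b = c s" using ab by (auto simp: c_def)
        let ?U = "id_blinfun + A (s, t)"
        have "(V' (s, t) o\<^sub>L C (0, t)) = (?U o\<^sub>L (V (s, t) o\<^sub>L C (0, t)))" by (simp add: V'_def blinfun_compose_assoc)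
        also have "\<dots> \<simeq>\<^sub>K (?U o\<^sub>L (C (a, t) o\<^sub>L V (s, t)))" using v(5) m(1) by (intro mod_compact_left) simp
        also have "\<dots> = ((?U o\<^sub>L C (a, t)) o\<^sub>L V (s, t))" by (simp add: blinfun_compose_assoc)
        also have "\<dots> \<simeq>\<^sub>K ((C (c s, t) o\<^sub>L ?U) o\<^sub>L V (s, t))"
          unfolding A_def B_def fst_conv snd_conv
          using C(2)[OF a st(2)] C(2)[OF c(1) st(2)] by (intro mod_compact_right intertwiner_mod_compact) blast+
        also have "\<dots> = (C (min s b, t) o\<^sub>L V' (s, t))" by (simp add: V'_def blinfun_compose_assoc m)
        finally show ?thesis by (simp add: b_def)
      qed
      have "c 0 = a" using ab by (auto simp: c_def)
      then show "V' (0, t) = id_blinfun" using A0 v(6) by (simp add: V'_def blinfun_compose_id)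
      show "(\<forall>s'\<in>{0..1}. C (s', t) = C (0, t)) \<longrightarrow> V' (s, t) = id_blinfun"
      proof
        assume const: "\<forall>s'\<in>{0..1}. C (s', t) = C (0, t)"
        have "C (c s, t) = C (0, t)" "C (a, t) = C (0, t)" using const c(1) a by blast+
        then have "A (s, t) = 0" by (simp add: A_def)
        then show "V' (s, t) = id_blinfun" by (simp add: V'_def blinfun_compose_id v(7)[OF const])
      qed
    qed
    then show ?case by blast
  qed
  then obtain V W where VW: "I n V W" by blast
  have "min s (real n / real n) = s" if "s \<in> {0..1}" for s using that n(1) by simp
  note min_eq = this
  have i: "V (s, t) \<in> bops \<and> W (s, t) \<in> bops \<and>
       (V (s, t) o\<^sub>L W (s, t)) = id_blinfun \<and> (W (s, t) o\<^sub>L V (s, t)) = id_blinfun \<and>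
       (V (s, t) o\<^sub>L C (0, t)) \<simeq>\<^sub>K (C (min s (real n / real n), t) o\<^sub>L V (s, t)) \<and>
       V (0, t) = id_blinfun \<and>
       ((\<forall>s'\<in>{0..1}. C (s', t) = C (0, t)) \<longrightarrow> V (s, t) = id_blinfun)" if "s \<in> {0..1}" "t \<in> T" for s t
    using VW that unfolding I_def by blast
  have "V (s, t) \<in> bops \<and> W (s, t) \<in> bops \<and>
       (V (s, t) o\<^sub>L W (s, t)) = id_blinfun \<and> (W (s, t) o\<^sub>L V (s, t)) = id_blinfun \<and>
       (V (s, t) o\<^sub>L C (0, t)) \<simeq>\<^sub>K (C (s, t) o\<^sub>L V (s, t)) \<and>
       V (0, t) = id_blinfun \<and>
       ((\<forall>s'\<in>{0..1}. C (s', t) = C (0, t)) \<longrightarrow> V (s, t) = id_blinfun)" if st: "s \<in> {0..1}" "t \<in> T" for s t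
    using i[OF st] unfolding min_eq[OF st(1)] .
  then have "transports T C V W" using VW unfolding I_def transports_def by blast
  then show ?thesis by blast
qed

section \<open>Lifts of loops and of their homotopies\<close>

definition lifts :: "('a \<Rightarrow>\<^sub>L 'a) \<Rightarrow> (real \<Rightarrow> ('a \<Rightarrow>\<^sub>L 'a) set) \<Rightarrow> (real \<Rightarrow> 'a \<Rightarrow>\<^sub>L 'a) \<Rightarrow> bool" where
  "lifts P a b \<longleftrightarrow> path b \<and> path_image b \<subseteq> projectors scl \<and> b 0 = P \<and> (\<forall>t\<in>{0..1}. calkin_proj scl (b t) = a t)"

lemma lifts_projector: "lifts P a b \<Longrightarrow> t \<in> {0..1} \<Longrightarrow> b t \<in> projectors scl"
  unfolding lifts_def path_image_def by blast

lemma projector_mod_compact: "Q \<in> projectors scl \<Longrightarrow> (Q o\<^sub>L Q) \<simeq>\<^sub>K Q"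
proof -
  assume Q: "Q \<in> projectors scl"
  have "(Q o\<^sub>L Q) = Q" by (rule blinfun_eqI) (simp add: projector_idem[OF Q])
  then show ?thesis by (simp add: mod_compact_refl)
qed

lemma fiber_iff: "Q \<in> fiber P \<longleftrightarrow> Q \<in> projectors scl \<and> Q \<simeq>\<^sub>K P"
  by (simp add: fiber_def mod_compact_def)

lemma conjugate_projector:
  assumes R: "R \<in> projectors scl" and V: "V \<in> bops" "W \<in> bops" "(W o\<^sub>L V) = id_blinfun"
  shows "(V o\<^sub>L (R o\<^sub>L W)) \<in> projectors scl"
proof -
  have "W (V x) = x" for x using V(3) by (metis blinfun_apply_blinfun_compose blinfun_apply_id_blinfun id_apply)
  moreover have "(V o\<^sub>L (R o\<^sub>L W)) \<in> bops" using V projectors_bops[OF R] by (intro bops_intros)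
  ultimately show ?thesis by (simp add: projectors_iff projector_idem[OF R])
qed

lemma continuous_on_compose_blinfun:
  assumes "continuous_on S f" "continuous_on S g"
  shows "continuous_on S (\<lambda>x. (f x o\<^sub>L g x :: 'a \<Rightarrow>\<^sub>L 'a))"
  by (rule bounded_bilinear.continuous_on[OF bounded_bilinear_blinfun_compose assms])

lemma continuous_map_calkin_idempotents_lift:
  assumes S: "compact (S :: 's::metric_space set)" and f: "continuous_map (top_of_set S) (calkin_idempotents scl) f"
  shows "\<exists>C. continuous_on S C \<and> (\<forall>x\<in>S. C x \<in> bops \<and> calkin_proj scl (C x) = f x \<and> (C x o\<^sub>L C x) \<simeq>\<^sub>K C x)"
proof -
  have f': "continuous_map (top_of_set S) (calkin_topology scl) f" "\<And>x. x \<in> S \<Longrightarrow> f x \<in> idempotents (calkin scl)"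
    using f unfolding calkin_idempotents_def continuous_map_in_subtopology by auto
  obtain C where C: "continuous_on S C" "\<And>x. x \<in> S \<Longrightarrow> C x \<in> bops" "\<And>x. x \<in> S \<Longrightarrow> calkin_proj scl (C x) = f x"
    using continuous_map_calkin_lift[OF S f'(1)] by blast
  have "(C x o\<^sub>L C x) \<simeq>\<^sub>K C x" if "x \<in> S" for x
    using f'(2)[OF that] C(2,3)[OF that] calkin_proj_idempotent_iff[OF C(2)[OF that]] by (simp add: mod_compact_def)
  then show ?thesis using C by blast
qed

lemma continuous_map_calkin_proj_projectors:
  assumes "continuous_on S C" "\<And>x. x \<in> S \<Longrightarrow> C x \<in> projectors scl"
  shows "continuous_map (top_of_set S) (calkin_idempotents scl) (\<lambda>x. calkin_proj scl (C x))"
  unfolding calkin_idempotents_def continuous_map_in_subtopology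
proof
  show "continuous_map (top_of_set S) (calkin_topology scl) (\<lambda>x. calkin_proj scl (C x))"
    using assms projectors_bops by (intro continuous_map_calkin_proj) auto
  have "calkin_proj scl (C x) \<in> idempotents (calkin scl)" if "x \<in> S" for x
    using calkin_proj_idempotent_iff[OF projectors_bops[OF assms(2)[OF that]]] projector_mod_compact[OF assms(2)[OF that]]
    by (simp add: mod_compact_def)
  then show "(\<lambda>x. calkin_proj scl (C x)) \<in> topspace (top_of_set S) \<rightarrow> idempotents (calkin scl)" by auto
qed

text \<open>Transport over a one-point parameter space. The selected lift agrees with
  \<open>P\<close> at 0 only modulo compact operators, which suffices for the congruence.\<close>

lemma loop_transport:
  assumes P: "P \<in> projectors scl" and a: "pathin (calkin_idempotents scl) a" "a 0 = calkin_proj scl P"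
  shows "\<exists>C V W. continuous_on {0..1} V \<and> continuous_on {0..1} W \<and> V 0 = id_blinfun \<and> W 0 = id_blinfun \<and>
    (\<forall>t\<in>{0..1}. C t \<in> bops \<and> calkin_proj scl (C t) = a t \<and> V t \<in> bops \<and> W t \<in> bops \<and>
      (V t o\<^sub>L W t) = id_blinfun \<and> (W t o\<^sub>L V t) = id_blinfun \<and> (V t o\<^sub>L P) \<simeq>\<^sub>K (C t o\<^sub>L V t))"
proof -
  obtain C where C: "continuous_on {0..1} C" "\<And>t. t \<in> {0..1} \<Longrightarrow> C t \<in> bops"
    "\<And>t. t \<in> {0..1} \<Longrightarrow> calkin_proj scl (C t) = a t" "\<And>t. t \<in> {0..1} \<Longrightarrow> (C t o\<^sub>L C t) \<simeq>\<^sub>K C t"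
    using continuous_map_calkin_idempotents_lift[OF compact_Icc a(1)[unfolded pathin_def]] by blast
  define C' where "C' x = C (fst x)" for x :: "real \<times> real"
  have C'_cont: "continuous_on ({0..1} \<times> {0}) C'"
    unfolding C'_def by (rule continuous_on_compose2[OF C(1)]) (auto intro!: continuous_intros)
  have "\<exists>V W. transports {0} C' V W"
    by (rule idempotent_transport[OF _ C'_cont]) (use C(2,4) in \<open>auto simp: C'_def\<close>)
  then obtain V W where VW: "transports {0} C' V W" by blast
  note v = transportsD[OF VW]
  have C0: "C 0 \<simeq>\<^sub>K P"
    using C(2,3)[of 0] a(2) projectors_bops[OF P] by (simp flip: calkin_proj_eq_iff')
  have slice: "continuous_on {0..1} (\<lambda>t. f (t, 0))" if "continuous_on ({0..1} \<times> {0}) f" for f :: "real \<times> real \<Rightarrow> 'a \<Rightarrow>\<^sub>L 'a"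
    by (rule continuous_on_compose2[OF that]) (auto intro!: continuous_intros)
  have "W (0, 0) = id_blinfun" using v(5)[of 0 0] v(8)[of 0] by (simp add: blinfun_compose_id)
  moreover have "(V (t, 0) o\<^sub>L P) \<simeq>\<^sub>K (C t o\<^sub>L V (t, 0))" if t: "t \<in> {0..1}" for t
  proof -
    have "(V (t, 0) o\<^sub>L P) \<simeq>\<^sub>K (V (t, 0) o\<^sub>L C 0)" by (rule mod_compact_left[OF mod_compact_sym[OF C0]])
    also have "\<dots> \<simeq>\<^sub>K (C t o\<^sub>L V (t, 0))" using v(7)[OF t, of 0] by (simp add: C'_def)
    finally show ?thesis .
  qed
  ultimately show ?thesis
    using slice[OF v(1)] slice[OF v(2)] v(3-6) v(8)[of 0] C(2,3)
    by (intro exI[of _ C] exI[of _ "\<lambda>t. V (t, 0)"] exI[of _ "\<lambda>t. W (t, 0)"]) auto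
qed

text \<open>The selected operators \<open>C t\<close> are idempotent only modulo compact operators;
  the conjugates \<open>V P W\<close> of \<open>P\<close> are exactly idempotent and congruent to
  them.\<close>

lemma path_lift_exists:
  assumes P: "P \<in> projectors scl" and a: "pathin (calkin_idempotents scl) a" "a 0 = calkin_proj scl P"
  shows "\<exists>b. lifts P a b"
proof -
  obtain C V W where V: "continuous_on {0..1} V" "continuous_on {0..1} W" "V 0 = id_blinfun" "W 0 = id_blinfun"
    "\<forall>t\<in>{0..1}. C t \<in> bops \<and> calkin_proj scl (C t) = a t \<and> V t \<in> bops \<and> W t \<in> bops \<and>
      (V t o\<^sub>L W t) = id_blinfun \<and> (W t o\<^sub>L V t) = id_blinfun \<and> (V t o\<^sub>L P) \<simeq>\<^sub>K (C t o\<^sub>L V t)"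
    using loop_transport[OF assms] by blast
  define b where "b t = (V t o\<^sub>L (P o\<^sub>L W t))" for t
  have bp: "b t \<in> projectors scl" if "t \<in> {0..1}" for t
    unfolding b_def using V(5) that by (intro conjugate_projector[OF P]) auto
  have "calkin_proj scl (b t) = a t" if t: "t \<in> {0..1}" for t
  proof -
    have v: "(V t o\<^sub>L W t) = id_blinfun" "(V t o\<^sub>L P) \<simeq>\<^sub>K (C t o\<^sub>L V t)" "C t \<in> bops" "calkin_proj scl (C t) = a t"
      using V(5) t by blast+
    have "b t = ((V t o\<^sub>L P) o\<^sub>L W t)" by (simp add: b_def blinfun_compose_assoc)
    also have "\<dots> \<simeq>\<^sub>K ((C t o\<^sub>L V t) o\<^sub>L W t)" by (rule mod_compact_right[OF v(2)])
    also have "\<dots> = C t" using v(1) by (simp add: blinfun_compose_assoc blinfun_compose_id)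
    finally show ?thesis using calkin_proj_eq_iff'[OF projectors_bops[OF bp[OF t]] v(3)] v(4) by simp
  qed
  moreover have "path b" unfolding path_def b_def
    by (intro continuous_on_compose_blinfun V(1,2) continuous_on_const)
  ultimately show ?thesis
    using bp V(3,4) unfolding lifts_def
    by (intro exI[of _ b]) (auto simp: b_def[of 0] blinfun_compose_id path_image_def)
qed

lemma loops_iff: "a \<in> loops X x0 \<longleftrightarrow> pathin X a \<and> a 0 = x0 \<and> a 1 = x0"
  by (simp add: loops_def)

text \<open>Conjugating a lift by the transport along the loop, with the end point of the transport undone,
  gives a path of projectors that stays in the fiber.\<close>
lemma lift_endpoint_unique:
  assumes P: "P \<in> projectors scl" and a: "a \<in> loops (calkin_idempotents scl) (calkin_proj scl P)"
    and b: "lifts P a b" and b': "lifts P a b'"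
  shows "path_component (fiber P) (b 1) (b' 1)"
proof -
  have a': "pathin (calkin_idempotents scl) a" "a 0 = calkin_proj scl P" "a 1 = calkin_proj scl P"
    using a by (auto simp: loops_iff)
  note Pb = projectors_bops[OF P]
  obtain C V W where V: "continuous_on {0..1} V" "continuous_on {0..1} W" "V 0 = id_blinfun" "W 0 = id_blinfun"
    "\<forall>t\<in>{0..1}. C t \<in> bops \<and> calkin_proj scl (C t) = a t \<and> V t \<in> bops \<and> W t \<in> bops \<and>
      (V t o\<^sub>L W t) = id_blinfun \<and> (W t o\<^sub>L V t) = id_blinfun \<and> (V t o\<^sub>L P) \<simeq>\<^sub>K (C t o\<^sub>L V t)"
    using loop_transport[OF P a'(1,2)] by blast
  have v: "C t \<in> bops" "calkin_proj scl (C t) = a t" "V t \<in> bops" "W t \<in> bops"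
    "(V t o\<^sub>L W t) = id_blinfun" "(W t o\<^sub>L V t) = id_blinfun" "(V t o\<^sub>L P) \<simeq>\<^sub>K (C t o\<^sub>L V t)" if "t \<in> {0..1}" for t
    using V(5) that by blast+
  have one: "(1::real) \<in> {0..1}" by simp
  have C1: "C 1 \<simeq>\<^sub>K P" using v(1,2)[OF one] a'(3) Pb by (simp flip: calkin_proj_eq_iff')
  have VW: "V t (W t x) = x" "W t (V t x) = x" if "t \<in> {0..1}" for t x
    using v(5,6)[OF that] by (metis blinfun_apply_blinfun_compose blinfun_apply_id_blinfun id_apply)+
  have main: "path_component (fiber P) (V 1 o\<^sub>L (P o\<^sub>L W 1)) (d 1)" if d: "lifts P a d" for d
  proof -
    \<comment> \<open>At 0 the conjugators are \<open>V 1\<close> and \<open>W 1\<close>, so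
      \<open>p\<close> starts at a point independent of the lift \<open>d\<close>; at 1 both are the
      identity, so \<open>p\<close> ends at \<open>d 1\<close>.\<close>
    define Y where "Y t = (V 1 o\<^sub>L W t)" for t
    define Z where "Z t = (V t o\<^sub>L W 1)" for t
    define p where "p t = (Y t o\<^sub>L (d t o\<^sub>L Z t))" for t
    have "p t \<in> fiber P" if t: "t \<in> {0..1}" for t
    proof -
      have YZ: "(Z t o\<^sub>L Y t) = id_blinfun" "(Y t o\<^sub>L Z t) = id_blinfun" "Y t \<in> bops" "Z t \<in> bops"
        unfolding Y_def Z_def using v(3,4)[OF t] v(3,4)[OF one] VW[OF t] VW[OF one]
        by (auto intro!: blinfun_eqI bops_intros)
      have "p t \<in> projectors scl"
        unfolding p_def using YZ by (intro conjugate_projector[OF lifts_projector[OF d t]])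
      have dC: "d t \<simeq>\<^sub>K C t"
        using d t v(1,2)[OF t] projectors_bops[OF lifts_projector[OF d t]]
        unfolding lifts_def by (simp flip: calkin_proj_eq_iff')
      have WC: "(W t o\<^sub>L C t) \<simeq>\<^sub>K (P o\<^sub>L W t)"
      proof -
        have "(W t o\<^sub>L C t) = ((W t o\<^sub>L (C t o\<^sub>L V t)) o\<^sub>L W t)"
          using VW[OF t] by (auto intro!: blinfun_eqI)
        also have "\<dots> \<simeq>\<^sub>K ((W t o\<^sub>L (V t o\<^sub>L P)) o\<^sub>L W t)"
          by (intro mod_compact_right mod_compact_left mod_compact_sym[OF v(7)[OF t]])
        also have "\<dots> = (P o\<^sub>L W t)" using VW[OF t] by (auto intro!: blinfun_eqI)
        finally show ?thesis .
      qed
      have "p t \<simeq>\<^sub>K (Y t o\<^sub>L (C t o\<^sub>L Z t))" unfolding p_def by (intro mod_compact_left mod_compact_right dC)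
      also have "\<dots> = (V 1 o\<^sub>L ((W t o\<^sub>L C t) o\<^sub>L Z t))" by (simp add: Y_def blinfun_compose_assoc)
      also have "\<dots> \<simeq>\<^sub>K (V 1 o\<^sub>L ((P o\<^sub>L W t) o\<^sub>L Z t))" by (intro mod_compact_left mod_compact_right WC)
      also have "\<dots> = ((V 1 o\<^sub>L P) o\<^sub>L W 1)" using VW[OF t] by (auto intro!: blinfun_eqI simp: Z_def)
      also have "\<dots> \<simeq>\<^sub>K ((C 1 o\<^sub>L V 1) o\<^sub>L W 1)" by (intro mod_compact_right v(7)[OF one])
      also have "\<dots> = C 1" using VW[OF one] by (auto intro!: blinfun_eqI)
      also have "\<dots> \<simeq>\<^sub>K P" by (rule C1)
      finally show ?thesis using \<open>p t \<in> projectors scl\<close> by (simp add: fiber_iff)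
    qed
    moreover have "path p" unfolding path_def p_def Y_def Z_def
      using d unfolding lifts_def path_def
      by (intro continuous_on_compose_blinfun V(1,2) continuous_on_const) blast
    moreover have "p 0 = (V 1 o\<^sub>L (P o\<^sub>L W 1))"
      using d unfolding lifts_def by (simp add: p_def Y_def Z_def V(3,4) blinfun_compose_id)
    moreover have "p 1 = d 1"
      using VW[OF one] by (auto intro!: blinfun_eqI simp: p_def Y_def Z_def)
    ultimately show ?thesis
      unfolding path_component_def by (intro exI[of _ p]) (auto simp: path_image_def pathstart_def pathfinish_def)
  qed
  show ?thesis using path_component_trans[OF path_component_sym[OF main[OF b]] main[OF b']] .
qed

text \<open>A lift of the homotopy that equals \<open>P\<close> on both sides where the homotopy is
  constant is transported in the homotopy parameter. The transport is the identity at the two ends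
  of the path, so conjugation by it turns a lift of \<open>a\<close> into a lift of
  \<open>a'\<close> with the same end point.\<close>

lemma homotopic_loops_lift:
  assumes P: "P \<in> projectors scl" and hom: "(a, a') \<in> loop_homotopy (calkin_idempotents scl) (calkin_proj scl P)"
  shows "\<exists>b b'. lifts P a b \<and> lifts P a' b' \<and> b 1 = b' 1"
proof -
  note Pb = projectors_bops[OF P]
  have loops: "a \<in> loops (calkin_idempotents scl) (calkin_proj scl P)"
    and h0: "homotopic_with (\<lambda>r. r 0 = calkin_proj scl P \<and> r 1 = calkin_proj scl P) (top_of_set {0..1}) (calkin_idempotents scl) a a'"
    using hom by (auto simp: loop_homotopy_def)
  then have "pathin (calkin_idempotents scl) a" "a 0 = calkin_proj scl P" by (auto simp: loops_iff)
  then obtain b where b: "lifts P a b" using path_lift_exists[OF P] by blast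
  obtain h where h: "continuous_map (top_of_set ({0..1} \<times> {0..1::real})) (calkin_idempotents scl) h"
    "\<And>t. h (0, t) = a t" "\<And>t. h (1, t) = a' t"
    "\<And>s. s \<in> {0..1::real} \<Longrightarrow> h (s, 0) = calkin_proj scl P" "\<And>s. s \<in> {0..1::real} \<Longrightarrow> h (s, 1) = calkin_proj scl P"
    using h0 unfolding homotopic_with_def prod_topology_subtopology_eu by blast
  let ?K = "{0..1::real} \<times> {0..1::real}"
  obtain C where C: "continuous_on ?K C" "\<And>x. x \<in> ?K \<Longrightarrow> C x \<in> bops" "\<And>x. x \<in> ?K \<Longrightarrow> calkin_proj scl (C x) = h x"
    using continuous_map_calkin_idempotents_lift[OF compact_Times[OF compact_Icc compact_Icc] h(1)] by blast
  have e: "C (s, 0) \<simeq>\<^sub>K P" "C (s, 1) \<simeq>\<^sub>K P" "C (s, 0) \<in> bops" "C (s, 1) \<in> bops" if "s \<in> {0..1}" for s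
    using that C(2)[of "(s, 0)"] C(2)[of "(s, 1)"] C(3)[of "(s, 0)"] C(3)[of "(s, 1)"] h(4,5)[OF that] Pb
    by (auto simp flip: calkin_proj_eq_iff')
  \<comment> \<open>The deviations of \<open>C\<close> from \<open>P\<close> on the two sides are
    compact; subtracting their linear interpolation makes \<open>D\<close> equal to \<open>P\<close>
    there and keeps all classes.\<close>
  define D where "D x = C x - ((1 - snd x) *\<^sub>R (C (fst x, 0) - P) + snd x *\<^sub>R (C (fst x, 1) - P))" for x
  have D01: "D (s, 0) = P" "D (s, 1) = P" for s by (simp_all add: D_def)
  have Db: "D x \<in> bops" if "x \<in> ?K" for x
    unfolding D_def using C(2)[OF that] e(3,4)[of "fst x"] that Pb by (intro bops_intros) auto
  have DC: "D x \<simeq>\<^sub>K C x" if "x \<in> ?K" for x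
  proof -
    have "compact_op ((1 - snd x) *\<^sub>R (C (fst x, 0) - P) + snd x *\<^sub>R (C (fst x, 1) - P))"
      using e(1,2)[of "fst x"] that by (intro compact_op_add compact_op_scaleR) (auto simp: mod_compact_def)
    then have "C x \<simeq>\<^sub>K D x" by (simp add: mod_compact_def D_def add.commute)
    then show ?thesis by (rule mod_compact_sym)
  qed
  have Dproj: "calkin_proj scl (D x) = h x" if "x \<in> ?K" for x
    using DC[OF that] C(2,3)[OF that] Db[OF that] calkin_proj_eq_iff' by metis
  have idem: "(D x o\<^sub>L D x) \<simeq>\<^sub>K D x" if x: "x \<in> ?K" for x
  proof -
    have "h x \<in> idempotents (calkin scl)"
      using h(1) x unfolding calkin_idempotents_def continuous_map_in_subtopology by auto
    then show ?thesis using calkin_proj_idempotent_iff[OF Db[OF x]] Dproj[OF x] by (simp add: mod_compact_def)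
  qed
  have "continuous_on ?K D"
    unfolding D_def
  proof (intro continuous_intros C(1))
    show "continuous_on ?K (\<lambda>x. C (fst x, 0))" "continuous_on ?K (\<lambda>x. C (fst x, 1))"
      by (rule continuous_on_compose2[OF C(1)]; auto intro!: continuous_intros)+
  qed
  then have "\<exists>V W. transports {0..1} D V W"
    by (intro idempotent_transport[OF compact_Icc] conjI Db idem) auto
  then obtain V W where VW: "transports {0..1} D V W" by blast
  note v = transportsD[OF VW]
  have one: "(1::real) \<in> {0..1}" by simp
  define V1 W1 where "V1 t = V (1, t)" and "W1 t = W (1, t)" for t :: real
  have v1: "V1 t \<in> bops" "W1 t \<in> bops" "(V1 t o\<^sub>L W1 t) = id_blinfun" "(W1 t o\<^sub>L V1 t) = id_blinfun"
    "(V1 t o\<^sub>L D (0, t)) \<simeq>\<^sub>K (D (1, t) o\<^sub>L V1 t)" if "t \<in> {0..1}" for t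
    unfolding V1_def W1_def using v(3-7)[OF one that] by auto
  have cont: "continuous_on {0..1} V1" "continuous_on {0..1} W1"
    unfolding V1_def W1_def
    by (rule continuous_on_compose2[OF v(1)] continuous_on_compose2[OF v(2)]; auto intro!: continuous_intros)+
  have ends: "V1 0 = id_blinfun" "V1 1 = id_blinfun"
    unfolding V1_def using v(9)[of 1 0] v(9)[of 1 1] D01 by auto
  then have ends': "W1 0 = id_blinfun" "W1 1 = id_blinfun"
    using v1(3)[of 0] v1(3)[of 1] by (auto simp: blinfun_compose_id)
  define b' where "b' t = (V1 t o\<^sub>L (b t o\<^sub>L W1 t))" for t
  have b'p: "b' t \<in> projectors scl" if "t \<in> {0..1}" for t
    unfolding b'_def using v1[OF that] by (intro conjugate_projector[OF lifts_projector[OF b that]])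
  have "calkin_proj scl (b' t) = a' t" if t: "t \<in> {0..1}" for t
  proof -
    have K: "(0, t) \<in> ?K" "(1, t) \<in> ?K" using t by auto
    have "calkin_proj scl (b t) = calkin_proj scl (D (0, t))"
      using b t Dproj[OF K(1)] h(2) by (auto simp: lifts_def)
    then have bD: "b t \<simeq>\<^sub>K D (0, t)"
      using calkin_proj_eq_iff'[OF projectors_bops[OF lifts_projector[OF b t]] Db[OF K(1)]] by simp
    have "b' t \<simeq>\<^sub>K (V1 t o\<^sub>L (D (0, t) o\<^sub>L W1 t))" unfolding b'_def by (intro mod_compact_left mod_compact_right bD)
    also have "\<dots> = ((V1 t o\<^sub>L D (0, t)) o\<^sub>L W1 t)" by (simp add: blinfun_compose_assoc)
    also have "\<dots> \<simeq>\<^sub>K ((D (1, t) o\<^sub>L V1 t) o\<^sub>L W1 t)" by (intro mod_compact_right v1(5)[OF t])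
    also have "\<dots> = D (1, t)" using v1(3)[OF t] by (simp add: blinfun_compose_assoc blinfun_compose_id)
    finally show ?thesis
      using calkin_proj_eq_iff'[OF projectors_bops[OF b'p[OF t]] Db[OF K(2)]] Dproj[OF K(2)] h(3) by simp
  qed
  moreover have "path b'"
    using b unfolding lifts_def path_def b'_def by (intro continuous_on_compose_blinfun cont) blast
  moreover have "b' 0 = P" "b' 1 = b 1"
    using b by (simp_all add: b'_def ends ends' blinfun_compose_id lifts_def)
  ultimately have "lifts P a' b'" using b'p by (auto simp: lifts_def path_image_def)
  then show ?thesis using b \<open>b' 1 = b 1\<close> by metis
qed

section \<open>Values, image and injectivity of the index homomorphism\<close>

lemma lift_end_in_fiber:
  assumes P: "P \<in> projectors scl" and a: "a \<in> loops (calkin_idempotents scl) (calkin_proj scl P)" and b: "lifts P a b"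
  shows "b 1 \<in> fiber P"
proof -
  have "b 1 \<in> projectors scl" by (rule lifts_projector[OF b]) simp
  moreover have "calkin_proj scl (b 1) = calkin_proj scl P" using a b by (simp add: lifts_def loops_iff)
  ultimately show ?thesis using calkin_proj_eq_iff' projectors_bops P by (simp add: fiber_iff)
qed

section \<open>Homotopy classes of loops\<close>

lemma loop_homotopy_refl: "a \<in> loops X x0 \<Longrightarrow> (a, a) \<in> loop_homotopy X x0"
  by (simp add: loop_homotopy_def loops_iff pathin_def)

lemma loop_homotopy_sym: "(a, b) \<in> loop_homotopy X x0 \<Longrightarrow> (b, a) \<in> loop_homotopy X x0"
  by (auto simp: loop_homotopy_def intro: homotopic_with_symD)

lemma loop_homotopy_trans:
  "(a, b) \<in> loop_homotopy X x0 \<Longrightarrow> (b, c) \<in> loop_homotopy X x0 \<Longrightarrow> (a, c) \<in> loop_homotopy X x0"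
  by (auto simp: loop_homotopy_def intro: homotopic_with_trans)

lemma loop_homotopy_class_eq:
  assumes "(a, b) \<in> loop_homotopy X x0"
  shows "loop_homotopy X x0 `` {a} = loop_homotopy X x0 `` {b}"
  using loop_homotopy_trans[OF assms] loop_homotopy_trans[OF loop_homotopy_sym[OF assms]] by blast

text \<open>This is well-definedness: homotopic loops have lifts with a common end point, two lifts
  of one loop end in the same path component of the fiber, and the relative dimension is constant on
  it.\<close>

lemma phi_class:
  assumes P: "P \<in> projectors scl" and a: "a \<in> loops (calkin_idempotents scl) (calkin_proj scl P)" and b: "lifts P a b"
  shows "phi scl P (loop_homotopy (calkin_idempotents scl) (calkin_proj scl P) `` {a})
    = relative_dim scl (rg (b 1)) (rg P)"
  unfolding phi_def
proof (rule the_equality)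
  let ?H = "loop_homotopy (calkin_idempotents scl) (calkin_proj scl P)"
  have "a \<in> ?H `` {a}" using loop_homotopy_refl[OF a] by simp
  moreover have "path b \<and> path_image b \<subseteq> projectors scl \<and> b 0 = P \<and> (\<forall>t\<in>{0..1}. calkin_proj scl (b t) = a t)"
    using b unfolding lifts_def .
  moreover have "relative_dim scl (rg (b 1)) (rg P)
      = relative_dim scl (rg (b 1)) (rg (b 0))"
    using b by (simp add: lifts_def)
  ultimately show "\<exists>a\<in>?H `` {a}. \<exists>b'. path b' \<and> path_image b' \<subseteq> projectors scl \<and> b' 0 = P \<and>
      (\<forall>t\<in>{0..1}. calkin_proj scl (b' t) = a t) \<and>
      relative_dim scl (rg (b 1)) (rg P)
        = relative_dim scl (rg (b' 1)) (rg (b' 0))"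
    by blast
  fix m
  assume "\<exists>a\<in>?H `` {a}. \<exists>b. path b \<and> path_image b \<subseteq> projectors scl \<and> b 0 = P \<and>
      (\<forall>t\<in>{0..1}. calkin_proj scl (b t) = a t) \<and>
      m = relative_dim scl (rg (b 1)) (rg (b 0))"
  then obtain a' b' where a': "(a, a') \<in> ?H" and b': "lifts P a' b'"
    and m: "m = relative_dim scl (rg (b' 1)) (rg (b' 0))"
    unfolding lifts_def by blast
  have b'0: "b' 0 = P" using b' by (simp add: lifts_def)
  have loop': "a' \<in> loops (calkin_idempotents scl) (calkin_proj scl P)" using a' by (simp add: loop_homotopy_def)
  obtain d d' where d: "lifts P a d" "lifts P a' d'" "d 1 = d' 1" using homotopic_loops_lift[OF P a'] by blast
  have "path_component (fiber P) (b 1) (b' 1)"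
    using path_component_trans[OF lift_endpoint_unique[OF P a b d(1)]] lift_endpoint_unique[OF P loop' d(2) b'] d(3) by simp
  then show "m = relative_dim scl (rg (b 1)) (rg P)"
    using relative_dim_path_component[OF P] m b'0 by simp
qed

text \<open>With the intertwiner \<open>id + A\<close> of \<open>Q\<close> and \<open>Q'\<close>,
  conjugation of \<open>Q\<close> by \<open>id + t A\<close> gives a path from \<open>Q\<close> to
  \<open>Q'\<close>.\<close>

lemma projectors_locally_path_connected:
  assumes Q: "Q \<in> projectors scl"
  shows "\<exists>e>0. \<forall>Q'\<in>projectors scl. dist Q' Q < e \<longrightarrow> path_component (projectors scl) Q Q'"
proof -
  define B where "B = 2 *\<^sub>R Q - id_blinfun"
  have Bb: "B \<in> bops" unfolding B_def using projectors_bops[OF Q] by (intro bops_intros)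
  have B: "norm B + 1 > 0" by (simp add: add_nonneg_pos)
  show ?thesis
  proof (intro exI[of _ "1 / (2 * (norm B + 1))"] conjI ballI impI)
    show "1 / (2 * (norm B + 1)) > 0" using B by simp
    fix Q' assume Q': "Q' \<in> projectors scl" and d: "dist Q' Q < 1 / (2 * (norm B + 1))"
    define A where "A = ((Q' - Q) o\<^sub>L B)"
    have Ab: "A \<in> bops" unfolding A_def using projectors_bops[OF Q] projectors_bops[OF Q'] Bb by (intro bops_intros)
    have "norm A \<le> norm (Q' - Q) * norm B" unfolding A_def by (rule norm_blinfun_compose)
    also have "\<dots> \<le> norm (Q' - Q) * (norm B + 1)" by (intro mult_left_mono) auto
    also have "\<dots> \<le> 1 / 2" using d B by (simp add: dist_norm field_simps)
    finally have A: "norm A \<le> 1/2" .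
    have tA: "t *\<^sub>R A \<in> bops \<and> norm (t *\<^sub>R A) \<le> 1/2" if "t \<in> {0..1}" for t
    proof
      show "t *\<^sub>R A \<in> bops" by (rule scaleR_in_bounded_ops[OF Ab])
      have "\<bar>t\<bar> * norm A \<le> 1 * norm A" using that by (intro mult_right_mono) auto
      then show "norm (t *\<^sub>R A) \<le> 1/2" using A by simp
    qed
    have tA_cont: "continuous_on {0..1} (\<lambda>t. t *\<^sub>R A)" by (intro continuous_intros)
    obtain W where W: "continuous_on {0..1} W" "\<And>t. t \<in> {0..1} \<Longrightarrow> W t \<in> bops"
      "\<And>t. t \<in> {0..1} \<Longrightarrow> (W t o\<^sub>L (id_blinfun + t *\<^sub>R A)) = id_blinfun"
      "\<And>t. t \<in> {0..1} \<Longrightarrow> ((id_blinfun + t *\<^sub>R A) o\<^sub>L W t) = id_blinfun"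
      using continuous_inverse[OF tA_cont tA] by blast
    define p where "p t = ((id_blinfun + t *\<^sub>R A) o\<^sub>L (Q o\<^sub>L W t))" for t :: real
    have "p t \<in> projectors scl" if "t \<in> {0..1}" for t
      unfolding p_def using W(2,3)[OF that] tA[OF that] by (intro conjugate_projector[OF Q] bops_add bops_id) auto
    moreover have "path p" unfolding path_def p_def
      by (intro continuous_on_compose_blinfun W(1) continuous_intros)
    moreover have "p 0 = Q" using W(3)[of 0] by (simp add: p_def blinfun_compose_id)
    moreover have "((id_blinfun + A) o\<^sub>L Q) = (Q' o\<^sub>L (id_blinfun + A))"
      by (rule blinfun_eqI) (simp add: A_def B_def blinfun_linear_simps projector_idem[OF Q] projector_idem[OF Q'] scaleR_2)
    then have "p 1 = Q'" using W(4)[of 1]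
      by (simp add: p_def flip: blinfun_compose_assoc) (simp add: blinfun_compose_assoc blinfun_compose_id)
    ultimately show "path_component (projectors scl) Q Q'"
      unfolding path_component_def by (intro exI[of _ p]) (auto simp: path_image_def pathstart_def pathfinish_def)
  qed
qed

text \<open>The path component is a locally constant function of the projector, hence constant on
  connected sets. This supplies the path that is projected to a loop.\<close>

lemma connected_component_projectors:
  assumes Q: "Q \<in> connected_component_set (projectors scl) P"
  shows "path_component (projectors scl) P Q"
proof -
  have PQ: "connected_component (projectors scl) P Q" using Q by simp
  then have P: "P \<in> projectors scl" using connected_component_in by metis
  define f where "f R = path_component_set (projectors scl) R" for R
  have "f P = f Q"
  proof (rule connected_local_const[OF connected_connected_component[of "projectors scl" P]])
    show "P \<in> connected_component_set (projectors scl) P" "Q \<in> connected_component_set (projectors scl) P"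
      using P Q connected_component_refl by auto
    show "\<forall>R\<in>connected_component_set (projectors scl) P.
        eventually (\<lambda>R'. f R = f R') (at R within connected_component_set (projectors scl) P)"
    proof
      fix R assume "R \<in> connected_component_set (projectors scl) P"
      then have "R \<in> projectors scl" using connected_component_subset by blast
      then obtain e where e: "e > 0" "\<And>R'. R' \<in> projectors scl \<Longrightarrow> dist R' R < e \<Longrightarrow> path_component (projectors scl) R R'"
        using projectors_locally_path_connected by blast
      show "eventually (\<lambda>R'. f R = f R') (at R within connected_component_set (projectors scl) P)"
        unfolding eventually_at
      proof (intro exI[of _ e] conjI ballI impI e(1))
        fix R' assume "R' \<in> connected_component_set (projectors scl) P" "R' \<noteq> R \<and> dist R' R < e"
        then have "path_component (projectors scl) R R'" using e(2) connected_component_subset by blast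
        then show "f R = f R'" unfolding f_def by (metis mem_Collect_eq path_component_eq)
      qed
    qed
  qed
  moreover have "Q \<in> f Q"
    unfolding f_def mem_Collect_eq using connected_component_in[OF PQ] by (intro path_component_refl) blast
  ultimately show ?thesis unfolding f_def by (metis mem_Collect_eq)
qed

lemma phi_image:
  assumes P: "P \<in> projectors scl"
  shows "m \<in> phi scl P ` pi1 (calkin_idempotents scl) (calkin_proj scl P) \<longleftrightarrow>
    (\<exists>Q \<in> connected_component_set (projectors scl) P. compact_op (Q - P) \<and>
      relative_dim scl (rg Q) (rg P) = m)"
proof
  assume "m \<in> phi scl P ` pi1 (calkin_idempotents scl) (calkin_proj scl P)"
  then obtain a where a: "a \<in> loops (calkin_idempotents scl) (calkin_proj scl P)"
    and m: "m = phi scl P (loop_homotopy (calkin_idempotents scl) (calkin_proj scl P) `` {a})"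
    unfolding pi1_def by (blast elim: quotientE)
  have "pathin (calkin_idempotents scl) a" "a 0 = calkin_proj scl P" using a by (auto simp: loops_iff)
  then obtain b where b: "lifts P a b" using path_lift_exists[OF P] by blast
  have "m = relative_dim scl (rg (b 1)) (rg P)" using m phi_class[OF P a b] by simp
  moreover have "compact_op (b 1 - P)" using lift_end_in_fiber[OF P a b] by (rule fiberD(2))
  moreover have "path_component (projectors scl) P (b 1)"
    using b unfolding path_component_def lifts_def pathstart_def pathfinish_def by blast
  then have "b 1 \<in> connected_component_set (projectors scl) P" using path_component_subset_connected_component by fastforce
  ultimately show "\<exists>Q \<in> connected_component_set (projectors scl) P. compact_op (Q - P) \<and>
      relative_dim scl (rg Q) (rg P) = m" by blast
next
  assume "\<exists>Q \<in> connected_component_set (projectors scl) P. compact_op (Q - P) \<and>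
      relative_dim scl (rg Q) (rg P) = m"
  then obtain Q where Q: "Q \<in> connected_component_set (projectors scl) P" "compact_op (Q - P)"
    "relative_dim scl (rg Q) (rg P) = m" by blast
  obtain b where b: "path b" "path_image b \<subseteq> projectors scl" "b 0 = P" "b 1 = Q"
    using connected_component_projectors[OF Q(1)] unfolding path_component_def pathstart_def pathfinish_def by blast
  define a where "a t = calkin_proj scl (b t)" for t
  have lift: "lifts P a b" unfolding lifts_def using b by (simp add: a_def)
  have "Q \<in> projectors scl" using Q(1) connected_component_subset by blast
  then have QP: "calkin_proj scl Q = calkin_proj scl P"
    using Q(2) P projectors_bops by (simp add: calkin_proj_eq_iff)
  have "pathin (calkin_idempotents scl) a"
    unfolding pathin_def a_def using b(1) lifts_projector[OF lift]
    by (intro continuous_map_calkin_proj_projectors) (auto simp: path_def)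
  then have a: "a \<in> loops (calkin_idempotents scl) (calkin_proj scl P)"
    using b(3,4) QP by (simp add: loops_iff a_def)
  have "m = phi scl P (loop_homotopy (calkin_idempotents scl) (calkin_proj scl P) `` {a})"
    using phi_class[OF P a lift] Q(3) b(4) by simp
  moreover have "loop_homotopy (calkin_idempotents scl) (calkin_proj scl P) `` {a} \<in> pi1 (calkin_idempotents scl) (calkin_proj scl P)"
    unfolding pi1_def using a by (rule quotientI)
  ultimately show "m \<in> phi scl P ` pi1 (calkin_idempotents scl) (calkin_proj scl P)" by blast
qed

text \<open>The second loop runs at double speed and waits at the base point: this is the projection
  of a lift joined to a path in the fiber.\<close>

lemma loop_homotopy_stop_early:
  assumes a: "a \<in> loops X x0"
  shows "homotopic_with (\<lambda>r. r 0 = x0 \<and> r 1 = x0) (top_of_set {0..1}) X a (\<lambda>t. a (min 1 (2 * t)))"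
proof -
  have a': "continuous_map (top_of_set {0..1}) X a" "a 0 = x0" "a 1 = x0"
    using a by (auto simp: loops_iff pathin_def)
  \<comment> \<open>\<open>a\<close> is arbitrary outside the unit interval, so it is replaced by
    the map that the homotopy below has at parameter 0 for every argument.\<close>
  have "homotopic_with (\<lambda>r. r 0 = x0 \<and> r 1 = x0) (top_of_set {0..1}) X a (\<lambda>t. a (min 1 t))"
    by (rule homotopic_with_equal) (use a' in auto)
  moreover have "homotopic_with (\<lambda>r. r 0 = x0 \<and> r 1 = x0) (top_of_set {0..1}) X (\<lambda>t. a (min 1 t)) (\<lambda>t. a (min 1 (2 * t)))"
    unfolding homotopic_with_def prod_topology_subtopology_eu
  proof (intro exI[of _ "\<lambda>(s, t). a (min 1 ((1 + s) * t))"] conjI allI ballI)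
    have "continuous_map (top_of_set ({0..1} \<times> {0..1})) (top_of_set {0..1})
        (\<lambda>x :: real \<times> real. min 1 ((1 + fst x) * snd x))"
      by (auto intro!: continuous_intros)
    from continuous_map_compose[OF this a'(1)]
    show "continuous_map (top_of_set ({0..1} \<times> {0..1})) X (\<lambda>(s, t). a (min 1 ((1 + s) * t)))"
      by (simp add: o_def case_prod_unfold)
  qed (use a' in auto)
  ultimately show ?thesis by (rule homotopic_with_trans)
qed

text \<open>Lifts of two loops with the same index end in the same path component of the fiber; joining the end
  points there gives two homotopic paths, whose images in the Calkin algebra are the given loops up to
  a stop.\<close>
lemma phi_injective:
  assumes P: "P \<in> projectors scl" and sc: "simply_connected (connected_component_set (projectors scl) P)"
  shows "inj_on (phi scl P) (pi1 (calkin_idempotents scl) (calkin_proj scl P))"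
proof (rule inj_onI)
  let ?X = "calkin_idempotents scl" and ?x = "calkin_proj scl P" and ?S = "connected_component_set (projectors scl) P"
  let ?end = "\<lambda>r. r 0 = ?x \<and> r (1::real) = ?x"
  fix c1 c2 assume "c1 \<in> pi1 ?X ?x" "c2 \<in> pi1 ?X ?x" and eq: "phi scl P c1 = phi scl P c2"
  then obtain a1 a2 where a1: "a1 \<in> loops ?X ?x" "c1 = loop_homotopy ?X ?x `` {a1}"
    and a2: "a2 \<in> loops ?X ?x" "c2 = loop_homotopy ?X ?x `` {a2}"
    unfolding pi1_def by (metis quotientE)
  have "pathin ?X a1" "a1 0 = ?x" "pathin ?X a2" "a2 0 = ?x" using a1 a2 by (auto simp: loops_iff)
  then obtain b1 b2 where b1: "lifts P a1 b1" and b2: "lifts P a2 b2" using path_lift_exists[OF P] by blast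
  have "path_component (fiber P) (b1 1) (b2 1)"
    using path_component_fiber_iff[OF P lift_end_in_fiber[OF P a1(1) b1] lift_end_in_fiber[OF P a2(1) b2]]
      phi_class[OF P a1(1) b1] phi_class[OF P a2(1) b2] eq a1(2) a2(2) by simp
  then obtain g where g: "path g" "path_image g \<subseteq> fiber P" "pathstart g = b1 1" "pathfinish g = b2 1"
    unfolding path_component_def by blast
  have sub: "path_image b \<subseteq> ?S" if "path b" "path_image b \<subseteq> projectors scl" "pathstart b \<in> ?S" for b
  proof -
    have "path_image b \<subseteq> connected_component_set (projectors scl) (pathstart b)"
      by (rule connected_component_maximal[OF pathstart_in_path_image connected_path_image[OF that(1)] that(2)])
    also have "\<dots> = ?S" using that(3) by (metis connected_component_eq)
    finally show ?thesis .
  qed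
  have pb: "path b1" "path_image b1 \<subseteq> projectors scl" "pathstart b1 = P"
    "path b2" "path_image b2 \<subseteq> projectors scl" "pathstart b2 = P"
    using b1 b2 by (auto simp: lifts_def pathstart_def)
  have PS: "P \<in> ?S" using P connected_component_refl by auto
  have S1: "path_image b1 \<subseteq> ?S" and S2: "path_image b2 \<subseteq> ?S" using sub pb PS by auto
  have "pathfinish b1 \<in> ?S" using S1 pathfinish_in_path_image by blast
  then have Sg: "path_image g \<subseteq> ?S"
    using sub[OF g(1)] g(2,3) by (auto simp: fiber_def pathfinish_def)
  define q where "q = b1 +++ g"
  have q: "path q" "path_image q \<subseteq> ?S" "pathstart q = P" "pathfinish q = pathfinish b2"
    unfolding q_def using pb g Sg S1
    by (auto simp: path_image_join pathfinish_def[of b1] pathfinish_def[of b2])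
  have "homotopic_paths ?S q b2"
    using sc q pb S2 unfolding simply_connected_eq_homotopic_paths by auto
  then have hom: "homotopic_with (\<lambda>r. pathstart r = P \<and> pathfinish r = pathfinish b2) (top_of_set {0..1}) (top_of_set ?S) q b2"
    unfolding homotopic_paths_def q(3,4) .
  have "?S \<subseteq> projectors scl" by (rule connected_component_subset)
  then have proj: "continuous_map (top_of_set ?S) ?X (calkin_proj scl)"
    using continuous_map_calkin_proj_projectors[of ?S "\<lambda>x. x"] by (auto simp: continuous_on_id)
  have end2: "calkin_proj scl (pathfinish b2) = ?x" using b2 a2(1) by (auto simp: lifts_def loops_iff pathfinish_def)
  have q_b2: "homotopic_with ?end (top_of_set {0..1}) ?X (calkin_proj scl \<circ> q) (calkin_proj scl \<circ> b2)"
    by (rule homotopic_with_compose_continuous_map_left[OF hom proj]) (use end2 in \<open>auto simp: pathstart_def pathfinish_def\<close>)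
  have a1_q: "homotopic_with ?end (top_of_set {0..1}) ?X a1 (calkin_proj scl \<circ> q)"
  proof (rule homotopic_with_trans[OF loop_homotopy_stop_early[OF a1(1)] homotopic_with_equal])
    show "continuous_map (top_of_set {0..1}) ?X (\<lambda>t. a1 (min 1 (2 * t)))"
      using homotopic_with_imp_continuous_maps[OF loop_homotopy_stop_early[OF a1(1)]] by blast
    have a1_ends: "a1 0 = ?x" "a1 1 = ?x" using a1(1) by (auto simp: loops_iff)
    then show "?end (\<lambda>t. a1 (min 1 (2 * t)))" by simp
    fix t :: real assume "t \<in> topspace (top_of_set {0..1})"
    then have t: "t \<in> {0..1}" by simp
    show "a1 (min 1 (2 * t)) = (calkin_proj scl \<circ> q) t"
    proof (cases "t \<le> 1/2")
      case True
      then show ?thesis using b1 t by (simp add: q_def joinpaths_def lifts_def)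
    next
      case False
      \<comment> \<open>The second half of \<open>q\<close> stays in the fiber and projects to the
        base point.\<close>
      then have "g (2 * t - 1) \<in> fiber P" using g(2) t by (auto simp: path_image_def)
      then have "calkin_proj scl (g (2 * t - 1)) = ?x"
        using P projectors_bops by (simp add: fiber_iff calkin_proj_eq_iff')
      then show ?thesis using False a1_ends by (simp add: q_def joinpaths_def)
    qed
  next
    show "?end (calkin_proj scl \<circ> q)" using q(3,4) end2 by (simp add: pathstart_def pathfinish_def)
  qed
  have b2_a2: "homotopic_with ?end (top_of_set {0..1}) ?X (calkin_proj scl \<circ> b2) a2"
  proof (rule homotopic_with_equal)
    show "continuous_map (top_of_set {0..1}) ?X (calkin_proj scl \<circ> b2)"
      using homotopic_with_imp_continuous_maps[OF q_b2] by blast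
  qed (use b2 a2(1) in \<open>auto simp: lifts_def loops_iff\<close>)
  have "homotopic_with ?end (top_of_set {0..1}) ?X a1 a2"
    by (rule homotopic_with_trans[OF homotopic_with_trans[OF a1_q q_b2] b2_a2])
  then have "(a1, a2) \<in> loop_homotopy ?X ?x" using a1(1) a2(1) by (simp add: loop_homotopy_def)
  then show "c1 = c2" unfolding a1(2) a2(2) by (rule loop_homotopy_class_eq)
qed

end

theorem corollary8p2:
  fixes scl :: "'k::{real_normed_field, euclidean_space} \<Rightarrow> 'a::banach \<Rightarrow> 'a"
    and P :: "'a \<Rightarrow>\<^sub>L 'a"
  assumes "banach_space_over scl"
    and "P \<in> projectors scl"
  shows "(\<forall>m. m \<in> phi scl P ` pi1 (calkin_idempotents scl) (calkin_proj scl P) \<longleftrightarrow>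
            (\<exists>Q \<in> connected_component_set (projectors scl) P. compact_op (Q - P) \<and>
               relative_dim scl (range (blinfun_apply Q)) (range (blinfun_apply P)) = m)) \<and>
         (simply_connected (connected_component_set (projectors scl) P) \<longrightarrow>
            inj_on (phi scl P) (pi1 (calkin_idempotents scl) (calkin_proj scl P)))"
proof -
  interpret banach_space_over scl by (rule assms(1))
  show ?thesis using phi_image[OF assms(2)] phi_injective[OF assms(2)] by blast
qed

end
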